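(* Let $\mathcal T$ be a field theory with set $\mathcal E(\mathcal T)$ of half-edge types, set $\mathcal V(\mathcal T)$ of vertex types and set $\widetilde{\mathcal V}(\mathcal T)$ of refined vertex types. Let $\widetilde{\mathcal H}_{\mathcal T}$ be the vector space generated by the specified graphs $\bar\Gamma=(\Gamma,\underline i)$ of $\mathcal T$, with product given by concatenation (disjoint union), unit $\mathbf 1$ the empty graph, and coproduct $$\Delta(\bar\Gamma)=\sum_{\bar\gamma\subseteq\bar\Gamma,\ \bar\Gamma/\bar\gamma\in\mathcal T}\bar\gamma\otimes\bar\Gamma/\bar\gamma ,$$ where the sum runs over all locally 1PI specified covering subgraphs $\bar\gamma=(\gamma,\underline j)$ of $\bar\Gamma=(\Gamma,\underline i)$ such that the contracted specified graph $\bar\Gamma/\bar\gamma=(\Gamma/(\gamma,\underline j),\underline i)$ is in the theory $\mathcal T$. Then $\widetilde{\mathcal H}_{\mathcal T}$, equipped with $\Delta$, is a bialgebra.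
   Context: Graphs. A (Feynman) graph $\Gamma$ consists of a finite set $\mathcal V(\Gamma)$ of vertices, a finite set $\mathcal E(\Gamma)$ of half-edges, an involution $\sigma_\Gamma:\mathcal E(\Gamma)\to\mathcal E(\Gamma)$ and a map $\partial:\mathcal E(\Gamma)\to\mathcal V(\Gamma)$. For a vertex $v$, $st(v)=\{e:\partial(e)=v\}$. Fixed points of $\sigma_\Gamma$ are the external edges; pairs $\{e,\sigma_\Gamma(e)\}$ with $e\ne\sigma_\Gamma(e)$ are the internal edges. Cutting an internal edge means modifying $\sigma_\Gamma$ so that its two half-edges become fixed points. $\pi_0(\Gamma)$ is the set of connected components. A graph is 1PI if it is connected and remains connected when any one internal edge is cut; it is locally 1PI if each connected component is 1PI (the empty graph is locally 1PI). A covering subgraph $\gamma$ of $\Gamma$ is a graph obtained from $\Gamma$ by cutting some (possibly no, possibly all) internal edges; it has the same vertices and half-edges. The contracted graph $\Gamma/\gamma$ has as vertices the connected components of $\gamma$, as half-edges the fixed points of $\sigma_\gamma$, as involution the restriction of $\sigma_\Gamma$, and a half-edge $e$ is attached to the component of $\gamma$ containing $\partial(e)$. The residue is $\mathrm{res}\,\Gamma=\Gamma/\Gamma$. Theory. Every half-edge carries a type in $\mathcal E(\mathcal T)$, and $\sigma_\Gamma$ preserves types. A vertex type is a function $\mathcal E(\mathcal T)\to\mathbb N$ (the number of half-edges of each type at the vertex); $\mathcal V(\mathcal T)$ is a prescribed set of vertex types. $\widetilde{\mathcal V}(\mathcal T)$ is a set of pairs $\tilde t=(t,k)$ with $t\in\mathcal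 V(\mathcal T)$ and $k\in\mathbb N$, every $t$ occurring with at least one and only finitely many $k$. In a graph of $\mathcal T$ each vertex $v$ carries a refined type $(t,k)\in\widetilde{\mathcal V}(\mathcal T)$, where $t$ is the type of $v$ determined by the half-edges in $st(v)$. A locally 1PI graph is superficially divergent if the residue of each of its components is a vertex whose type lies in $\mathcal V(\mathcal T)$. Specified graphs. A specified graph of $\mathcal T$ is a pair $\bar\Gamma=(\Gamma,\underline i)$ where $\Gamma$ is a locally 1PI superficially divergent graph of $\mathcal T$ and $\underline i:\pi_0(\Gamma)\to\mathbb N$ is such that for each component $\Gamma_0$, if $t$ is the type of the vertex $\mathrm{res}\,\Gamma_0$, then $(t,\underline i(\Gamma_0))\in\widetilde{\mathcal V}(\mathcal T)$; if $\Gamma_0$ is a single vertex of refined type $(t,k)$ without internal edges, then $\underline i(\Gamma_0)=k$. A specified graph $(\gamma,\underline j)$ is a specified covering subgraph of $(\Gamma,\underline i)$, written $(\gamma,\underline j)\subseteq(\Gamma,\underline i)$, if $\gamma$ is a covering subgraph of $\Gamma$ (vertices keeping their refined types) and $\underline j(\gamma_0)=\underline i(\gamma_0)$ whenever the component $\gamma_0$ of $\gamma$ is also a full connected component of $\Gamma$. The contracted specified graph is $\bar\Gamma/\bar\gamma=(\Gamma/\bar\gamma,\underline i)$, where $\Gamma/\bar\gamma$ is $\Gamma/\gamma$ with the vertex coming from a component $\gamma_0$ of $\gamma$ given the refined type $(t,\underline j(\gamma_0))$, $t$ being the type of $\mathrm{res}\,\gamma_0$ (the components of $\Gamma/\gamma$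 being identified with those of $\Gamma$). It is in $\mathcal T$ if all its vertices have refined type in $\widetilde{\mathcal V}(\mathcal T)$. Specified graphs are taken up to isomorphism (preserving half-edge types, refined vertex types and specification). The base field is $\mathbb C$; a basis of $\widetilde{\mathcal H}_{\mathcal T}$ is given by the isomorphism classes of specified graphs, including the empty graph. *)

theory Defs
  imports Complex_Main "HOL-Library.FuncSet" "HOL-Library.Poly_Mapping"
begin

section \<open>Graphs\<close>

record ('v, 'h, 'e) feyn_graph =
  verts :: "'v set"
  halfedges :: "'h set"
  invol :: "'h \<Rightarrow> 'h"
  attach :: "'h \<Rightarrow> 'v"
  etype :: "'h \<Rightarrow> 'e"

definition is_graph :: "('v, 'h, 'e, 'z) feyn_graph_scheme \<Rightarrow> bool" where
  "is_graph G \<longleftrightarrow> finite (verts G) \<and> finite (halfedges G) \<and>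
     (\<forall>h\<in>halfedges G. invol G h \<in> halfedges G \<and> invol G (invol G h) = h \<and> attach G h \<in> verts G)"

definition internal_edges :: "('v, 'h, 'e, 'z) feyn_graph_scheme \<Rightarrow> 'h set set" where
  "internal_edges G = {{h, invol G h} | h. h \<in> halfedges G \<and> invol G h \<noteq> h}"

definition cut_edges :: "('v, 'h, 'e, 'z) feyn_graph_scheme \<Rightarrow> 'h set set
    \<Rightarrow> ('v, 'h, 'e, 'z) feyn_graph_scheme" where
  "cut_edges G S = G\<lparr>invol := (\<lambda>h. if h \<in> \<Union>S then h else invol G h)\<rparr>"

definition covering_subgraph :: "('v, 'h, 'e, 'z) feyn_graph_scheme
    \<Rightarrow> ('v, 'h, 'e, 'z) feyn_graph_scheme \<Rightarrow> bool" where
  "covering_subgraph g G \<longleftrightarrow> (\<exists>S \<subseteq> internal_edges G. g = cut_edges G S)"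

definition conn :: "('v, 'h, 'e, 'z) feyn_graph_scheme \<Rightarrow> ('v \<times> 'v) set" where
  "conn G = Restr ({(attach G h, attach G (invol G h)) | h. h \<in> halfedges G}\<^sup>*) (verts G)"

text \<open>A connected component is represented by its vertex set; the component itself, as a
  graph, is given by \<open>component\<close>.\<close>

definition pi0 :: "('v, 'h, 'e, 'z) feyn_graph_scheme \<Rightarrow> 'v set set" where
  "pi0 G = verts G // conn G"

definition component :: "('v, 'h, 'e, 'z) feyn_graph_scheme \<Rightarrow> 'v set
    \<Rightarrow> ('v, 'h, 'e, 'z) feyn_graph_scheme" where
  "component G C = G\<lparr>verts := C, halfedges := {h \<in> halfedges G. attach G h \<in> C}\<rparr>"

definition connected_graph :: "('v, 'h, 'e, 'z) feyn_graph_scheme \<Rightarrow> bool" where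
  "connected_graph G \<longleftrightarrow> (\<exists>C. pi0 G = {C})"

definition one_PI :: "('v, 'h, 'e, 'z) feyn_graph_scheme \<Rightarrow> bool" where
  "one_PI G \<longleftrightarrow> connected_graph G \<and> (\<forall>e \<in> internal_edges G. connected_graph (cut_edges G {e}))"

definition locally_one_PI :: "('v, 'h, 'e, 'z) feyn_graph_scheme \<Rightarrow> bool" where
  "locally_one_PI G \<longleftrightarrow> (\<forall>C \<in> pi0 G. one_PI (component G C))"

definition contract :: "('v, 'h, 'e, 'z) feyn_graph_scheme \<Rightarrow> ('v, 'h, 'e, 'z) feyn_graph_scheme
    \<Rightarrow> ('v set, 'h, 'e) feyn_graph" where
  "contract G g = \<lparr>verts = pi0 g, halfedges = {h \<in> halfedges g. invol g h = h},
     invol = invol G, attach = (\<lambda>h. conn g `` {attach G h}), etype = etype G\<rparr>"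

definition residue :: "('v, 'h, 'e, 'z) feyn_graph_scheme \<Rightarrow> ('v set, 'h, 'e) feyn_graph" where
  "residue G = contract G G"

type_synonym 'e vertex_type = "'e \<Rightarrow> nat"

definition vertex_type_of :: "('v, 'h, 'e, 'z) feyn_graph_scheme \<Rightarrow> 'v \<Rightarrow> 'e vertex_type" where
  "vertex_type_of G v = (\<lambda>e. card {h \<in> halfedges G. attach G h = v \<and> etype G h = e})"

text \<open>For \<open>C \<in> pi0 G\<close>, the residue of \<open>component G C\<close> has the single vertex \<open>C\<close>.\<close>

definition residue_type :: "('v, 'h, 'e, 'z) feyn_graph_scheme \<Rightarrow> 'v set \<Rightarrow> 'e vertex_type" where
  "residue_type G C = vertex_type_of (residue (component G C)) C"


section \<open>Field theories and their graphs\<close>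

text \<open>A function from edge types to naturals is encoded as a total function that vanishes
  outside \<open>edge_types T\<close>.\<close>

record 'e field_theory =
  edge_types :: "'e set"
  vertex_types :: "'e vertex_type set"
  refined_types :: "('e vertex_type \<times> nat) set"

definition is_theory :: "'e field_theory \<Rightarrow> bool" where
  "is_theory T \<longleftrightarrow>
     (\<forall>t \<in> vertex_types T. \<forall>e. e \<notin> edge_types T \<longrightarrow> t e = 0) \<and>
     refined_types T \<subseteq> vertex_types T \<times> UNIV \<and>
     (\<forall>t \<in> vertex_types T. {k. (t, k) \<in> refined_types T} \<noteq> {} \<and> finite {k. (t, k) \<in> refined_types T})"

record ('v, 'h, 'e) dec_graph = "('v, 'h, 'e) feyn_graph" +
  rtype :: "'v \<Rightarrow> 'e vertex_type \<times> nat"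

definition graph_of_theory :: "'e field_theory \<Rightarrow> ('v, 'h, 'e) dec_graph \<Rightarrow> bool" where
  "graph_of_theory T G \<longleftrightarrow> is_graph G \<and>
     (\<forall>h \<in> halfedges G. etype G h \<in> edge_types T \<and> etype G (invol G h) = etype G h) \<and>
     (\<forall>v \<in> verts G. rtype G v \<in> refined_types T \<and> fst (rtype G v) = vertex_type_of G v)"

definition superficially_divergent :: "'e field_theory \<Rightarrow> ('v, 'h, 'e) dec_graph \<Rightarrow> bool" where
  "superficially_divergent T G \<longleftrightarrow>
     locally_one_PI G \<and> (\<forall>C \<in> pi0 G. residue_type G C \<in> vertex_types T)"


section \<open>Specified graphs\<close>

text \<open>A specification is a function on \<open>pi0 G\<close>; it is required to be extensional, so that two
  specifications are equal iff they agree on \<open>pi0 G\<close>. This matters for the sum over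
  specified covering subgraphs.\<close>

type_synonym ('v, 'h, 'e) spec_graph = "('v, 'h, 'e) dec_graph \<times> ('v set \<Rightarrow> nat)"

definition is_spec_graph :: "'e field_theory \<Rightarrow> ('v, 'h, 'e) spec_graph \<Rightarrow> bool" where
  "is_spec_graph T = (\<lambda>(G, i). graph_of_theory T G \<and> superficially_divergent T G \<and>
     i \<in> extensional (pi0 G) \<and>
     (\<forall>C \<in> pi0 G. (residue_type G C, i C) \<in> refined_types T) \<and>
     (\<forall>v. {v} \<in> pi0 G \<and> internal_edges (component G {v}) = {} \<longrightarrow> i {v} = snd (rtype G v)))"

text \<open>A component of \<open>g\<close> having the vertex set of a component of \<open>G\<close> may still have fewer
  internal edges; it is a full component of \<open>G\<close> if the involutions also agree on it.\<close>

definition full_component :: "('v, 'h, 'e, 'z) feyn_graph_scheme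
    \<Rightarrow> ('v, 'h, 'e, 'z) feyn_graph_scheme \<Rightarrow> 'v set \<Rightarrow> bool" where
  "full_component g G C \<longleftrightarrow> C \<in> pi0 g \<and> C \<in> pi0 G \<and>
     (\<forall>h \<in> halfedges G. attach G h \<in> C \<longrightarrow> invol g h = invol G h)"

definition spec_covering_subgraph :: "('v, 'h, 'e) spec_graph \<Rightarrow> ('v, 'h, 'e) spec_graph \<Rightarrow> bool" where
  "spec_covering_subgraph = (\<lambda>(g, j) (G, i). covering_subgraph g G \<and>
     (\<forall>C. full_component g G C \<longrightarrow> j C = i C))"

text \<open>A component \<open>D\<close> of the contracted graph is a set of components of \<open>g\<close>; it is identified
  with the component \<open>\<Union>D\<close> of \<open>G\<close>.\<close>

definition spec_contract :: "('v, 'h, 'e) spec_graph \<Rightarrow> ('v, 'h, 'e) spec_graph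
    \<Rightarrow> ('v set, 'h, 'e) spec_graph" where
  "spec_contract = (\<lambda>(G, i) (g, j).
     (feyn_graph.extend (contract G g) (dec_graph.fields (\<lambda>C. (residue_type g C, j C))),
      restrict (\<lambda>D. i (\<Union>D)) (pi0 (contract G g))))"

definition in_theory :: "'e field_theory \<Rightarrow> ('v, 'h, 'e) spec_graph \<Rightarrow> bool" where
  "in_theory T = (\<lambda>(G, i). \<forall>v \<in> verts G. rtype G v \<in> refined_types T)"

definition coproduct_index :: "'e field_theory \<Rightarrow> ('v, 'h, 'e) spec_graph
    \<Rightarrow> ('v, 'h, 'e) spec_graph set" where
  "coproduct_index T G = {g. is_spec_graph T g \<and> spec_covering_subgraph g G \<and>
     in_theory T (spec_contract G g)}"

definition disjoint_union :: "('v, 'h, 'e) spec_graph \<Rightarrow> ('w, 'k, 'e) spec_graph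
    \<Rightarrow> ('v + 'w, 'h + 'k, 'e) spec_graph" where
  "disjoint_union = (\<lambda>(G, i) (G', i').
     let U = \<lparr>verts = verts G <+> verts G', halfedges = halfedges G <+> halfedges G',
              invol = map_sum (invol G) (invol G'), attach = map_sum (attach G) (attach G'),
              etype = case_sum (etype G) (etype G'), rtype = case_sum (rtype G) (rtype G')\<rparr>
     in (U, restrict (\<lambda>C. if C \<subseteq> range Inl then i (Inl -` C) else i' (Inr -` C)) (pi0 U)))"

definition empty_spec_graph :: "('v, 'h, 'e) spec_graph" where
  "empty_spec_graph = (\<lparr>verts = {}, halfedges = {}, invol = id, attach = undefined,
     etype = undefined, rtype = undefined\<rparr>, \<lambda>_. undefined)"

definition spec_iso :: "('v, 'h, 'e) spec_graph \<Rightarrow> ('w, 'k, 'e) spec_graph \<Rightarrow> bool" where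
  "spec_iso = (\<lambda>(G, i) (G', i'). \<exists>f p.
     bij_betw f (verts G) (verts G') \<and> bij_betw p (halfedges G) (halfedges G') \<and>
     (\<forall>h \<in> halfedges G. invol G' (p h) = p (invol G h) \<and> attach G' (p h) = f (attach G h) \<and>
        etype G' (p h) = etype G h) \<and>
     (\<forall>v \<in> verts G. rtype G' (f v) = rtype G v) \<and>
     (\<forall>C \<in> pi0 G. i' (f ` C) = i C))"

text \<open>Graphs being finite, each one is isomorphic to a graph whose vertices and half-edges
  are natural numbers. So the isomorphism class of a graph over arbitrary types is
  represented by the set of all isomorphic graphs over \<open>nat\<close>.\<close>

type_synonym 'e spec_class = "(nat, nat, 'e) spec_graph set"

definition iso_class :: "'e field_theory \<Rightarrow> ('v, 'h, 'e) spec_graph \<Rightarrow> 'e spec_class" where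
  "iso_class T G = {K. is_spec_graph T K \<and> spec_iso G K}"

definition spec_classes :: "'e field_theory \<Rightarrow> 'e spec_class set" where
  "spec_classes T = iso_class T ` {G :: (nat, nat, 'e) spec_graph. is_spec_graph T G}"


section \<open>Complex vector spaces with a basis, and bialgebras\<close>

type_synonym 'b cvec = "'b \<Rightarrow>\<^sub>0 complex"

definition free_space :: "'b set \<Rightarrow> 'b cvec set" where
  "free_space B = {x. Poly_Mapping.keys x \<subseteq> B}"

definition smul :: "complex \<Rightarrow> 'b cvec \<Rightarrow> 'b cvec" where
  "smul c = Poly_Mapping.map ((*) c)"

abbreviation bas :: "'b \<Rightarrow> 'b cvec" where
  "bas b \<equiv> Poly_Mapping.single b 1"

definition lin_ext :: "('a \<Rightarrow> 'b cvec) \<Rightarrow> 'a cvec \<Rightarrow> 'b cvec" where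
  "lin_ext f x = (\<Sum>a \<in> Poly_Mapping.keys x. smul (Poly_Mapping.lookup x a) (f a))"

definition linear_between :: "'a set \<Rightarrow> 'b set \<Rightarrow> ('a cvec \<Rightarrow> 'b cvec) \<Rightarrow> bool" where
  "linear_between A B f \<longleftrightarrow> f \<in> free_space A \<rightarrow> free_space B \<and>
     (\<forall>x \<in> free_space A. \<forall>y \<in> free_space A. f (x + y) = f x + f y) \<and>
     (\<forall>c. \<forall>x \<in> free_space A. f (smul c x) = smul c (f x))"

definition linear_form :: "'a set \<Rightarrow> ('a cvec \<Rightarrow> complex) \<Rightarrow> bool" where
  "linear_form A f \<longleftrightarrow>
     (\<forall>x \<in> free_space A. \<forall>y \<in> free_space A. f (x + y) = f x + f y) \<and>
     (\<forall>c. \<forall>x \<in> free_space A. f (smul c x) = c * f x)"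

text \<open>The tensor product of the spaces with bases \<open>A\<close> and \<open>B\<close> is the space with basis
  \<open>A \<times> B\<close>; its universal property is proved below (\<open>tensor_universal\<close>, for the
  case where \<open>A\<close> and \<open>B\<close> are whole types).\<close>

definition tensor :: "'a cvec \<Rightarrow> 'b cvec \<Rightarrow> ('a \<times> 'b) cvec" where
  "tensor x y = lin_ext (\<lambda>a. lin_ext (\<lambda>b. bas (a, b)) y) x"

definition tensor_map :: "('a cvec \<Rightarrow> 'c cvec) \<Rightarrow> ('b cvec \<Rightarrow> 'd cvec)
    \<Rightarrow> ('a \<times> 'b) cvec \<Rightarrow> ('c \<times> 'd) cvec" where
  "tensor_map f g = lin_ext (\<lambda>(a, b). tensor (f (bas a)) (g (bas b)))"

definition tensor_assoc :: "(('a \<times> 'b) \<times> 'c) cvec \<Rightarrow> ('a \<times> ('b \<times> 'c)) cvec" where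
  "tensor_assoc = lin_ext (\<lambda>((a, b), c). bas (a, (b, c)))"

text \<open>The product of the tensor square: \<open>(a \<otimes> b)(c \<otimes> d) = ac \<otimes> bd\<close>.\<close>

definition tensor_mult :: "('b cvec \<Rightarrow> 'b cvec \<Rightarrow> 'b cvec)
    \<Rightarrow> ('b \<times> 'b) cvec \<Rightarrow> ('b \<times> 'b) cvec \<Rightarrow> ('b \<times> 'b) cvec" where
  "tensor_mult m z w =
     lin_ext (\<lambda>(a, b). lin_ext (\<lambda>(c, d). tensor (m (bas a) (bas c)) (m (bas b) (bas d))) w) z"

definition unital_algebra :: "'b set \<Rightarrow> ('b cvec \<Rightarrow> 'b cvec \<Rightarrow> 'b cvec) \<Rightarrow> 'b cvec \<Rightarrow> bool" where
  "unital_algebra B m u \<longleftrightarrow>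
     (\<forall>x \<in> free_space B. linear_between B B (m x) \<and> linear_between B B (\<lambda>y. m y x)) \<and>
     (\<forall>x \<in> free_space B. \<forall>y \<in> free_space B. \<forall>z \<in> free_space B. m (m x y) z = m x (m y z)) \<and>
     u \<in> free_space B \<and> (\<forall>x \<in> free_space B. m u x = x \<and> m x u = x)"

text \<open>In the counit axioms, \<open>\<complex> \<otimes> V\<close> and \<open>V \<otimes> \<complex>\<close> are identified with \<open>V\<close>.\<close>

definition counital_coalgebra :: "'b set \<Rightarrow> ('b cvec \<Rightarrow> ('b \<times> 'b) cvec) \<Rightarrow> ('b cvec \<Rightarrow> complex)
    \<Rightarrow> bool" where
  "counital_coalgebra B \<Delta> \<epsilon> \<longleftrightarrow>
     linear_between B (B \<times> B) \<Delta> \<and> linear_form B \<epsilon> \<and>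
     (\<forall>x \<in> free_space B. tensor_assoc (tensor_map \<Delta> id (\<Delta> x)) = tensor_map id \<Delta> (\<Delta> x)) \<and>
     (\<forall>x \<in> free_space B. lin_ext (\<lambda>(a, b). smul (\<epsilon> (bas a)) (bas b)) (\<Delta> x) = x) \<and>
     (\<forall>x \<in> free_space B. lin_ext (\<lambda>(a, b). smul (\<epsilon> (bas b)) (bas a)) (\<Delta> x) = x)"

definition bialgebra :: "'b set \<Rightarrow> ('b cvec \<Rightarrow> 'b cvec \<Rightarrow> 'b cvec) \<Rightarrow> 'b cvec
    \<Rightarrow> ('b cvec \<Rightarrow> ('b \<times> 'b) cvec) \<Rightarrow> ('b cvec \<Rightarrow> complex) \<Rightarrow> bool" where
  "bialgebra B m u \<Delta> \<epsilon> \<longleftrightarrow> unital_algebra B m u \<and> counital_coalgebra B \<Delta> \<epsilon> \<and>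
     (\<forall>x \<in> free_space B. \<forall>y \<in> free_space B. \<Delta> (m x y) = tensor_mult m (\<Delta> x) (\<Delta> y)) \<and>
     \<Delta> u = tensor u u \<and>
     (\<forall>x \<in> free_space B. \<forall>y \<in> free_space B. \<epsilon> (m x y) = \<epsilon> x * \<epsilon> y) \<and> \<epsilon> u = 1"


section \<open>The structure maps\<close>

definition gen :: "'e field_theory \<Rightarrow> ('v, 'h, 'e) spec_graph \<Rightarrow> 'e spec_class cvec" where
  "gen T G = bas (iso_class T G)"

definition rep :: "'e spec_class \<Rightarrow> (nat, nat, 'e) spec_graph" where
  "rep X = (SOME G. G \<in> X)"

definition graph_mult :: "'e field_theory \<Rightarrow> 'e spec_class cvec \<Rightarrow> 'e spec_class cvec
    \<Rightarrow> 'e spec_class cvec" where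
  "graph_mult T x y = lin_ext (\<lambda>X. lin_ext (\<lambda>Y. gen T (disjoint_union (rep X) (rep Y))) y) x"

definition graph_unit :: "'e field_theory \<Rightarrow> 'e spec_class cvec" where
  "graph_unit T = gen T (empty_spec_graph :: (nat, nat, 'e) spec_graph)"

definition graph_coproduct :: "'e field_theory \<Rightarrow> 'e spec_class cvec
    \<Rightarrow> ('e spec_class \<times> 'e spec_class) cvec" where
  "graph_coproduct T = lin_ext (\<lambda>X. \<Sum>g \<in> coproduct_index T (rep X).
     tensor (gen T g) (gen T (spec_contract (rep X) g)))"


section \<open>Sanity checks\<close>

lemma finite_coproduct_index:
  fixes T :: "'e field_theory" and G :: "('v, 'h, 'e) dec_graph"
  assumes T: "is_theory T" and G: "is_spec_graph T (G, i)"
  shows "finite (coproduct_index T (G, i))"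
proof -
  let ?K = "\<lambda>g C. {k. (residue_type g C, k) \<in> refined_types T}"
  have fin: "finite (verts G)" "finite (halfedges G)"
    using G by (auto simp: is_spec_graph_def graph_of_theory_def is_graph_def)
  have "internal_edges G = (\<lambda>h. {h, invol G h}) ` {h \<in> halfedges G. invol G h \<noteq> h}"
    by (auto simp: internal_edges_def)
  then have 1: "finite (cut_edges G ` Pow (internal_edges G))" using fin by simp
  have K: "finite (?K g C)" for g :: "('v, 'h, 'e) dec_graph" and C
  proof (cases "residue_type g C \<in> vertex_types T")
    case False
    then have "?K g C = {}" using T by (auto simp: is_theory_def)
    then show ?thesis by simp
  qed (use T in \<open>auto simp: is_theory_def\<close>)
  have "finite (pi0 g)" if "g \<in> cut_edges G ` Pow (internal_edges G)" for g
    using that fin by (auto simp: pi0_def cut_edges_def quotient_def)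
  then have 2: "finite
      (SIGMA g : cut_edges G ` Pow (internal_edges G). PiE (pi0 g) (?K g))"
    using 1 K by (intro finite_SigmaI finite_PiE) auto
  have "coproduct_index T (G, i) \<subseteq>
      (SIGMA g : cut_edges G ` Pow (internal_edges G). PiE (pi0 g) (?K g))"
    by (auto simp: coproduct_index_def spec_covering_subgraph_def covering_subgraph_def
        is_spec_graph_def PiE_iff extensional_def)
  then show ?thesis using 2 finite_subset by blast
qed

lemma lookup_smul: "Poly_Mapping.lookup (smul c x) b = c * Poly_Mapping.lookup x b"
  by (simp add: smul_def map.rep_eq when_def)

lemma vector_space_smul: "vector_space (smul :: complex \<Rightarrow> 'b cvec \<Rightarrow> 'b cvec)"
  by unfold_locales (auto intro!: poly_mapping_eqI simp: lookup_smul lookup_add algebra_simps)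

lemma linear_smulI:
  fixes f :: "'b cvec \<Rightarrow> 'w::ab_group_add"
  assumes "vector_space s" "\<And>x y. f (x + y) = f x + f y" "\<And>c x. f (smul c x) = s c (f x)"
  shows "Vector_Spaces.linear smul s f"
  using assms by (simp add: Vector_Spaces.linear_iff vector_space_smul)

lemma linear_extension:
  fixes s :: "complex \<Rightarrow> 'w::ab_group_add \<Rightarrow> 'w" and \<phi> :: "'b \<Rightarrow> 'w"
  assumes "vector_space s"
  defines "f \<equiv> \<lambda>z. \<Sum>p \<in> Poly_Mapping.keys z. s (Poly_Mapping.lookup z p) (\<phi> p)"
  shows "Vector_Spaces.linear smul s f" "f (bas b) = \<phi> b"
proof -
  interpret W: vector_space s by fact
  interpret V: vector_space "smul :: complex \<Rightarrow> 'b cvec \<Rightarrow> 'b cvec" by (rule vector_space_smul)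
  have sup: "f z = (\<Sum>p\<in>S. s (Poly_Mapping.lookup z p) (\<phi> p))"
    if "finite S" "Poly_Mapping.keys z \<subseteq> S" for z S
    unfolding f_def using that by (intro sum.mono_neutral_left) (auto simp: in_keys_iff)
  have add: "f (x + y) = f x + f y" for x y
  proof -
    let ?S = "Poly_Mapping.keys x \<union> Poly_Mapping.keys y"
    have "Poly_Mapping.keys (x + y) \<subseteq> ?S" by (rule keys_add)
    then show ?thesis
      by (simp add: sup[of ?S x] sup[of ?S y] sup[of ?S "x + y"] lookup_add
          W.scale_left_distrib sum.distrib)
  qed
  have scale: "f (smul c x) = s c (f x)" for c x
  proof -
    have "Poly_Mapping.keys (smul c x) \<subseteq> Poly_Mapping.keys x"
      by (auto simp: in_keys_iff lookup_smul)
    then show ?thesis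
      by (simp add: sup[of "Poly_Mapping.keys x" x] sup[of "Poly_Mapping.keys x" "smul c x"]
          lookup_smul W.scale_sum_right)
  qed
  show "Vector_Spaces.linear smul s f"
    by (rule linear_smulI[OF assms(1) add scale])
  show "f (bas b) = \<phi> b"
    by (simp add: f_def)
qed

lemma expand_bas: "x = (\<Sum>b \<in> Poly_Mapping.keys x. smul (Poly_Mapping.lookup x b) (bas b))"
proof (rule poly_mapping_eqI)
  fix a
  have "Poly_Mapping.lookup (\<Sum>b \<in> Poly_Mapping.keys x. smul (Poly_Mapping.lookup x b) (bas b)) a
      = (\<Sum>b \<in> Poly_Mapping.keys x. if b = a then Poly_Mapping.lookup x b else 0)"
    by (simp add: lookup_sum lookup_smul lookup_single when_def if_distrib cong: if_cong)
  then show "Poly_Mapping.lookup x a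
      = Poly_Mapping.lookup (\<Sum>b \<in> Poly_Mapping.keys x. smul (Poly_Mapping.lookup x b) (bas b)) a"
    by (simp add: in_keys_iff)
qed

lemma linear_eqI:
  assumes f: "Vector_Spaces.linear smul s f" and g: "Vector_Spaces.linear smul s g"
    and eq: "\<And>b. f (bas b) = g (bas b)"
  shows "f = g"
proof
  fix x
  interpret f: Vector_Spaces.linear smul s f by fact
  interpret g: Vector_Spaces.linear smul s g by fact
  show "f x = g x"
    by (subst (1 2) expand_bas) (simp add: f.sum f.scale g.sum g.scale eq)
qed

lemma linear_lin_ext: "Vector_Spaces.linear smul smul (lin_ext f)"
  unfolding lin_ext_def by (rule linear_extension(1)[OF vector_space_smul])

lemma lin_ext_bas: "lin_ext f (bas b) = f b"
  unfolding lin_ext_def by (rule linear_extension(2)[OF vector_space_smul])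

lemma tensor_bas: "tensor (bas a) (bas b) = bas (a, b)"
  by (simp add: tensor_def lin_ext_bas)

lemma tensor_bilinear:
  fixes x :: "'a cvec" and y :: "'b cvec"
  shows "Vector_Spaces.linear smul smul (\<lambda>y :: 'b cvec. tensor x y)"
    and "Vector_Spaces.linear smul smul (\<lambda>x :: 'a cvec. tensor x y)"
proof -
  interpret V: vector_space "smul :: complex \<Rightarrow> ('a \<times> 'b) cvec \<Rightarrow> ('a \<times> 'b) cvec"
    by (rule vector_space_smul)
  show "Vector_Spaces.linear smul smul (\<lambda>x :: 'a cvec. tensor x y)"
    unfolding tensor_def by (rule linear_lin_ext)
  have add: "lin_ext h (z + w) = lin_ext h z + lin_ext h w"
    and scale: "lin_ext h (smul c z) = smul c (lin_ext h z)"
    for h :: "'b \<Rightarrow> ('a \<times> 'b) cvec" and z w c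
  proof -
    interpret h: Vector_Spaces.linear smul smul "lin_ext h" by (rule linear_lin_ext)
    show "lin_ext h (z + w) = lin_ext h z + lin_ext h w" by (rule h.add)
    show "lin_ext h (smul c z) = smul c (lin_ext h z)" by (rule h.scale)
  qed
  show "Vector_Spaces.linear smul smul (\<lambda>y :: 'b cvec. tensor x y)"
    by (rule linear_smulI[OF vector_space_smul])
      (simp_all only: tensor_def lin_ext_def[of _ x] add scale
        V.scale_right_distrib sum.distrib V.scale_sum_right V.scale_left_commute)
qed

lemma tensor_universal:
  fixes s :: "complex \<Rightarrow> 'w::ab_group_add \<Rightarrow> 'w" and \<beta> :: "'a cvec \<Rightarrow> 'b cvec \<Rightarrow> 'w"
  assumes "vector_space s"
    and \<beta>1: "\<And>y. Vector_Spaces.linear smul s (\<lambda>x. \<beta> x y)"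
    and \<beta>2: "\<And>x. Vector_Spaces.linear smul s (\<beta> x)"
  shows "\<exists>!f. Vector_Spaces.linear smul s f \<and> (\<forall>x y. f (tensor x y) = \<beta> x y)"
proof -
  define f where "f = (\<lambda>z. \<Sum>p \<in> Poly_Mapping.keys z.
    s (Poly_Mapping.lookup z p) ((\<lambda>(a, b). \<beta> (bas a) (bas b)) p))"
  have f: "Vector_Spaces.linear smul s f" "f (bas (a, b)) = \<beta> (bas a) (bas b)" for a b
    unfolding f_def
    using linear_extension[OF assms(1), of "\<lambda>(a, b). \<beta> (bas a) (bas b)"] by simp_all
  have c1: "Vector_Spaces.linear smul s (\<lambda>y. f (tensor x y))" for x
    using Vector_Spaces.linear_compose[OF tensor_bilinear(1) f(1)] by (simp add: o_def)
  have c2: "Vector_Spaces.linear smul s (\<lambda>x. f (tensor x y))" for y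
    using Vector_Spaces.linear_compose[OF tensor_bilinear(2) f(1)] by (simp add: o_def)
  have e1: "(\<lambda>y. f (tensor (bas a) y)) = \<beta> (bas a)" for a
    by (rule linear_eqI[OF c1 \<beta>2]) (simp add: tensor_bas f)
  have e2: "(\<lambda>x. f (tensor x y)) = (\<lambda>x. \<beta> x y)" for y
    by (rule linear_eqI[OF c2 \<beta>1]) (rule fun_cong[OF e1])
  show ?thesis
  proof (rule ex1I[of _ f])
    show "Vector_Spaces.linear smul s f \<and> (\<forall>x y. f (tensor x y) = \<beta> x y)"
      using f(1) fun_cong[OF e2] by simp
  next
    fix g assume g: "Vector_Spaces.linear smul s g \<and> (\<forall>x y. g (tensor x y) = \<beta> x y)"
    have "g (bas p) = f (bas p)" for p
      using g f(2) by (cases p) (simp flip: tensor_bas)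
    then show "g = f" using g f(1) by (intro linear_eqI) auto
  qed
qed

end

theory Submission
  imports Defs
begin

text \<open>
  A graph is locally 1PI iff no half-edge is a bridge, and a locally 1PI subgraph contracts
  to a graph with the same connectivity: two vertices are connected in \<open>G\<close> iff their
  components are connected in \<open>G/d\<close>. So all conditions on a specified graph are local, at
  vertices, half-edges and components, and they pass between \<open>G\<close> on the one side and
  \<open>d\<close>, \<open>G/d\<close> on the other; in particular \<open>G/d\<close> is automatically a specified graph of the
  theory. Coassociativity is the bijection \<open>(g, d) \<mapsto> (d, g/d)\<close> from chains \<open>d \<subseteq> g \<subseteq> G\<close> to
  pairs of a subgraph of \<open>G\<close> and one of \<open>G/d\<close>, together with \<open>(G/d)/(g/d) \<cong> G/g\<close>.
  The counit sends a graph without internal edges to 1 and all others to 0.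

  Isomorphisms and the inclusions into a disjoint union are both treated as open embeddings,
  along which subgraphs pull back.
\<close>

section \<open>Connectivity and bridges\<close>

text \<open>The delicate data are the specifications. Two conditions constrain them: a subgraph
  inherits the value on a full component, and a single vertex of refined type \<open>(t, k)\<close>
  without internal edges has the value \<open>k\<close>. Contraction exchanges the two, because a
  vertex \<open>c\<close> of \<open>G/d\<close> forms a component without internal edges exactly
  when \<open>c\<close> is a full component of \<open>G\<close>. So inheritance for
  \<open>d \<subseteq> G\<close> is what makes \<open>G/d\<close> satisfy the vertex condition, and
  the vertex condition on a subgraph of \<open>G/d\<close> is what gives inheritance between
  \<open>d\<close> and the lifted subgraph \<open>g\<close>. The types match because the half-edges
  of \<open>G/d\<close> are those cut in \<open>d\<close>: at a vertex \<open>c\<close> they are the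
  external half-edges of \<open>d\<close> at \<open>c\<close>, and those that are external over a
  component of \<open>G/d\<close> are the external half-edges of \<open>G\<close> at its
  union.\<close>

lemma is_graphD:
  assumes "is_graph G"
  shows "finite (verts G)" "finite (halfedges G)"
    "\<And>h. h \<in> halfedges G \<Longrightarrow> invol G h \<in> halfedges G"
    "\<And>h. h \<in> halfedges G \<Longrightarrow> invol G (invol G h) = h"
    "\<And>h. h \<in> halfedges G \<Longrightarrow> attach G h \<in> verts G"
  using assms by (auto simp: is_graph_def)

lemma conn_attach:
  assumes "is_graph G" "h \<in> halfedges G"
  shows "(attach G h, attach G (invol G h)) \<in> conn G"
  using assms by (auto simp: conn_def is_graph_def)

lemma equiv_conn:
  assumes G: "is_graph G"
  shows "equiv (verts G) (conn G)"
proof -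
  let ?A = "{(attach G h, attach G (invol G h)) | h. h \<in> halfedges G}"
  have "sym ?A"
  proof (rule symI)
    fix x y assume "(x, y) \<in> ?A"
    then obtain h where "h \<in> halfedges G" "x = attach G h" "y = attach G (invol G h)" by auto
    then show "(y, x) \<in> ?A"
      using is_graphD(3,4)[OF G, of h] by (auto intro!: exI[of _ "invol G h"])
  qed
  then have "sym (?A\<^sup>*)" by (rule sym_rtrancl)
  then show ?thesis
    unfolding conn_def by (auto simp: equiv_def refl_on_def sym_def trans_def)
qed

lemma conn_refl: "x \<in> verts G \<Longrightarrow> (x, x) \<in> conn G"
  by (simp add: conn_def)

lemma conn_sym: "is_graph G \<Longrightarrow> (x, y) \<in> conn G \<Longrightarrow> (y, x) \<in> conn G"
  using equiv_conn by (meson equivE symE)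

lemma conn_trans: "is_graph G \<Longrightarrow> (x, y) \<in> conn G \<Longrightarrow> (y, z) \<in> conn G \<Longrightarrow> (x, z) \<in> conn G"
  using equiv_conn by (meson equivE transE)

lemma conn_verts: "(x, y) \<in> conn G \<Longrightarrow> x \<in> verts G \<and> y \<in> verts G"
  by (simp add: conn_def)

lemma conn_induct [consumes 2, case_names refl step]:
  assumes "(x, y) \<in> conn G" "is_graph G" "P x"
    and step: "\<And>h. \<lbrakk>h \<in> halfedges G; (x, attach G h) \<in> conn G; P (attach G h)\<rbrakk>
      \<Longrightarrow> P (attach G (invol G h))"
  shows "P y"
proof -
  let ?A = "{(attach G h, attach G (invol G h)) | h. h \<in> halfedges G}"
  have x: "x \<in> verts G" and "(x, y) \<in> ?A\<^sup>*" using assms(1) by (auto simp: conn_def)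
  from this(2) have "P y \<and> (x, y) \<in> conn G"
  proof (induction rule: rtrancl_induct)
    case base
    then show ?case using x assms(3) by (simp add: conn_refl)
  next
    case (step y z)
    then obtain h where "h \<in> halfedges G" "y = attach G h" "z = attach G (invol G h)" by auto
    moreover from this step have "(x, attach G h) \<in> conn G" "P (attach G h)" by auto
    ultimately show ?case
      using assms(4)[of h] conn_trans[OF assms(2) _ conn_attach[OF assms(2)], of x h] by simp
  qed
  then show ?thesis ..
qed

text \<open>Paths are followed step by step. The images of the two ends of a half-edge only have to
  be connected, not joined by an edge, so the lemma serves for embeddings, for the contraction map,
  and with \<open>\<phi> = id\<close> for comparing two graphs on the same vertices.\<close>

lemma conn_map:
  assumes "(x, y) \<in> conn G" "is_graph G" "is_graph K"
    and V: "\<phi> x \<in> verts K"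
    and E: "\<And>h. h \<in> halfedges G \<Longrightarrow> (\<phi> (attach G h), \<phi> (attach G (invol G h))) \<in> conn K"
  shows "(\<phi> x, \<phi> y) \<in> conn K"
  using assms(1,2)
proof (induction rule: conn_induct)
  case refl
  show ?case using V by (rule conn_refl)
next
  case (step h)
  then show ?case using E conn_trans[OF assms(3)] by blast
qed

lemma pi0_iff: "C \<in> pi0 G \<longleftrightarrow> (\<exists>x \<in> verts G. C = conn G `` {x})"
  by (auto simp: pi0_def quotient_def)

lemma pi0_subset: "C \<in> pi0 G \<Longrightarrow> C \<subseteq> verts G"
  by (auto simp: pi0_iff dest: conn_verts)

lemma pi0_nonempty: "C \<in> pi0 G \<Longrightarrow> C \<noteq> {}"
  by (auto simp: pi0_iff intro: conn_refl)

lemma class_in_pi0: "x \<in> verts G \<Longrightarrow> conn G `` {x} \<in> pi0 G"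
  by (auto simp: pi0_iff)

lemma mem_class: "x \<in> verts G \<Longrightarrow> x \<in> conn G `` {x}"
  by (simp add: conn_refl)

lemma pi0_class: "is_graph G \<Longrightarrow> C \<in> pi0 G \<Longrightarrow> x \<in> C \<Longrightarrow> conn G `` {x} = C"
  unfolding pi0_iff using equiv_class_eq[OF equiv_conn] by fastforce

lemma pi0_disjoint: "is_graph G \<Longrightarrow> C \<in> pi0 G \<Longrightarrow> D \<in> pi0 G \<Longrightarrow> x \<in> C \<Longrightarrow> x \<in> D \<Longrightarrow> C = D"
  using pi0_class by metis

lemma Union_pi0: "\<Union>(pi0 G) = verts G"
  using pi0_subset class_in_pi0 mem_class by fast

lemma finite_pi0: "is_graph G \<Longrightarrow> finite (pi0 G)"
  by (simp add: pi0_def quotient_def is_graph_def)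

lemma pi0_closed:
  "is_graph G \<Longrightarrow> C \<in> pi0 G \<Longrightarrow> h \<in> halfedges G \<Longrightarrow> attach G h \<in> C \<Longrightarrow> attach G (invol G h) \<in> C"
  using pi0_class conn_attach by (metis Image_singleton_iff)

section \<open>Cutting an edge; components as graphs\<close>

lemma cut_edges_simps [simp]:
  "verts (cut_edges G S) = verts G" "halfedges (cut_edges G S) = halfedges G"
  "attach (cut_edges G S) = attach G" "etype (cut_edges G S) = etype G"
  "invol (cut_edges G S) h = (if h \<in> \<Union>S then h else invol G h)"
  by (simp_all add: cut_edges_def)

abbreviation cut_at :: "('v, 'h, 'e, 'z) feyn_graph_scheme \<Rightarrow> 'h \<Rightarrow> ('v, 'h, 'e, 'z) feyn_graph_scheme" where
  "cut_at G h \<equiv> cut_edges G {{h, invol G h}}"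

lemma is_graph_cut_at:
  assumes "is_graph G" "h \<in> halfedges G"
  shows "is_graph (cut_at G h)"
proof -
  \<comment> \<open>Injectivity of the involution: no half-edge outside the cut pair is sent into
    it, so the modified map is still an involution.\<close>
  have "invol G k = invol G h \<Longrightarrow> k = h" if "k \<in> halfedges G" for k
    using is_graphD(4)[OF assms(1)] assms(2) that by metis
  moreover note is_graphD[OF assms(1)]
  ultimately show ?thesis
    unfolding is_graph_def using assms(2) by simp metis
qed

text \<open>Stated for a half-edge rather than an edge. For an external half-edge both ends coincide
  and the condition is trivial, so it can be imposed on all half-edges uniformly.\<close>

definition nonbridge :: "('v, 'h, 'e, 'z) feyn_graph_scheme \<Rightarrow> 'h \<Rightarrow> bool" where
  "nonbridge G h \<longleftrightarrow> (attach G h, attach G (invol G h)) \<in> conn (cut_at G h)"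

lemma component_simps [simp]:
  "verts (component G C) = C" "halfedges (component G C) = {h \<in> halfedges G. attach G h \<in> C}"
  "attach (component G C) = attach G" "etype (component G C) = etype G"
  "invol (component G C) = invol G"
  by (simp_all add: component_def)

lemma cut_component: "cut_edges (component G C) S = component (cut_edges G S) C"
  by (rule feyn_graph.equality) (auto simp: cut_edges_def component_def)

lemma is_graph_component:
  assumes "is_graph G" "C \<subseteq> verts G"
    and "\<And>h. h \<in> halfedges G \<Longrightarrow> attach G h \<in> C \<Longrightarrow> attach G (invol G h) \<in> C"
  shows "is_graph (component G C)"
  using assms finite_subset[OF assms(2)] by (auto simp: is_graph_def)

text \<open>A path that starts in a set closed under edges stays there. \<open>C\<close> need not be
  a class of \<open>G\<close>: the lemma is also applied to \<open>cut_at G h\<close> with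
  \<open>C\<close> a component of the uncut graph, which the cut might have split.\<close>

lemma conn_component:
  assumes G: "is_graph G" and C: "C \<subseteq> verts G"
    and cl: "\<And>h. h \<in> halfedges G \<Longrightarrow> attach G h \<in> C \<Longrightarrow> attach G (invol G h) \<in> C"
  shows "conn (component G C) = Restr (conn G) C"
proof (intro equalityI subrelI)
  have gC: "is_graph (component G C)" by (rule is_graph_component) fact+
  fix x y
  show "(x, y) \<in> Restr (conn G) C" if "(x, y) \<in> conn (component G C)"
    using conn_map[OF that gC G, of id] conn_verts[OF that] C conn_attach[OF G] by auto
  assume "(x, y) \<in> Restr (conn G) C"
  then have "(x, y) \<in> conn G" and x: "x \<in> C" by auto
  from this(1) G have "y \<in> C \<and> (x, y) \<in> conn (component G C)"
  proof (induction rule: conn_induct)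
    case refl
    show ?case using x by (simp add: conn_refl)
  next
    case (step h)
    then show ?case using cl conn_attach[OF gC, of h] conn_trans[OF gC] by auto
  qed
  then show "(x, y) \<in> conn (component G C)" ..
qed

lemma connected_graph_iff:
  assumes G: "is_graph G"
  shows "connected_graph G \<longleftrightarrow> verts G \<noteq> {} \<and> conn G = verts G \<times> verts G"
proof
  assume "connected_graph G"
  then obtain C where C: "pi0 G = {C}" by (auto simp: connected_graph_def)
  then have V: "C = verts G" using Union_pi0[of G] by simp
  have "(x, y) \<in> conn G" if "x \<in> verts G" "y \<in> verts G" for x y
    using pi0_class[OF G, of C x] C V that by auto
  then show "verts G \<noteq> {} \<and> conn G = verts G \<times> verts G"
    using pi0_nonempty[of C G] C V by (auto dest: conn_verts)
next
  assume *: "verts G \<noteq> {} \<and> conn G = verts G \<times> verts G"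
  then have "conn G `` {x} = verts G" if "x \<in> verts G" for x using that by blast
  with * have "pi0 G = {verts G}" unfolding pi0_def quotient_def by auto
  then show "connected_graph G" by (auto simp: connected_graph_def)
qed

text \<open>Cutting an edge affects only the component that contains it, and that component stays
  connected exactly when the two ends of the edge do, since every path through the edge can then be
  rerouted.\<close>

lemma locally_one_PI_iff:
  assumes G: "is_graph G"
  shows "locally_one_PI G \<longleftrightarrow> (\<forall>h \<in> halfedges G. nonbridge G h)"
proof
  assume L: "locally_one_PI G"
  show "\<forall>h \<in> halfedges G. nonbridge G h"
  proof
    fix h assume h: "h \<in> halfedges G"
    show "nonbridge G h"
    proof (cases "invol G h = h")
      case True
      then show ?thesis using h is_graphD(5)[OF G] by (simp add: nonbridge_def conn_refl)
    next
      case False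
      define C where "C = conn G `` {attach G h}"
      have C: "C \<in> pi0 G" and hC: "attach G h \<in> C"
        using is_graphD(5)[OF G h] by (auto simp: C_def class_in_pi0 conn_refl)
      have "{h, invol G h} \<in> internal_edges (component G C)"
        unfolding internal_edges_def using False h hC by auto
      then have con: "connected_graph (component (cut_at G h) C)"
        using L C by (auto simp: locally_one_PI_def one_PI_def cut_component)
      have *: "is_graph (cut_at G h)" by (rule is_graph_cut_at) fact+
      have CV: "C \<subseteq> verts (cut_at G h)" using pi0_subset[OF C] by simp
      have cl: "attach (cut_at G h) (invol (cut_at G h) k) \<in> C"
        if "k \<in> halfedges (cut_at G h)" "attach (cut_at G h) k \<in> C" for k
        using that pi0_closed[OF G C] by auto
      have "conn (component (cut_at G h) C) = Restr (conn (cut_at G h)) C"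
        by (rule conn_component[OF * CV cl])
      moreover have "is_graph (component (cut_at G h) C)"
        by (rule is_graph_component[OF * CV cl])
      ultimately have "Restr (conn (cut_at G h)) C = C \<times> C"
        using con by (simp add: connected_graph_iff)
      then show ?thesis unfolding nonbridge_def using hC pi0_closed[OF G C h hC] by blast
    qed
  qed
next
  assume nb: "\<forall>h \<in> halfedges G. nonbridge G h"
  show "locally_one_PI G"
    unfolding locally_one_PI_def one_PI_def
  proof (intro ballI conjI)
    fix C assume C: "C \<in> pi0 G"
    note cl = pi0_closed[OF G C]
    have full: "C \<times> C \<subseteq> conn G" using pi0_class[OF G C] by auto
    have gC: "is_graph (component G C)"
      by (rule is_graph_component[OF G pi0_subset[OF C] cl])
    show "connected_graph (component G C)"
      using full pi0_nonempty[OF C]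
      by (auto simp: connected_graph_iff[OF gC] conn_component[OF G pi0_subset[OF C] cl])
    fix e assume "e \<in> internal_edges (component G C)"
    then obtain h where h: "h \<in> halfedges G" "attach G h \<in> C" "e = {h, invol G h}"
      by (auto simp: internal_edges_def)
    have g: "is_graph (cut_at G h)" by (rule is_graph_cut_at) fact+
    have cl': "attach (cut_at G h) (invol (cut_at G h) k) \<in> C"
        if "k \<in> halfedges (cut_at G h)" "attach (cut_at G h) k \<in> C" for k
        using that cl by auto
    have CV: "C \<subseteq> verts (cut_at G h)" using pi0_subset[OF C] by simp
    have "(x, y) \<in> conn (cut_at G h)" if "(x, y) \<in> conn G" for x y
    proof -
      have nbh: "(attach G h, attach G (invol G h)) \<in> conn (cut_at G h)"
        using nb h by (auto simp: nonbridge_def)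
      \<comment> \<open>Every step of a path in \<open>G\<close> survives the cut: other edges are
        untouched, and the two directions of the cut edge are replaced by the detour
        \<open>nbh\<close>.\<close>
      have "(attach G k, attach G (invol G k)) \<in> conn (cut_at G h)" if k: "k \<in> halfedges G" for k
      proof -
        consider "k = h" | "k = invol G h" | "k \<notin> {h, invol G h}" by blast
        then show ?thesis
        proof cases
          case 1
          then show ?thesis using nbh by simp
        next
          case 2
          then show ?thesis using conn_sym[OF g nbh] is_graphD(4)[OF G h(1)] by simp
        next
          case 3
          then show ?thesis using conn_attach[OF g, of k] k by simp
        qed
      qed
      then show ?thesis using conn_map[OF that G g, of id] conn_verts[OF that] by simp
    qed
    then have "C \<times> C \<subseteq> conn (cut_at G h)" using full by blast
    moreover have "conn (component (cut_at G h) C) = Restr (conn (cut_at G h)) C"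
      by (rule conn_component[OF g CV cl'])
    moreover have "is_graph (component (cut_at G h) C)"
      by (rule is_graph_component[OF g CV cl'])
    ultimately show "connected_graph (cut_edges (component G C) {e})"
      using pi0_nonempty[OF C] unfolding cut_component h(3)
      by (simp add: connected_graph_iff inf.absorb2)
  qed
qed

text \<open>The residue type read off in \<open>G\<close> itself, without forming a component and
  contracting it. As a count of half-edges over a vertex set it is easy to transport along
  embeddings and contractions.\<close>

definition ext_type :: "('v, 'h, 'e, 'z) feyn_graph_scheme \<Rightarrow> 'v set \<Rightarrow> 'e vertex_type" where
  "ext_type G C = (\<lambda>e. card {h \<in> halfedges G. invol G h = h \<and> attach G h \<in> C \<and> etype G h = e})"

lemma residue_type_eq_ext_type:
  assumes G: "is_graph G" and C: "C \<in> pi0 G"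
  shows "residue_type G C = ext_type G C"
proof -
  note cl = pi0_closed[OF G C]
  have "conn (component G C) `` {x} = C" if "x \<in> C" for x
    using that pi0_class[OF G C] by (auto simp: conn_component[OF G pi0_subset[OF C] cl])
  then have "{h \<in> halfedges (residue (component G C)).
      attach (residue (component G C)) h = C \<and> etype (residue (component G C)) h = e} =
    {h \<in> halfedges G. invol G h = h \<and> attach G h \<in> C \<and> etype G h = e}" for e
    by (auto simp: residue_def contract_def)
  then show ?thesis
    by (simp add: residue_type_def vertex_type_of_def ext_type_def)
qed

lemma internal_edges_component_empty:
  "internal_edges (component G {v}) = {} \<longleftrightarrow> (\<forall>h \<in> halfedges G. attach G h = v \<longrightarrow> invol G h = h)"
  by (auto simp: internal_edges_def)

section \<open>Covering subgraphs\<close>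

text \<open>Covering subgraphs described by their involution instead of a set of cut edges, which
  makes them easy to compare, compose and glue. The last clause fixes the involution off the
  half-edges, so that a subgraph, as a record, is determined by its values on half-edges
  (\<open>cov_eqI\<close>); the coproduct sums over records.\<close>

definition cov :: "('v, 'h, 'e, 'z) feyn_graph_scheme \<Rightarrow> ('v, 'h, 'e, 'z) feyn_graph_scheme \<Rightarrow> bool" where
  "cov g G \<longleftrightarrow> g = G\<lparr>invol := invol g\<rparr> \<and>
     (\<forall>h \<in> halfedges G. (invol g h = h \<or> invol g h = invol G h) \<and> invol g (invol g h) = h) \<and>
     (\<forall>h. h \<notin> halfedges G \<longrightarrow> invol g h = invol G h)"

lemma covD:
  assumes "cov g G"
  shows "verts g = verts G" "halfedges g = halfedges G" "attach g = attach G" "etype g = etype G"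
    "\<And>h. h \<in> halfedges G \<Longrightarrow> invol g h = h \<or> invol g h = invol G h"
    "\<And>h. h \<in> halfedges G \<Longrightarrow> invol g (invol g h) = h"
    "\<And>h. h \<notin> halfedges G \<Longrightarrow> invol g h = invol G h"
proof -
  have g: "g = G\<lparr>invol := invol g\<rparr>" using assms by (simp add: cov_def)
  show "verts g = verts G" by (subst g) simp
  show "halfedges g = halfedges G" by (subst g) simp
  show "attach g = attach G" by (subst g) simp
  show "etype g = etype G" by (subst g) simp
qed (use assms in \<open>simp_all add: cov_def\<close>)

lemma cov_rtype: "cov g G \<Longrightarrow> rtype g = rtype G"
proof -
  assume "cov g G"
  then have "g = G\<lparr>invol := invol g\<rparr>" by (simp add: cov_def)
  then show ?thesis by (metis dec_graph.select_convs(1) dec_graph.surjective feyn_graph.update_convs(3))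
qed

lemma cov_is_graph: "cov g G \<Longrightarrow> is_graph G \<Longrightarrow> is_graph g"
  using covD[of g G] unfolding is_graph_def by metis

lemma cov_eqI:
  assumes "cov g G" "cov g' G" "\<And>h. h \<in> halfedges G \<Longrightarrow> invol g h = invol g' h"
  shows "g = g'"
proof -
  have "invol g h = invol g' h" for h
    using assms(3) covD(7)[OF assms(1)] covD(7)[OF assms(2)] by (cases "h \<in> halfedges G") auto
  then have "invol g = invol g'" ..
  then show ?thesis using assms(1,2) unfolding cov_def by metis
qed

lemma cov_refl: "is_graph G \<Longrightarrow> cov G G"
  by (simp add: cov_def is_graph_def)

lemma cov_trans: "is_graph G \<Longrightarrow> cov d g \<Longrightarrow> cov g G \<Longrightarrow> cov d G"
proof -
  assume a: "is_graph G" "cov d g" "cov g G"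
  have "d = g\<lparr>invol := invol d\<rparr>" "g = G\<lparr>invol := invol g\<rparr>" using a by (simp_all add: cov_def)
  then have "d = G\<lparr>invol := invol d\<rparr>" by (metis feyn_graph.update_convs(3) feyn_graph.surjective)
  then show "cov d G" 
    using covD[OF a(2)] covD[OF a(3)] unfolding cov_def by metis
qed

lemma cov_fixed: "cov g G \<Longrightarrow> h \<in> halfedges G \<Longrightarrow> invol G h = h \<Longrightarrow> invol g h = h"
  using covD(5) by metis

text \<open>If only one half of an edge were cut, \<open>invol g\<close> would send both halves to
  \<open>h\<close> and could not be an involution.\<close>

lemma cov_fixed_invol: "cov g G \<Longrightarrow> is_graph G \<Longrightarrow> h \<in> halfedges G \<Longrightarrow> invol g h = h \<Longrightarrow>
    invol g (invol G h) = invol G h"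
  using covD(5,6) is_graphD(3,4) by metis

lemma covering_subgraph_iff:
  assumes G: "is_graph G"
  shows "covering_subgraph g G \<longleftrightarrow> cov g G"
proof
  assume "covering_subgraph g G"
  then obtain S where S: "S \<subseteq> internal_edges G" "g = cut_edges G S"
    by (auto simp: covering_subgraph_def)
  \<comment> \<open>The set of cut half-edges is stable under the involution of \<open>G\<close>;
    hence the cut map is an involution.\<close>
  have mem: "h \<in> halfedges G \<and> invol G h \<in> \<Union>S" if "h \<in> \<Union>S" for h
  proof -
    from that obtain e where e: "e \<in> S" "h \<in> e" by auto
    then obtain k where k: "k \<in> halfedges G" "e = {k, invol G k}"
      using S(1) by (auto simp: internal_edges_def)
    then have "h = k \<or> h = invol G k" using e(2) by simp
    then have "h \<in> halfedges G \<and> invol G h \<in> e"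
      using k is_graphD(3,4)[OF G k(1)] by auto
    then show ?thesis using e(1) by blast
  qed
  have "invol g (invol g h) = h" if "h \<in> halfedges G" for h
    using mem[of h] mem[of "invol G h"] is_graphD(4)[OF G that]
    unfolding S(2) cut_edges_simps by metis
  moreover have "g = G\<lparr>invol := invol g\<rparr>"
    unfolding S(2) by (simp add: cut_edges_def)
  moreover have "invol g h = invol G h" if "h \<notin> halfedges G" for h
    using mem[of h] that unfolding S(2) cut_edges_simps by auto
  moreover have "invol g h = h \<or> invol g h = invol G h" for h
    unfolding S(2) cut_edges_simps by simp
  ultimately show "cov g G" by (simp add: cov_def)
next
  assume c: "cov g G"
  define S where "S = {{h, invol G h} | h. h \<in> halfedges G \<and> invol G h \<noteq> h \<and> invol g h = h}"
  have S: "h \<in> \<Union>S \<longleftrightarrow> h \<in> halfedges G \<and> invol G h \<noteq> h \<and> invol g h = h" for h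
  proof
    assume "h \<in> \<Union>S"
    then obtain k where k: "k \<in> halfedges G" "invol G k \<noteq> k" "invol g k = k" "h = k \<or> h = invol G k"
      by (auto simp: S_def)
    then show "h \<in> halfedges G \<and> invol G h \<noteq> h \<and> invol g h = h"
      using is_graphD(3,4)[OF G k(1)] cov_fixed_invol[OF c G k(1,3)] by metis
  qed (auto simp: S_def)
  have "g = cut_edges G S"
  proof -
    have "invol g = (\<lambda>h. if h \<in> \<Union>S then h else invol G h)"
      unfolding S using covD(5,7)[OF c] by fastforce
    then show ?thesis using c unfolding cut_edges_def cov_def by metis
  qed
  moreover have "S \<subseteq> internal_edges G" by (auto simp: S_def internal_edges_def)
  ultimately show "covering_subgraph g G" unfolding covering_subgraph_def by blast
qed

lemma cov_conn:
  assumes G: "is_graph G" and c: "cov g G" and "(x, y) \<in> conn g"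
  shows "(x, y) \<in> conn G"
proof -
  have "(attach g h, attach g (invol g h)) \<in> conn G" if "h \<in> halfedges g" for h
    using covD(5)[OF c, of h] that is_graphD(5)[OF G, of h] conn_attach[OF G, of h] conn_refl
    unfolding covD[OF c] by metis
  then show ?thesis
    using conn_map[OF assms(3) cov_is_graph[OF c G] G, of id] conn_verts[OF assms(3)]
    by (simp add: covD[OF c])
qed

definition is_full :: "('v, 'h, 'e, 'z) feyn_graph_scheme
    \<Rightarrow> ('v, 'h, 'e, 'z) feyn_graph_scheme \<Rightarrow> 'v set \<Rightarrow> bool" where
  "is_full g G C \<longleftrightarrow> (\<forall>h \<in> halfedges G. attach G h \<in> C \<longrightarrow> invol g h = invol G h)"

text \<open>A path of \<open>G\<close> starting in \<open>C\<close> uses only half-edges at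
  \<open>C\<close>, and \<open>g\<close> keeps these, so the path cannot leave the
  \<open>g\<close>-component \<open>C\<close>.\<close>

lemma full_pi0:
  assumes G: "is_graph G" and c: "cov g G" and C: "C \<in> pi0 g" and f: "is_full g G C"
  shows "C \<in> pi0 G"
proof -
  have g: "is_graph g" by (rule cov_is_graph) fact+
  obtain x where x: "x \<in> C" using pi0_nonempty[OF C] by auto
  then have xV: "x \<in> verts G" using pi0_subset[OF C] covD(1)[OF c] by auto
  have "y \<in> C" if "(x, y) \<in> conn G" for y
    using that G
  proof (induction rule: conn_induct)
    case (step h)
    then show ?case using f pi0_closed[OF g C, of h] covD[OF c] by (auto simp: is_full_def)
  qed (rule x)
  moreover have "(x, y) \<in> conn G" if "y \<in> C" for y
    using that pi0_class[OF g C x] cov_conn[OF G c] by auto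
  ultimately have "C = conn G `` {x}" by auto
  then show ?thesis using xV by (simp add: class_in_pi0)
qed

lemma full_component_iff:
  assumes "is_graph G" "cov g G"
  shows "full_component g G C \<longleftrightarrow> C \<in> pi0 g \<and> is_full g G C"
  using full_pi0[OF assms] by (auto simp: full_component_def is_full_def)

section \<open>Local form of the conditions on a specified graph\<close>

definition vert_ok :: "'e field_theory \<Rightarrow> ('v, 'h, 'e) dec_graph \<Rightarrow> 'v \<Rightarrow> bool" where
  "vert_ok T G v \<longleftrightarrow> rtype G v \<in> refined_types T \<and> fst (rtype G v) = vertex_type_of G v"

definition edge_ok :: "'e field_theory \<Rightarrow> ('v, 'h, 'e) dec_graph \<Rightarrow> 'h \<Rightarrow> bool" where
  "edge_ok T G h \<longleftrightarrow> etype G h \<in> edge_types T \<and> etype G (invol G h) = etype G h \<and> nonbridge G h"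

definition comp_ok :: "'e field_theory \<Rightarrow> ('v, 'h, 'e) spec_graph \<Rightarrow> 'v set \<Rightarrow> bool" where
  "comp_ok T = (\<lambda>(G, i) C. (ext_type G C, i C) \<in> refined_types T \<and>
     (\<forall>v. C = {v} \<longrightarrow> (\<forall>h \<in> halfedges G. attach G h = v \<longrightarrow> invol G h = h) \<longrightarrow> i C = snd (rtype G v)))"

text \<open>Each clause now concerns one vertex, half-edge or component, so it can be checked
  wherever that item lives. The condition on residue types is recovered from \<open>comp_ok\<close>,
  since by \<open>is_theory\<close> a refined type lies over a vertex type.\<close>

lemma is_spec_graph_iff:
  assumes T: "is_theory T"
  shows "is_spec_graph T (G, i) \<longleftrightarrow> is_graph G \<and> i \<in> extensional (pi0 G) \<and>
    (\<forall>v \<in> verts G. vert_ok T G v) \<and> (\<forall>h \<in> halfedges G. edge_ok T G h) \<and>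
    (\<forall>C \<in> pi0 G. comp_ok T (G, i) C)"
proof (cases "is_graph G")
  case True
  have "t \<in> vertex_types T" if "(t, k) \<in> refined_types T" for t k
    using T that by (auto simp: is_theory_def)
  then show ?thesis
    using True residue_type_eq_ext_type[OF True] locally_one_PI_iff[OF True]
    unfolding is_spec_graph_def graph_of_theory_def superficially_divergent_def
      internal_edges_component_empty vert_ok_def edge_ok_def comp_ok_def by auto
next
  case False
  then show ?thesis by (simp add: is_spec_graph_def graph_of_theory_def)
qed

lemma is_spec_graphD:
  assumes "is_spec_graph T (G, i)"
  shows "is_graph G" "i \<in> extensional (pi0 G)"
  using assms by (auto simp: is_spec_graph_def graph_of_theory_def)

text \<open>A vertex of the contraction carries a pair \<open>(residue_type g C, j C)\<close>, and
  these pairs lie in \<open>refined_types T\<close> because \<open>(g, j)\<close> is a specified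
  graph.\<close>

lemma coproduct_index_iff:
  assumes G: "is_graph G"
  shows "(g, j) \<in> coproduct_index T (G, i) \<longleftrightarrow> is_spec_graph T (g, j) \<and> cov g G \<and>
    (\<forall>C \<in> pi0 g. is_full g G C \<longrightarrow> j C = i C)"
proof -
  have "verts (feyn_graph.extend (contract G g) (dec_graph.fields r)) = pi0 g"
    "rtype (feyn_graph.extend (contract G g) (dec_graph.fields r)) = r" for r
    by (simp_all add: feyn_graph.defs dec_graph.defs contract_def)
  then have "in_theory T (spec_contract (G, i) (g, j))" if "is_spec_graph T (g, j)"
    using that by (simp add: in_theory_def spec_contract_def is_spec_graph_def)
  then show ?thesis
    using full_component_iff[OF G] covering_subgraph_iff[OF G]
    by (auto simp: coproduct_index_def spec_covering_subgraph_def)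
qed

section \<open>Open embeddings\<close>

text \<open>The axiom \<open>open_image\<close> makes the image a union of components of
  \<open>K\<close>: a path that starts in it cannot leave it (\<open>conn_image\<close>). Hence
  components, external half-edges, types and bridges of \<open>G\<close> are those of
  \<open>K\<close> over the image.\<close>

locale graph_embedding =
  fixes f :: "'v \<Rightarrow> 'w" and p :: "'h \<Rightarrow> 'k"
    and G :: "('v, 'h, 'e, 'z) feyn_graph_scheme" and K :: "('w, 'k, 'e, 'y) feyn_graph_scheme"
  assumes G: "is_graph G" and K: "is_graph K"
    and inj_f: "inj_on f (verts G)" and inj_p: "inj_on p (halfedges G)"
    and f_verts: "\<And>v. v \<in> verts G \<Longrightarrow> f v \<in> verts K"
    and p_halfedges: "\<And>h. h \<in> halfedges G \<Longrightarrow> p h \<in> halfedges K"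
    and invol_p: "\<And>h. h \<in> halfedges G \<Longrightarrow> invol K (p h) = p (invol G h)"
    and attach_p: "\<And>h. h \<in> halfedges G \<Longrightarrow> attach K (p h) = f (attach G h)"
    and etype_p: "\<And>h. h \<in> halfedges G \<Longrightarrow> etype K (p h) = etype G h"
    and open_image: "\<And>k. k \<in> halfedges K \<Longrightarrow> attach K k \<in> f ` verts G \<Longrightarrow> k \<in> p ` halfedges G"
begin

lemma conn_image:
  assumes "x \<in> verts G" "(f x, y') \<in> conn K"
  shows "\<exists>y. y' = f y \<and> (x, y) \<in> conn G"
  using assms(2) K
proof (induction rule: conn_induct)
  case refl
  show ?case using conn_refl[OF assms(1)] by (intro exI[of _ x]) simp
next
  case (step k)
  from step(3) obtain y where y: "attach K k = f y" "(x, y) \<in> conn G" by blast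
  then have yV: "y \<in> verts G" using conn_verts[OF y(2)] by simp
  have "k \<in> p ` halfedges G" by (rule open_image[OF step(1)]) (simp add: y(1) yV)
  then obtain h where h: "h \<in> halfedges G" "k = p h" by blast
  then have "attach G h = y"
    using y(1) attach_p[OF h(1)] inj_onD[OF inj_f _ is_graphD(5)[OF G h(1)] yV] by simp
  moreover have "attach K (invol K k) = f (attach G (invol G h))"
    using h invol_p attach_p is_graphD(3)[OF G] by simp
  ultimately show ?case
    using conn_trans[OF G y(2)] conn_attach[OF G h(1)] by blast
qed

lemma conn_iff:
  assumes "x \<in> verts G" "y \<in> verts G"
  shows "(f x, f y) \<in> conn K \<longleftrightarrow> (x, y) \<in> conn G"
proof
  assume "(f x, f y) \<in> conn K"
  then obtain z where "f y = f z" "(x, z) \<in> conn G" using conn_image assms(1) by blast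
  then show "(x, y) \<in> conn G" using inj_onD[OF inj_f, of y z] assms(2) conn_verts by metis
next
  assume "(x, y) \<in> conn G"
  moreover have "(f (attach G h), f (attach G (invol G h))) \<in> conn K" if "h \<in> halfedges G" for h
    using conn_attach[OF K p_halfedges[OF that]] attach_p invol_p that is_graphD(3)[OF G] by simp
  ultimately show "(f x, f y) \<in> conn K"
    using conn_map[of x y G K f] G K f_verts[OF assms(1)] by blast
qed

lemma class_image: "x \<in> verts G \<Longrightarrow> conn K `` {f x} = f ` (conn G `` {x})"
proof (intro equalityI subsetI)
  fix y' assume x: "x \<in> verts G" and "y' \<in> conn K `` {f x}"
  then show "y' \<in> f ` (conn G `` {x})" using conn_image[OF x] by blast
next
  fix y' assume x: "x \<in> verts G" and "y' \<in> f ` (conn G `` {x})"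
  then obtain y where y: "y' = f y" "(x, y) \<in> conn G" by blast
  then show "y' \<in> conn K `` {f x}"
    using conn_iff[OF x, of y] conn_verts[OF y(2)] by simp
qed

lemma pi0_image: "C \<in> pi0 G \<Longrightarrow> f ` C \<in> pi0 K"
  using class_image f_verts by (metis pi0_iff)

lemma pi0_preimage: 
  assumes "C' \<in> pi0 K" "f x \<in> C'" "x \<in> verts G"
  shows "C' = f ` (conn G `` {x})"
  using pi0_class[OF K assms(1,2)] class_image[OF assms(3)] by simp

lemma mem_image_iff: "C \<subseteq> verts G \<Longrightarrow> x \<in> verts G \<Longrightarrow> f x \<in> f ` C \<longleftrightarrow> x \<in> C"
  by (rule inj_on_image_mem_iff[OF inj_f])

lemma fixed_iff: "h \<in> halfedges G \<Longrightarrow> invol K (p h) = p h \<longleftrightarrow> invol G h = h"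
  using invol_p inj_onD[OF inj_p] is_graphD(3)[OF G] by metis

lemma halfedge_preimage:
  assumes "k \<in> halfedges K" "attach K k \<in> f ` C" "C \<subseteq> verts G"
  obtains h where "h \<in> halfedges G" "k = p h" "attach G h \<in> C"
proof -
  obtain h where h: "h \<in> halfedges G" "k = p h" using open_image assms by blast
  then have "attach G h \<in> C"
    using assms(2) attach_p mem_image_iff[OF assms(3)] is_graphD(5)[OF G] by metis
  with h show ?thesis using that by blast
qed

lemma card_halfedges_image:
  assumes C: "C \<subseteq> verts G" and P: "\<And>h. h \<in> halfedges G \<Longrightarrow> P' (p h) \<longleftrightarrow> P h"
  shows "card {k \<in> halfedges K. attach K k \<in> f ` C \<and> P' k} = card {h \<in> halfedges G. attach G h \<in> C \<and> P h}"
proof -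
  let ?A = "{h \<in> halfedges G. attach G h \<in> C \<and> P h}"
  have "{k \<in> halfedges K. attach K k \<in> f ` C \<and> P' k} = p ` ?A"
  proof (intro equalityI subsetI)
    fix k assume k: "k \<in> {k \<in> halfedges K. attach K k \<in> f ` C \<and> P' k}"
    then obtain h where "h \<in> halfedges G" "k = p h" "attach G h \<in> C"
      using halfedge_preimage[OF _ _ C] by auto
    then show "k \<in> p ` ?A" using k P by auto
  qed (use P p_halfedges attach_p in auto)
  moreover have "inj_on p ?A" using inj_p by (rule inj_on_subset) auto
  ultimately show ?thesis by (simp add: card_image)
qed

lemma ext_type_image: "C \<subseteq> verts G \<Longrightarrow> ext_type K (f ` C) = ext_type G C"
  unfolding ext_type_def
  using card_halfedges_image[of C "\<lambda>k. invol K k = k \<and> etype K k = e" "\<lambda>h. invol G h = h \<and> etype G h = e" for e]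
  by (simp add: fixed_iff etype_p conj_commute conj_left_commute)

lemma vertex_type_image: "v \<in> verts G \<Longrightarrow> vertex_type_of K (f v) = vertex_type_of G v"
  unfolding vertex_type_of_def
  using card_halfedges_image[of "{v}" "\<lambda>k. etype K k = e" "\<lambda>h. etype G h = e" for e]
  by (simp add: etype_p)

text \<open>The same pair of maps embeds the cut graphs, so that \<open>conn_iff\<close> applies to
  them; this is how the bridge condition is transported.\<close>

lemma cut_at_embedding:
  assumes h: "h \<in> halfedges G"
  shows "graph_embedding f p (cut_at G h) (cut_at K (p h))"
proof
  show "is_graph (cut_at G h)" by (rule is_graph_cut_at[OF G h])
  show "is_graph (cut_at K (p h))" by (rule is_graph_cut_at[OF K p_halfedges[OF h]])
  fix k assume k: "k \<in> halfedges (cut_at G h)"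
  have "p k \<in> {p h, invol K (p h)} \<longleftrightarrow> k \<in> {h, invol G h}"
    using k h invol_p inj_on_eq_iff[OF inj_p] is_graphD(3)[OF G] by simp
  then show "invol (cut_at K (p h)) (p k) = p (invol (cut_at G h) k)"
    using k invol_p by auto
qed (use inj_f inj_p f_verts p_halfedges attach_p etype_p open_image in auto)

lemma nonbridge_image:
  assumes h: "h \<in> halfedges G"
  shows "nonbridge K (p h) \<longleftrightarrow> nonbridge G h"
proof -
  interpret cut: graph_embedding f p "cut_at G h" "cut_at K (p h)" by (rule cut_at_embedding[OF h])
  show ?thesis
    using cut.conn_iff[of "attach G h" "attach G (invol G h)"] h is_graphD(3,5)[OF G]
    by (simp add: nonbridge_def attach_p invol_p)
qed

end

section \<open>Embeddings of specified graphs\<close>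

definition emb :: "('v \<Rightarrow> 'w) \<Rightarrow> ('h \<Rightarrow> 'k) \<Rightarrow> ('v, 'h, 'e) spec_graph \<Rightarrow> ('w, 'k, 'e) spec_graph \<Rightarrow> bool" where
  "emb f p = (\<lambda>(G, i) (K, j). graph_embedding f p G K \<and> (\<forall>v \<in> verts G. rtype K (f v) = rtype G v) \<and>
     (\<forall>C \<in> pi0 G. j (f ` C) = i C))"

lemma embD:
  assumes "emb f p (G, i) (K, j)"
  shows "graph_embedding f p G K" "\<And>v. v \<in> verts G \<Longrightarrow> rtype K (f v) = rtype G v"
    "\<And>C. C \<in> pi0 G \<Longrightarrow> j (f ` C) = i C"
  using assms by (auto simp: emb_def)

lemma emb_local:
  assumes e: "emb f p (G, i) (K, j)"
  shows "v \<in> verts G \<Longrightarrow> vert_ok T K (f v) \<longleftrightarrow> vert_ok T G v"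
    and "h \<in> halfedges G \<Longrightarrow> edge_ok T K (p h) \<longleftrightarrow> edge_ok T G h"
    and "C \<in> pi0 G \<Longrightarrow> comp_ok T (K, j) (f ` C) \<longleftrightarrow> comp_ok T (G, i) C"
proof -
  interpret graph_embedding f p G K by (rule embD[OF e])
  note rt = embD(2)[OF e]
  show "v \<in> verts G \<Longrightarrow> vert_ok T K (f v) \<longleftrightarrow> vert_ok T G v"
    by (simp add: vert_ok_def rt vertex_type_image)
  show "h \<in> halfedges G \<Longrightarrow> edge_ok T K (p h) \<longleftrightarrow> edge_ok T G h"
    using is_graphD(3)[OF G] by (simp add: edge_ok_def etype_p invol_p nonbridge_image)
  assume C: "C \<in> pi0 G"
  note CV = pi0_subset[OF C]
  \<comment> \<open>The single-vertex clause of \<open>comp_ok\<close> has to be recognised through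
    \<open>f\<close>, which is injective only on \<open>verts G\<close>.\<close>
  have sing: "f ` C = {w} \<longleftrightarrow> (\<exists>v. w = f v \<and> C = {v})" for w
  proof
    assume w: "f ` C = {w}"
    obtain v where v: "v \<in> C" using pi0_nonempty[OF C] by auto
    have "u = v" if "u \<in> C" for u
    proof -
      have "f u = f v" using w v that by (metis imageI singletonD)
      then show ?thesis using inj_onD[OF inj_f, of u v] v that CV by auto
    qed
    then have "C = {v}" using v by blast
    then show "\<exists>v. w = f v \<and> C = {v}" using w by simp
  qed auto
  have "(\<forall>k \<in> halfedges K. attach K k = f v \<longrightarrow> invol K k = k) \<longleftrightarrow>
      (\<forall>h \<in> halfedges G. attach G h = v \<longrightarrow> invol G h = h)" if "C = {v}" for v
  proof -
    have v: "v \<in> verts G" using CV that by simp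
    show ?thesis
    proof (intro iffI ballI impI)
      fix h assume *: "\<forall>k \<in> halfedges K. attach K k = f v \<longrightarrow> invol K k = k"
        "h \<in> halfedges G" "attach G h = v"
      then have "invol K (p h) = p h" using p_halfedges attach_p by simp
      then show "invol G h = h" using fixed_iff *(2) by simp
    next
      fix k assume *: "\<forall>h \<in> halfedges G. attach G h = v \<longrightarrow> invol G h = h"
        "k \<in> halfedges K" "attach K k = f v"
      then obtain h where "h \<in> halfedges G" "k = p h" "attach G h = v"
        using halfedge_preimage[of k "{v}"] v by auto
      then show "invol K k = k" using fixed_iff * by simp
    qed
  qed
  then show "comp_ok T (K, j) (f ` C) \<longleftrightarrow> comp_ok T (G, i) C"
    using rt CV unfolding comp_ok_def prod.case sing ext_type_image[OF CV] embD(3)[OF e C] by auto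
qed

lemma emb_is_spec_graph:
  assumes T: "is_theory T" and e: "emb f p (G, i) (K, j)" and spec: "is_spec_graph T (K, j)"
    and i: "i \<in> extensional (pi0 G)"
  shows "is_spec_graph T (G, i)"
proof -
  interpret graph_embedding f p G K by (rule embD[OF e])
  show ?thesis
    using spec i G emb_local[OF e, of _ T] f_verts p_halfedges pi0_image
    unfolding is_spec_graph_iff[OF T] by blast
qed

text \<open>Every vertex, half-edge and component of \<open>W\<close> lies in one of two open
  pieces, where the local conditions are known. Taking both pieces equal covers the case of one
  embedding onto all vertices.\<close>

lemma is_spec_graph_cover:
  assumes T: "is_theory T" and a: "emb a a' (A, i) (W, l)" and b: "emb b b' (B, j) (W, l)"
    and A: "is_spec_graph T (A, i)" and B: "is_spec_graph T (B, j)"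
    and l: "l \<in> extensional (pi0 W)" and cov: "verts W \<subseteq> a ` verts A \<union> b ` verts B"
  shows "is_spec_graph T (W, l)"
proof -
  interpret a: graph_embedding a a' A W by (rule embD[OF a])
  interpret b: graph_embedding b b' B W by (rule embD[OF b])
  note A' = A[unfolded is_spec_graph_iff[OF T]] and B' = B[unfolded is_spec_graph_iff[OF T]]
  have "vert_ok T W v" if "v \<in> verts W" for v
    using that cov A' B' emb_local(1)[OF a] emb_local(1)[OF b] by blast
  moreover have "edge_ok T W h" if "h \<in> halfedges W" for h
  proof -
    have "attach W h \<in> a ` verts A \<union> b ` verts B"
      using cov is_graphD(5)[OF a.K that] by auto
    then show ?thesis
      using that a.open_image b.open_image A' B' emb_local(2)[OF a] emb_local(2)[OF b] by blast
  qed
  moreover have "comp_ok T (W, l) C" if C: "C \<in> pi0 W" for C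
  proof -
    obtain w where w: "w \<in> C" using pi0_nonempty[OF C] by auto
    then consider v where "v \<in> verts A" "w = a v" | v where "v \<in> verts B" "w = b v"
      using pi0_subset[OF C] cov by blast
    then show ?thesis
    proof cases
      case 1
      then show ?thesis using a.pi0_preimage[OF C] w A' emb_local(3)[OF a] class_in_pi0 by metis
    next
      case 2
      then show ?thesis using b.pi0_preimage[OF C] w B' emb_local(3)[OF b] class_in_pi0 by metis
    qed
  qed
  ultimately show ?thesis using a.K l unfolding is_spec_graph_iff[OF T] by blast
qed

lemma emb_compose:
  assumes "emb f p (A, i) (B, j)" "emb g q (B, j) (C, k)"
  shows "emb (g \<circ> f) (q \<circ> p) (A, i) (C, k)"
proof -
  interpret f: graph_embedding f p A B by (rule embD[OF assms(1)])
  interpret g: graph_embedding g q B C by (rule embD[OF assms(2)])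
  have "graph_embedding (g \<circ> f) (q \<circ> p) A C"
  proof
    show "inj_on (g \<circ> f) (verts A)"
      by (intro comp_inj_on f.inj_f inj_on_subset[OF g.inj_f]) (use f.f_verts in auto)
    show "inj_on (q \<circ> p) (halfedges A)"
      by (intro comp_inj_on f.inj_p inj_on_subset[OF g.inj_p]) (use f.p_halfedges in auto)
    fix k assume k: "k \<in> halfedges C" "attach C k \<in> (g \<circ> f) ` verts A"
    have "f ` verts A \<subseteq> verts B" using f.f_verts by auto
    then obtain h where h: "h \<in> halfedges B" "k = q h" "attach B h \<in> f ` verts A"
      using g.halfedge_preimage[OF k(1), of "f ` verts A"] k(2) unfolding image_comp by blast
    then show "k \<in> (q \<circ> p) ` halfedges A" using f.open_image by auto
  qed (use f.G g.K f.f_verts g.f_verts f.p_halfedges g.p_halfedges f.invol_p g.invol_p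
      f.attach_p g.attach_p f.etype_p g.etype_p in auto)
  moreover have "rtype C ((g \<circ> f) v) = rtype A v" if "v \<in> verts A" for v
    using that embD(2)[OF assms(1)] embD(2)[OF assms(2)] f.f_verts by simp
  moreover have "k ((g \<circ> f) ` D) = i D" if "D \<in> pi0 A" for D
    using that embD(3)[OF assms(1)] embD(3)[OF assms(2)] f.pi0_image by (metis image_comp)
  ultimately show ?thesis by (simp add: emb_def)
qed

text \<open>By openness, an embedding onto the vertices is also onto the half-edges. So an
  isomorphism is just an embedding with all vertices in its image.\<close>

lemma emb_surj_halfedges:
  assumes "emb f p (A, i) (B, j)" "f ` verts A = verts B"
  shows "p ` halfedges A = halfedges B"
proof -
  interpret graph_embedding f p A B by (rule embD[OF assms(1)])
  show ?thesis using p_halfedges open_image is_graphD(5)[OF K] assms(2) by blast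
qed

lemma emb_inverse:
  assumes e: "emb f p (A, i) (B, j)" and sur: "f ` verts A = verts B"
  shows "emb (inv_into (verts A) f) (inv_into (halfedges A) p) (B, j) (A, i)"
    and "inv_into (verts A) f ` verts B = verts A"
proof -
  interpret graph_embedding f p A B by (rule embD[OF e])
  note pur = emb_surj_halfedges[OF e sur]
  let ?f = "inv_into (verts A) f" and ?p = "inv_into (halfedges A) p"
  have fi: "?f (f v) = v" if "v \<in> verts A" for v using that inj_f by simp
  have pi: "?p (p h) = h" if "h \<in> halfedges A" for h using that inj_p by simp
  show im: "?f ` verts B = verts A" using fi by (auto simp flip: sur simp: image_image)
  have fim: "?f ` f ` C = C" if "C \<subseteq> verts A" for C
    using fi that by (force simp: image_image)
  have "graph_embedding ?f ?p B A"
  proof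
    show "inj_on ?f (verts B)" "inj_on ?p (halfedges B)"
      using inj_on_inv_into[of "verts B" f "verts A"] inj_on_inv_into[of "halfedges B" p "halfedges A"]
        sur pur by auto
    fix h assume "h \<in> halfedges A"
    then show "h \<in> ?p ` halfedges B" using pi p_halfedges by (metis imageI)
  next
    fix v assume "v \<in> verts B"
    then show "?f v \<in> verts A" using im by blast
  next
    fix k assume "k \<in> halfedges B"
    then obtain h where h: "h \<in> halfedges A" "k = p h" using pur by blast
    show "?p k \<in> halfedges A" "invol A (?p k) = ?p (invol B k)" "attach A (?p k) = ?f (attach B k)"
      "etype A (?p k) = etype B k"
      using h pi fi is_graphD(3,5)[OF G h(1)] invol_p attach_p etype_p by simp_all
  qed (use G K in auto)
  moreover have "rtype A (?f w) = rtype B w" if "w \<in> verts B" for w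
  proof -
    obtain v where "v \<in> verts A" "w = f v" using \<open>w \<in> verts B\<close> sur by blast
    then show ?thesis using fi embD(2)[OF e] by simp
  qed
  moreover have "i (?f ` D) = j D" if D: "D \<in> pi0 B" for D
  proof -
    obtain w where w: "w \<in> D" using pi0_nonempty[OF D] by auto
    then obtain v where v: "v \<in> verts A" "w = f v" using pi0_subset[OF D] sur by blast
    then have D': "D = f ` (conn A `` {v})" using pi0_preimage[OF D] w by simp
    moreover have "conn A `` {v} \<in> pi0 A" using v(1) by (rule class_in_pi0)
    ultimately show ?thesis
      unfolding D' using fim[OF pi0_subset] embD(3)[OF e] by metis
  qed
  ultimately show "emb ?f ?p (B, j) (A, i)" by (simp add: emb_def)
qed

lemma spec_iso_iff:
  assumes "is_graph G" "is_graph K"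
  shows "spec_iso (G, i) (K, j) \<longleftrightarrow> (\<exists>f p. emb f p (G, i) (K, j) \<and> f ` verts G = verts K)"
proof
  assume "spec_iso (G, i) (K, j)"
  then obtain f p where fp: "bij_betw f (verts G) (verts K)" "bij_betw p (halfedges G) (halfedges K)"
    "\<forall>h \<in> halfedges G. invol K (p h) = p (invol G h) \<and> attach K (p h) = f (attach G h) \<and>
        etype K (p h) = etype G h"
    "\<forall>v \<in> verts G. rtype K (f v) = rtype G v" "\<forall>C \<in> pi0 G. j (f ` C) = i C"
    unfolding spec_iso_def by auto
  then have "graph_embedding f p G K"
    using assms by unfold_locales (auto simp: bij_betw_def)
  then show "\<exists>f p. emb f p (G, i) (K, j) \<and> f ` verts G = verts K"
    using fp by (auto simp: emb_def bij_betw_def)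
next
  assume "\<exists>f p. emb f p (G, i) (K, j) \<and> f ` verts G = verts K"
  then obtain f p where e: "emb f p (G, i) (K, j)" and sur: "f ` verts G = verts K" by blast
  interpret graph_embedding f p G K by (rule embD[OF e])
  show "spec_iso (G, i) (K, j)"
    unfolding spec_iso_def prod.case
    using inj_f inj_p sur emb_surj_halfedges[OF e sur] invol_p attach_p etype_p embD(2,3)[OF e]
    by (intro exI[of _ f] exI[of _ p]) (simp add: bij_betw_def)
qed

text \<open>Both classes consist of graphs over \<open>nat\<close>, so they can be compared although
  \<open>G\<close> and \<open>K\<close> live over different types. Composition with the isomorphism
  and with its inverse gives the two inclusions.\<close>

lemma emb_iso_class:
  fixes G :: "('v, 'h, 'e) spec_graph"
  assumes e: "emb f p G K" and sur: "f ` verts (fst G) = verts (fst K)"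
    and G: "is_spec_graph T G" and K: "is_spec_graph T K"
  shows "iso_class T G = iso_class T K"
proof -
  obtain G1 i where [simp]: "G = (G1, i)" by (cases G)
  obtain K1 j where [simp]: "K = (K1, j)" by (cases K)
  have e: "emb f p (G1, i) (K1, j)" and sur: "f ` verts G1 = verts K1" using e sur by auto
  have g: "is_graph G1" "is_graph K1" using G K is_spec_graphD(1) by auto
  have "spec_iso (G1, i) (L, l) \<longleftrightarrow> spec_iso (K1, j) (L, l)"
    if L: "is_graph L" for L :: "(nat, nat, 'e) dec_graph" and l
    unfolding spec_iso_iff[OF g(1) L] spec_iso_iff[OF g(2) L]
  proof (intro iffI; elim exE conjE)
    fix f' p' assume "emb f' p' (K1, j) (L, l)" "f' ` verts K1 = verts L"
    then show "\<exists>f p. emb f p (G1, i) (L, l) \<and> f ` verts G1 = verts L"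
      using emb_compose[OF e] sur by (metis image_comp)
  next
    fix f' p' assume "emb f' p' (G1, i) (L, l)" "f' ` verts G1 = verts L"
    then show "\<exists>f p. emb f p (K1, j) (L, l) \<and> f ` verts K1 = verts L"
      using emb_compose[OF emb_inverse(1)[OF e sur]] emb_inverse(2)[OF e sur] by (metis image_comp)
  qed
  note iso = this
  have "L \<in> iso_class T G \<longleftrightarrow> L \<in> iso_class T K" for L
  proof -
    obtain L1 l where "L = (L1, l)" by (cases L)
    then show ?thesis
      using iso[of L1 l] is_spec_graphD(1)[of T L1 l] by (auto simp: iso_class_def)
  qed
  then show ?thesis by blast
qed

text \<open>Ensures that isomorphism classes are nonempty, so that \<open>rep\<close> really chooses
  a member. Finiteness supplies injections into \<open>nat\<close>, along which the structure is
  transported.\<close>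

lemma nat_representative:
  fixes G :: "('v, 'h, 'e) dec_graph"
  assumes T: "is_theory T" and spec: "is_spec_graph T (G, i)"
  obtains K :: "(nat, nat, 'e) dec_graph" and j f p
    where "is_spec_graph T (K, j)" "emb f p (G, i) (K, j)" "f ` verts G = verts K"
proof -
  have g: "is_graph G" by (rule is_spec_graphD[OF spec])
  obtain f :: "'v \<Rightarrow> nat" where f: "inj_on f (verts G)"
    using finite_imp_inj_to_nat_seg[OF is_graphD(1)[OF g]] by blast
  obtain p :: "'h \<Rightarrow> nat" where p: "inj_on p (halfedges G)"
    using finite_imp_inj_to_nat_seg[OF is_graphD(2)[OF g]] by blast
  let ?f = "inv_into (verts G) f" and ?p = "inv_into (halfedges G) p"
  define K :: "(nat, nat, 'e) dec_graph" where "K = \<lparr>verts = f ` verts G, halfedges = p ` halfedges G,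
    invol = (\<lambda>k. p (invol G (?p k))), attach = (\<lambda>k. f (attach G (?p k))),
    etype = (\<lambda>k. etype G (?p k)), rtype = (\<lambda>v. rtype G (?f v))\<rparr>"
  define j where "j = restrict (\<lambda>C. i (?f ` C)) (pi0 K)"
  have "graph_embedding f p G K"
    using g f p is_graphD[OF g]
    by unfold_locales (auto simp: K_def is_graph_def)
  then interpret graph_embedding f p G K .
  have "j (f ` C) = i C" if "C \<in> pi0 G" for C
    using that pi0_image[OF that] inv_into_image_cancel[OF f pi0_subset[OF that]] by (simp add: j_def)
  then have e: "emb f p (G, i) (K, j)"
    using \<open>graph_embedding f p G K\<close> f by (simp add: emb_def K_def)
  have sur: "f ` verts G = verts K" by (simp add: K_def)
  have "is_spec_graph T (K, j)"
    by (rule is_spec_graph_cover[OF T e e spec spec]) (simp_all add: sur j_def)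
  then show ?thesis using that e sur by blast
qed

section \<open>Pulling back and gluing subgraphs along embeddings\<close>

lemma pullback:
  assumes T: "is_theory T" and e: "emb f p (G, i) (K, j)"
    and w: "(w, l) \<in> coproduct_index T (K, j)"
  shows "\<exists>g m. (g, m) \<in> coproduct_index T (G, i) \<and> emb f p (g, m) (w, l)"
proof -
  interpret graph_embedding f p G K by (rule embD[OF e])
  have ws: "is_spec_graph T (w, l)" and wc: "cov w K"
    and wf: "\<And>C. C \<in> pi0 w \<Longrightarrow> is_full w K C \<Longrightarrow> l C = j C"
    using w coproduct_index_iff[OF K] by auto
  let ?p = "inv_into (halfedges G) p"
  \<comment> \<open>\<open>g\<close> cuts \<open>h\<close> exactly when \<open>w\<close> cuts
    \<open>p h\<close>. On half-edges \<open>w\<close> stays inside the image, so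
    \<open>inv_into\<close> is meaningful there; elsewhere the involution of \<open>G\<close> is
    kept, as \<open>cov\<close> demands.\<close>
  define g where "g = G\<lparr>invol := (\<lambda>h. if h \<in> halfedges G then ?p (invol w (p h)) else invol G h)\<rparr>"
  define m where "m = restrict (\<lambda>C. l (f ` C)) (pi0 g)"
  have g_simps: "verts g = verts G" "halfedges g = halfedges G" "attach g = attach G"
    "etype g = etype G" "rtype g = rtype G"
    by (simp_all add: g_def)
  have inv: "invol w (p h) = p (invol g h) \<and> (invol g h = h \<or> invol g h = invol G h)"
    if h: "h \<in> halfedges G" for h
    using covD(5)[OF wc p_halfedges[OF h]] invol_p[OF h] h is_graphD(3)[OF G h] inj_p
    by (auto simp: g_def)
  have "invol g (invol g h) = h" if h: "h \<in> halfedges G" for h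
  proof -
    have m: "invol g h \<in> halfedges G" using inv[OF h] h is_graphD(3)[OF G h] by auto
    then have "p (invol g (invol g h)) = p h"
      using inv[OF h] inv[OF m] covD(6)[OF wc p_halfedges[OF h]] by metis
    moreover have "invol g (invol g h) \<in> halfedges G"
      using inv[OF m] m is_graphD(3)[OF G m] by auto
    ultimately show ?thesis using inj_onD[OF inj_p] h by blast
  qed
  moreover have "g = G\<lparr>invol := invol g\<rparr>" by (simp add: g_def)
  moreover have "invol g h = invol G h" if "h \<notin> halfedges G" for h using that by (simp add: g_def)
  ultimately have c: "cov g G" using inv unfolding cov_def by blast
  then have gg: "is_graph g" using G by (rule cov_is_graph)
  have ge: "graph_embedding f p g w"
    using gg cov_is_graph[OF wc K] inj_f inj_p f_verts p_halfedges inv attach_p etype_p open_image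
    by unfold_locales (simp_all add: g_simps covD[OF wc])
  then interpret gw: graph_embedding f p g w .
  have e': "emb f p (g, m) (w, l)"
    using ge embD(2)[OF e] by (simp add: emb_def g_simps cov_rtype[OF wc] m_def)
  have "is_spec_graph T (g, m)"
    by (rule emb_is_spec_graph[OF T e' ws]) (simp add: m_def)
  moreover have "m C = i C" if C: "C \<in> pi0 g" and full: "is_full g G C" for C
  proof -
    have CV: "C \<subseteq> verts G" using pi0_subset[OF C] by (simp add: g_simps)
    \<comment> \<open>By openness every half-edge of \<open>K\<close> at the image of
      \<open>C\<close> comes from one of \<open>G\<close> at \<open>C\<close>, so fullness moves to
      \<open>K\<close>, where the specifications are known to agree.\<close>
    have "is_full w K (f ` C)"
      unfolding is_full_def
    proof (intro ballI impI)
      fix k assume "k \<in> halfedges K" "attach K k \<in> f ` C"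
      then obtain h where "h \<in> halfedges G" "k = p h" "attach G h \<in> C"
        using halfedge_preimage CV by blast
      then show "invol w k = invol K k" using full inv invol_p by (simp add: is_full_def)
    qed
    then have "l (f ` C) = j (f ` C)" by (intro wf gw.pi0_image C)
    moreover have "C \<in> pi0 G" by (rule full_pi0[OF G c C full])
    ultimately show ?thesis using C embD(3)[OF e] by (simp add: m_def)
  qed
  ultimately have "(g, m) \<in> coproduct_index T (G, i)"
    using c coproduct_index_iff[OF G] by blast
  then show ?thesis using e' by blast
qed

lemma pullback_unique:
  assumes e: "emb f p (g, m) (w, l)" and e': "emb f p (g', m') (w, l)"
    and g: "(g, m) \<in> coproduct_index T (G, i)" and g': "(g', m') \<in> coproduct_index T (G, i)"
    and G: "is_graph G"
  shows "(g, m) = (g', m')"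
proof -
  interpret g: graph_embedding f p g w by (rule embD[OF e])
  interpret g': graph_embedding f p g' w by (rule embD[OF e'])
  have s: "is_spec_graph T (g, m)" "is_spec_graph T (g', m')" and c: "cov g G" "cov g' G"
    using g g' coproduct_index_iff[OF G] by auto
  have "invol g h = invol g' h" if "h \<in> halfedges G" for h
    using g.invol_p g'.invol_p that inj_onD[OF g.inj_p] is_graphD(3)[OF g.G] is_graphD(3)[OF g'.G]
      covD(2)[OF c(1)] covD(2)[OF c(2)] by metis
  then have "g = g'" by (rule cov_eqI[OF c])
  moreover from this have "m = m'"
    using is_spec_graphD(2)[OF s(1)] is_spec_graphD(2)[OF s(2)] embD(3)[OF e] embD(3)[OF e']
    by (intro extensionalityI[of m "pi0 g"]) auto
  ultimately show ?thesis by simp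
qed

text \<open>Each half-edge and each component of a subgraph of \<open>W\<close> lies in one of the
  two open pieces, and there its value is dictated by the pullback. With both pieces equal this
  gives uniqueness along an isomorphism.\<close>

lemma glue_unique:
  assumes a: "emb a a' (A, i) (w, l)" "emb a a' (A, i) (w', l')"
    and b: "emb b b' (B, j) (w, l)" "emb b b' (B, j) (w', l')"
    and w: "(w, l) \<in> coproduct_index T (W, k)" and w': "(w', l') \<in> coproduct_index T (W, k)"
    and W: "is_graph W" and sur: "verts W \<subseteq> a ` verts A \<union> b ` verts B"
  shows "(w, l) = (w', l')"
proof -
  interpret a: graph_embedding a a' A w by (rule embD[OF a(1)])
  interpret a': graph_embedding a a' A w' by (rule embD[OF a(2)])
  interpret b: graph_embedding b b' B w by (rule embD[OF b(1)])
  interpret b': graph_embedding b b' B w' by (rule embD[OF b(2)])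
  have s: "is_spec_graph T (w, l)" "is_spec_graph T (w', l')" and c: "cov w W" "cov w' W"
    using w w' coproduct_index_iff[OF W] by auto
  have "invol w h = invol w' h" if h: "h \<in> halfedges W" for h
  proof -
    have "attach W h \<in> a ` verts A \<union> b ` verts B"
      using sur is_graphD(5)[OF W h] by auto
    then have "h \<in> a' ` halfedges A \<or> h \<in> b' ` halfedges B"
      using a.open_image[of h] b.open_image[of h] h covD[OF c(1)] by auto
    then show ?thesis using a.invol_p a'.invol_p b.invol_p b'.invol_p by auto
  qed
  then have ww: "w = w'" by (rule cov_eqI[OF c])
  have "l C = l' C" if C: "C \<in> pi0 w" for C
  proof -
    obtain x where x: "x \<in> C" using pi0_nonempty[OF C] by auto
    then have "x \<in> a ` verts A \<union> b ` verts B"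
      using sur pi0_subset[OF C] covD(1)[OF c(1)] by auto
    then consider v where "v \<in> verts A" "x = a v" | v where "v \<in> verts B" "x = b v" by auto
    then show ?thesis
    proof cases
      case 1
      then show ?thesis using a.pi0_preimage[OF C] x embD(3)[OF a(1)] embD(3)[OF a(2)] class_in_pi0 by metis
    next
      case 2
      then show ?thesis using b.pi0_preimage[OF C] x embD(3)[OF b(1)] embD(3)[OF b(2)] class_in_pi0 by metis
    qed
  qed
  then have "l = l'"
    using is_spec_graphD(2)[OF s(1)] is_spec_graphD(2)[OF s(2)] ww
    by (intro extensionalityI[of l "pi0 w"]) auto
  then show ?thesis using ww by simp
qed

section \<open>Contraction\<close>

definition dec_contract :: "('v, 'h, 'e) dec_graph \<Rightarrow> ('v, 'h, 'e) dec_graph \<Rightarrow> ('v set \<Rightarrow> nat)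
    \<Rightarrow> ('v set, 'h, 'e) dec_graph" where
  "dec_contract G g j =
     feyn_graph.extend (contract G g) (dec_graph.fields (\<lambda>C. (residue_type g C, j C)))"

lemma dec_contract_simps [simp]:
  "verts (dec_contract G g j) = pi0 g"
  "halfedges (dec_contract G g j) = {h \<in> halfedges g. invol g h = h}"
  "invol (dec_contract G g j) = invol G"
  "attach (dec_contract G g j) = (\<lambda>h. conn g `` {attach G h})"
  "etype (dec_contract G g j) = etype G"
  "rtype (dec_contract G g j) = (\<lambda>C. (residue_type g C, j C))"
  by (simp_all add: dec_contract_def contract_def feyn_graph.defs dec_graph.defs)

lemma spec_contract_eq:
  "spec_contract (G, i) (g, j) =
    (dec_contract G g j, restrict (\<lambda>D. i (\<Union>D)) (pi0 (dec_contract G g j)))"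
proof -
  have "pi0 (dec_contract G g j) = pi0 (contract G g)"
    by (simp add: pi0_def conn_def contract_def)
  then show ?thesis by (simp add: spec_contract_def dec_contract_def)
qed

lemma rtype_cut_edges: "rtype (cut_edges G S) = rtype G"
  by (simp add: cut_edges_def)

lemma cut_dec_contract: "cut_edges (dec_contract G g j) S = dec_contract (cut_edges G S) g j"
proof -
  have "invol (cut_edges (dec_contract G g j) S) = invol (dec_contract (cut_edges G S) g j)"
    by (rule ext) simp
  then show ?thesis by (intro dec_graph.equality) (simp_all add: rtype_cut_edges)
qed

lemma cov_cut_at:
  assumes G: "is_graph G" and c: "cov g G" and h: "h \<in> halfedges G" "invol g h = h"
  shows "cov g (cut_at G h)"
proof -
  have "g = G\<lparr>invol := invol g\<rparr>" using c by (simp add: cov_def)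
  then have "g = (cut_at G h)\<lparr>invol := invol g\<rparr>" by (simp add: cut_edges_def)
  moreover have "invol g k = k" if "k \<in> {h, invol G h}" for k
    using that h cov_fixed_invol[OF c G h] by auto
  ultimately show ?thesis
    using covD(5-7)[OF c] h is_graphD(3)[OF G h(1)] unfolding cov_def by auto
qed

text \<open>\<open>d\<close> is only assumed to be a covering subgraph and \<open>k\<close> is
  arbitrary. This allows the locale to be instantiated again with an edge of \<open>G\<close> cut,
  which is how bridges are compared.\<close>

locale contraction =
  fixes G d :: "('v, 'h, 'e) dec_graph" and k :: "'v set \<Rightarrow> nat"
  assumes G: "is_graph G" and d_cov: "cov d G"
begin

abbreviation "Q \<equiv> dec_contract G d k"
abbreviation "cl x \<equiv> conn d `` {x}"

lemma d: "is_graph d" using d_cov G by (rule cov_is_graph)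

lemmas d_simps = covD(1-4)[OF d_cov]

lemma cl_in_pi0: "x \<in> verts G \<Longrightarrow> cl x \<in> pi0 d"
  using class_in_pi0[of x d] by (simp add: d_simps)

lemma Q: "is_graph Q"
  unfolding is_graph_def
proof (intro conjI ballI)
  show "finite (verts Q)" using finite_pi0[OF d] by simp
  show "finite (halfedges Q)" using is_graphD(2)[OF d] by simp
  fix h assume "h \<in> halfedges Q"
  then have h: "h \<in> halfedges G" "invol d h = h" by (auto simp: d_simps)
  show "invol Q h \<in> halfedges Q"
    using h is_graphD(3)[OF G] cov_fixed_invol[OF d_cov G h] by (simp add: d_simps)
  show "invol Q (invol Q h) = h" using is_graphD(4)[OF G h(1)] by simp
  show "attach Q h \<in> verts Q" using is_graphD(5)[OF G h(1)] cl_in_pi0 by simp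
qed

text \<open>An edge of \<open>G\<close> is either cut in \<open>d\<close>, and then it is an edge of
  \<open>Q\<close>, or kept in \<open>d\<close>, and then both ends have the same class.\<close>

lemma conn_contract:
  assumes x: "x \<in> verts G" and y: "y \<in> verts G"
  shows "(cl x, cl y) \<in> conn Q \<longleftrightarrow> (x, y) \<in> conn G"
proof
  assume "(cl x, cl y) \<in> conn Q"
  \<comment> \<open>The induction runs over classes, not vertices, so the claim is made for every
    vertex of the current class.\<close>
  from this Q have "\<forall>z \<in> cl y. (x, z) \<in> conn G"
  proof (induction rule: conn_induct)
    case refl
    then show ?case using cov_conn[OF G d_cov] by blast
  next
    case (step h)
    then have h: "h \<in> halfedges G" "\<forall>z \<in> cl (attach G h). (x, z) \<in> conn G" by (auto simp: d_simps)
    have "attach G h \<in> cl (attach G h)"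
      using is_graphD(5)[OF G h(1)] mem_class[of _ d] by (simp add: d_simps)
    then have "(x, attach G (invol G h)) \<in> conn G"
      using h(2) conn_trans[OF G _ conn_attach[OF G h(1)]] by blast
    then show ?case using cov_conn[OF G d_cov] conn_trans[OF G] by auto
  qed
  then show "(x, y) \<in> conn G" using mem_class[of y d] y by (simp add: d_simps)
next
  assume "(x, y) \<in> conn G"
  moreover have "(cl (attach G h), cl (attach G (invol G h))) \<in> conn Q" if h: "h \<in> halfedges G" for h
  proof (cases "invol d h = h")
    case True
    then show ?thesis using conn_attach[OF Q, of h] h by (simp add: d_simps)
  next
    case False
    then have "invol d h = invol G h" using covD(5)[OF d_cov h] by simp
    then have "(attach G h, attach G (invol G h)) \<in> conn d"
      using conn_attach[OF d, of h] h by (simp add: d_simps)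
    then have "cl (attach G h) = cl (attach G (invol G h))"
      using equiv_class_eq[OF equiv_conn[OF d]] by blast
    then show ?thesis using conn_refl[of _ Q] cl_in_pi0[OF is_graphD(5)[OF G h]] by simp
  qed
  ultimately show "(cl x, cl y) \<in> conn Q"
    using conn_map[of x y G Q cl] G Q cl_in_pi0[OF x] by simp
qed

lemma mem_Union_iff:
  assumes D: "D \<in> pi0 Q" and x: "x \<in> verts G"
  shows "x \<in> \<Union>D \<longleftrightarrow> cl x \<in> D"
proof
  assume "x \<in> \<Union>D"
  then obtain c where c: "c \<in> D" "x \<in> c" by blast
  then have "c \<in> pi0 d" using pi0_subset[OF D] by auto
  then show "cl x \<in> D" using pi0_class[OF d _ c(2)] c(1) by simp
next
  assume "cl x \<in> D"
  then show "x \<in> \<Union>D" using mem_class[of x d] x by (auto simp: d_simps)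
qed

lemma Union_class:
  assumes x: "x \<in> verts G"
  shows "\<Union>(conn Q `` {cl x}) = conn G `` {x}"
proof -
  have Dp: "conn Q `` {cl x} \<in> pi0 Q" using cl_in_pi0[OF x] by (intro class_in_pi0) simp
  have "\<Union>(conn Q `` {cl x}) \<subseteq> verts G"
    using pi0_subset[OF Dp] pi0_subset[of _ d] by (fastforce simp: d_simps)
  then show ?thesis
    using mem_Union_iff[OF Dp] conn_contract[OF x] conn_verts[of x _ G] by blast
qed

lemma Union_in_pi0: "D \<in> pi0 Q \<Longrightarrow> \<Union>D \<in> pi0 G"
proof -
  assume D: "D \<in> pi0 Q"
  then obtain c where c: "c \<in> pi0 d" "D = conn Q `` {c}" by (auto simp: pi0_iff[of D])
  then obtain x where "x \<in> verts G" "c = cl x" by (auto simp: pi0_iff d_simps)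
  then show "\<Union>D \<in> pi0 G" using Union_class[of x] c(2) class_in_pi0 by simp
qed

text \<open>Together with \<open>Union_in_pi0\<close> and \<open>Union_preimage\<close>, this makes
  \<open>Union\<close> a bijection from the components of \<open>Q\<close> to those of
  \<open>G\<close>; the inverse is written without choosing a vertex.\<close>

lemma parts_Union: "D \<in> pi0 Q \<Longrightarrow> {c \<in> pi0 d. c \<subseteq> \<Union>D} = D"
proof -
  assume D: "D \<in> pi0 Q"
  have "c \<in> D" if c: "c \<in> pi0 d" "c \<subseteq> \<Union>D" for c
  proof -
    obtain x where x: "x \<in> c" using pi0_nonempty[OF c(1)] by auto
    then have "cl x \<in> D"
      using mem_Union_iff[OF D, of x] c pi0_subset[OF c(1)] by (auto simp: d_simps)
    then show ?thesis using pi0_class[OF d c(1) x] by simp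
  qed
  then show "{c \<in> pi0 d. c \<subseteq> \<Union>D} = D" using pi0_subset[OF D] by auto
qed

lemma Union_preimage:
  assumes C: "C \<in> pi0 G"
  shows "{c \<in> pi0 d. c \<subseteq> C} \<in> pi0 Q" "\<Union>{c \<in> pi0 d. c \<subseteq> C} = C"
proof -
  obtain x where x: "x \<in> C" using pi0_nonempty[OF C] by auto
  then have xV: "x \<in> verts G" using pi0_subset[OF C] by auto
  let ?D = "conn Q `` {cl x}"
  have D: "?D \<in> pi0 Q" using cl_in_pi0[OF xV] by (intro class_in_pi0) simp
  have U: "\<Union>?D = C" using Union_class[OF xV] pi0_class[OF G C x] by simp
  have "{c \<in> pi0 d. c \<subseteq> C} = ?D" using parts_Union[OF D] unfolding U .
  then show "{c \<in> pi0 d. c \<subseteq> C} \<in> pi0 Q" "\<Union>{c \<in> pi0 d. c \<subseteq> C} = C" using D U by simp_all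
qed

text \<open>Contraction drops only half-edges moved by \<open>d\<close>, and an external half-edge
  of \<open>G\<close> is fixed by \<open>d\<close>; so all external half-edges survive.\<close>

lemma ext_type_contract:
  assumes D: "D \<in> pi0 Q"
  shows "ext_type Q D = ext_type G (\<Union>D)"
proof -
  have "{h \<in> halfedges Q. invol Q h = h \<and> attach Q h \<in> D \<and> etype Q h = e} =
    {h \<in> halfedges G. invol G h = h \<and> attach G h \<in> \<Union>D \<and> etype G h = e}" for e
    using mem_Union_iff[OF D] is_graphD(5)[OF G] cov_fixed[OF d_cov] by (auto simp: d_simps)
  then show ?thesis by (simp add: ext_type_def)
qed

lemma vertex_type_contract:
  assumes c: "c \<in> pi0 d"
  shows "vertex_type_of Q c = ext_type d c"
proof -
  have "cl (attach G h) = c \<longleftrightarrow> attach G h \<in> c" if "h \<in> halfedges G" for h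
    using pi0_class[OF d c] mem_class[of "attach G h" d] is_graphD(5)[OF G that] by (auto simp: d_simps)
  then have "{h \<in> halfedges Q. attach Q h = c \<and> etype Q h = e} =
    {h \<in> halfedges d. invol d h = h \<and> attach d h \<in> c \<and> etype d h = e}" for e
    by (auto simp: d_simps)
  then show ?thesis by (simp add: ext_type_def vertex_type_of_def)
qed

text \<open>A half-edge of \<open>Q\<close> is one that \<open>d\<close> leaves fixed, so
  \<open>d\<close> is a covering subgraph of \<open>cut_at G h\<close> as well, and cutting commutes
  with contraction. The claim is then \<open>conn_contract\<close> for the cut graph.\<close>

lemma nonbridge_contract:
  assumes h: "h \<in> halfedges Q"
  shows "nonbridge Q h \<longleftrightarrow> nonbridge G h"
proof -
  have h': "h \<in> halfedges G" "invol d h = h" using h by (auto simp: d_simps)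
  interpret cut: contraction "cut_at G h" d k
    using is_graph_cut_at[OF G h'(1)] cov_cut_at[OF G d_cov h'] by unfold_locales
  show ?thesis
    using cut.conn_contract[of "attach G h" "attach G (invol G h)"] is_graphD(3,5)[OF G] h'(1)
    by (simp add: nonbridge_def cut_dec_contract)
qed

end

lemma contractionI: "(d, k) \<in> coproduct_index T (G, i) \<Longrightarrow> is_graph G \<Longrightarrow> contraction G d"
  by (simp add: contraction_def coproduct_index_iff)

text \<open>The vertices of \<open>Q\<close> inherit their conditions from the components of
  \<open>d\<close>, the half-edges from \<open>G\<close>, and the components from \<open>G\<close>
  through \<open>Union\<close>. Only the single-vertex clause combines both sides.\<close>

lemma is_spec_graph_contract:
  assumes T: "is_theory T" and spec: "is_spec_graph T (G, i)" and dk: "(d, k) \<in> coproduct_index T (G, i)"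
  shows "is_spec_graph T (spec_contract (G, i) (d, k))"
proof -
  interpret contraction G d k using dk by (rule contractionI) (rule is_spec_graphD[OF spec])
  have ds: "is_spec_graph T (d, k)"
    and full: "\<And>C. C \<in> pi0 d \<Longrightarrow> is_full d G C \<Longrightarrow> k C = i C"
    using dk coproduct_index_iff[OF G] by auto
  note S = spec[unfolded is_spec_graph_iff[OF T]]
  note dS = ds[unfolded is_spec_graph_iff[OF T]]
  let ?i = "restrict (\<lambda>D. i (\<Union>D)) (pi0 Q)"
  have "vert_ok T Q c" if c: "c \<in> verts Q" for c
    using dS c residue_type_eq_ext_type[OF d, of c]
    by (simp add: vert_ok_def comp_ok_def vertex_type_contract)
  moreover have "edge_ok T Q h" if h: "h \<in> halfedges Q" for h
    using S h nonbridge_contract[OF h] by (simp add: edge_ok_def d_simps)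
  moreover have "comp_ok T (Q, ?i) D" if D: "D \<in> pi0 Q" for D
  proof -
    \<comment> \<open>If the vertex \<open>c\<close> of \<open>Q\<close> has no internal edges, then
      \<open>d\<close> keeps all edges of \<open>G\<close> at \<open>c\<close>. So \<open>c\<close>
      is a full component, where \<open>k\<close> and \<open>i\<close> agree.\<close>
    have "i c = k c" if c: "D = {c}" and ext: "\<forall>h \<in> halfedges Q. attach Q h = c \<longrightarrow> invol Q h = h" for c
    proof -
      have cd: "c \<in> pi0 d" using pi0_subset[OF D] c by simp
      have "invol d h = invol G h" if h: "h \<in> halfedges G" "attach G h \<in> c" for h
        using ext pi0_class[OF d cd h(2)] h(1) covD(5)[OF d_cov h(1)]
        by (auto simp: d_simps)
      then show ?thesis using full[OF cd] by (simp add: is_full_def)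
    qed
    moreover have "(ext_type Q D, ?i D) \<in> refined_types T"
      using S Union_in_pi0[OF D] D by (simp add: comp_ok_def ext_type_contract)
    ultimately show ?thesis using D by (auto simp: comp_ok_def)
  qed
  ultimately show ?thesis
    using Q unfolding spec_contract_eq is_spec_graph_iff[OF T] by simp
qed

text \<open>Contraction is functorial: one pair of maps embedding both the graphs and the subgraphs
  induces an embedding of the quotients, acting on vertices by taking images of components.\<close>

lemma emb_contract:
  assumes e: "emb f p (G, i) (W, l)" and e': "emb f p (g, m) (w, n)"
    and g: "(g, m) \<in> coproduct_index T (G, i)" and w: "(w, n) \<in> coproduct_index T (W, l)"
  shows "emb (image f) p (spec_contract (G, i) (g, m)) (spec_contract (W, l) (w, n))"
proof -
  interpret E: graph_embedding f p G W by (rule embD[OF e])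
  interpret E': graph_embedding f p g w by (rule embD[OF e'])
  interpret g: contraction G g m using g E.G by (rule contractionI)
  interpret w: contraction W w n using w E.K by (rule contractionI)
  have gV: "C \<subseteq> verts G" if "C \<in> pi0 g" for C using pi0_subset[OF that] by (simp add: g.d_simps)
  have "graph_embedding (image f) p g.Q w.Q"
  proof
    show "inj_on (image f) (verts g.Q)"
      using inj_on_image_eq_iff[OF E.inj_f] gV by (auto intro!: inj_onI)
    show "inj_on p (halfedges g.Q)" using E'.inj_p by (rule inj_on_subset) auto
    fix h assume "h \<in> halfedges g.Q"
    then have h: "h \<in> halfedges G" "invol g h = h" by (auto simp: g.d_simps)
    show "p h \<in> halfedges w.Q"
      using h E'.fixed_iff[of h] E'.p_halfedges[of h] by (simp add: g.d_simps)
    show "attach w.Q (p h) = f ` attach g.Q h"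
      using E'.class_image[of "attach G h"] E.attach_p[OF h(1)] is_graphD(5)[OF E.G h(1)]
      by (simp add: g.d_simps)
  next
    fix h assume h: "h \<in> halfedges w.Q" "attach w.Q h \<in> image f ` verts g.Q"
    then obtain C where C: "C \<in> pi0 g" "conn w `` {attach W h} = f ` C" by auto
    have hW: "h \<in> halfedges W" "invol w h = h" using h by (auto simp: w.d_simps)
    have "attach W h \<in> f ` C"
      using C(2) mem_class[of "attach W h" w] is_graphD(5)[OF E.K hW(1)] by (simp add: w.d_simps)
    then obtain h' where h': "h' \<in> halfedges G" "h = p h'"
      using E.halfedge_preimage[OF hW(1) _ gV[OF C(1)]] by blast
    then show "h \<in> p ` halfedges g.Q"
      using hW E'.fixed_iff[of h'] by (auto simp: g.d_simps)
  qed (use g.Q w.Q E'.pi0_image E.invol_p E.etype_p in \<open>auto simp: g.d_simps\<close>)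
  then interpret Q: graph_embedding "image f" p g.Q w.Q .
  have "rtype w.Q (f ` C) = rtype g.Q C" if C: "C \<in> verts g.Q" for C
  proof -
    have C: "C \<in> pi0 g" using C by simp
    have "residue_type w (f ` C) = residue_type g C"
      using residue_type_eq_ext_type[OF w.d E'.pi0_image[OF C]] residue_type_eq_ext_type[OF g.d C]
        E'.ext_type_image[OF pi0_subset[OF C]] by simp
    then show ?thesis using embD(3)[OF e' C] by simp
  qed
  moreover have "restrict (\<lambda>D. l (\<Union>D)) (pi0 w.Q) (image f ` D) = restrict (\<lambda>D. i (\<Union>D)) (pi0 g.Q) D"
    if D: "D \<in> pi0 g.Q" for D
  proof -
    have "\<Union>(image f ` D) = f ` \<Union>D" by blast
    then show ?thesis
      using embD(3)[OF e g.Union_in_pi0[OF D]] Q.pi0_image[OF D] D by simp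
  qed
  ultimately show ?thesis
    using Q.graph_embedding_axioms unfolding spec_contract_eq emb_def by simp
qed

lemma pi0_cover:
  assumes a: "emb a a' (A, i) (W, l)" and b: "emb b b' (B, j) (W, l)"
    and sur: "verts W \<subseteq> a ` verts A \<union> b ` verts B"
  shows "pi0 W \<subseteq> image a ` pi0 A \<union> image b ` pi0 B"
proof
  interpret a: graph_embedding a a' A W by (rule embD[OF a])
  interpret b: graph_embedding b b' B W by (rule embD[OF b])
  fix C assume C: "C \<in> pi0 W"
  obtain x where x: "x \<in> C" using pi0_nonempty[OF C] by auto
  then consider v where "v \<in> verts A" "x = a v" | v where "v \<in> verts B" "x = b v"
    using sur pi0_subset[OF C] by blast
  then show "C \<in> image a ` pi0 A \<union> image b ` pi0 B"
  proof cases
    case 1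
    then have "C = a ` (conn A `` {v})" using a.pi0_preimage[OF C] x by simp
    then show ?thesis using class_in_pi0[OF 1(1)] by blast
  next
    case 2
    then have "C = b ` (conn B `` {v})" using b.pi0_preimage[OF C] x by simp
    then show ?thesis using class_in_pi0[OF 2(1)] by blast
  qed
qed

section \<open>Iterated contraction\<close>

text \<open>If \<open>d\<close> keeps all edges of \<open>G\<close> at \<open>C\<close>, so does the
  intermediate graph \<open>g\<close>; the values on \<open>C\<close> then agree in two steps, first
  from \<open>d\<close> to \<open>g\<close> and then from \<open>g\<close> to
  \<open>G\<close>.\<close>

lemma coproduct_index_trans:
  assumes G: "is_graph G" and g: "(g, j) \<in> coproduct_index T (G, i)"
    and d: "(d, k) \<in> coproduct_index T (g, j)"
  shows "(d, k) \<in> coproduct_index T (G, i)"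
proof -
  have gc: "cov g G" and gf: "\<And>C. C \<in> pi0 g \<Longrightarrow> is_full g G C \<Longrightarrow> j C = i C"
    using g coproduct_index_iff[OF G] by auto
  have gg: "is_graph g" using gc G by (rule cov_is_graph)
  have ds: "is_spec_graph T (d, k)" and dc: "cov d g"
    and df: "\<And>C. C \<in> pi0 d \<Longrightarrow> is_full d g C \<Longrightarrow> k C = j C"
    using d coproduct_index_iff[OF gg] by auto
  have "k C = i C" if C: "C \<in> pi0 d" and f: "is_full d G C" for C
  proof -
    have "invol g h = invol G h" "invol d h = invol g h" if h: "h \<in> halfedges G" "attach G h \<in> C" for h
      using f h covD(5)[OF gc h(1)] covD(5)[OF dc, of h] covD(2)[OF gc] by (auto simp: is_full_def)
    then have "is_full g G C" "is_full d g C" by (auto simp: is_full_def covD[OF gc])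
    then show ?thesis using df[OF C] gf[OF full_pi0[OF gg dc C]] by simp
  qed
  then show ?thesis using ds cov_trans[OF G dc gc] coproduct_index_iff[OF G] by blast
qed

lemma invol_eq_of_moved:
  assumes "cov d g" "cov g G" "h \<in> halfedges G" "invol d h \<noteq> h"
  shows "invol g h = invol G h" "invol d h = invol g h"
  using assms covD(5)[of d g h] covD(5)[of g G h] covD(2)[of g G] by auto

text \<open>Inheritance for \<open>g/d \<subseteq> G/d\<close> comes from
  \<open>g \<subseteq> G\<close>: if \<open>D\<close> is full in \<open>G/d\<close>, then its union
  is full in \<open>G\<close>, because an edge that \<open>d\<close> keeps is kept by
  \<open>g\<close> anyway.\<close>

lemma spec_contract_in_coproduct_index:
  assumes T: "is_theory T" and spec: "is_spec_graph T (G, i)"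
    and g: "(g, j) \<in> coproduct_index T (G, i)" and dk: "(d, k) \<in> coproduct_index T (g, j)"
  shows "spec_contract (g, j) (d, k) \<in> coproduct_index T (spec_contract (G, i) (d, k))"
proof -
  have gr: "is_graph G" by (rule is_spec_graphD[OF spec])
  have gs: "is_spec_graph T (g, j)" and gc: "cov g G"
    and gf: "\<And>C. C \<in> pi0 g \<Longrightarrow> is_full g G C \<Longrightarrow> j C = i C"
    using g coproduct_index_iff[OF gr] by auto
  interpret A: contraction G d k
    using coproduct_index_trans[OF gr g dk] gr by (rule contractionI)
  interpret B: contraction g d k
    using dk is_spec_graphD(1)[OF gs] by (rule contractionI)
  note moved = invol_eq_of_moved[OF B.d_cov gc]
  have c: "cov B.Q A.Q"
    unfolding cov_def
  proof (intro conjI ballI allI impI)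
    show "B.Q = A.Q\<lparr>invol := invol B.Q\<rparr>"
      by (intro dec_graph.equality) (simp_all add: covD[OF gc])
    fix h assume "h \<in> halfedges A.Q"
    then have "h \<in> halfedges G" by (simp add: A.d_simps)
    then show "invol B.Q h = h \<or> invol B.Q h = invol A.Q h" "invol B.Q (invol B.Q h) = h"
      using covD(5,6)[OF gc] by auto
  next
    \<comment> \<open>This includes the half-edges that \<open>d\<close> moves; on these
      \<open>g\<close> and \<open>G\<close> agree, since \<open>g\<close> keeps every edge that
      \<open>d\<close> keeps.\<close>
    fix h assume "h \<notin> halfedges A.Q"
    then show "invol B.Q h = invol A.Q h"
      using moved(1) covD(7)[OF gc] by (auto simp: A.d_simps)
  qed
  have "j (\<Union>D) = i (\<Union>D) \<and> D \<in> pi0 A.Q" if D: "D \<in> pi0 B.Q" and f: "is_full B.Q A.Q D" for D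
  proof
    have "invol g h = invol G h" if h: "h \<in> halfedges G" "attach G h \<in> \<Union>D" for h
    proof (cases "invol d h = h")
      case True
      then have "h \<in> halfedges A.Q" using h by (simp add: A.d_simps)
      moreover have "attach A.Q h \<in> D"
        using B.mem_Union_iff[OF D, of "attach G h"] h is_graphD(5)[OF A.G h(1)]
        by (simp add: covD[OF gc])
      ultimately show ?thesis using f unfolding is_full_def dec_contract_simps(3) by blast
    qed (use moved h in auto)
    then have "is_full g G (\<Union>D)" by (simp add: is_full_def)
    then show "j (\<Union>D) = i (\<Union>D)" by (intro gf B.Union_in_pi0 D)
    show "D \<in> pi0 A.Q" by (rule full_pi0[OF A.Q c D f])
  qed
  then show ?thesis
    using c is_spec_graph_contract[OF T gs dk]
    unfolding spec_contract_eq coproduct_index_iff[OF A.Q] by simp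
qed

text \<open>For an edge that survives in the subgraph, in contrast to \<open>cov_cut_at\<close>:
  here both graphs contain the edge, and it is cut in both.\<close>

lemma cov_cut_at_both:
  assumes g: "is_graph g" and c: "cov d g" and h: "h \<in> halfedges g" "invol d h = invol g h"
  shows "cov (cut_at d h) (cut_at g h)"
proof -
  have "is_graph (cut_at d h)"
    using is_graph_cut_at[OF cov_is_graph[OF c g]] h(1) covD(2)[OF c] by simp
  then have "invol (cut_at d h) (invol (cut_at d h) k) = k" if "k \<in> halfedges g" for k
    using is_graphD(4)[of "cut_at d h" k] that covD(2)[OF c] by simp
  moreover have "cut_at d h = (cut_at g h)\<lparr>invol := invol (cut_at d h)\<rparr>"
  proof -
    have e: "g\<lparr>invol := invol d\<rparr> = d" using c by (simp add: cov_def)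
    have "cut_edges (g\<lparr>invol := I\<rparr>) S = (cut_edges g S')\<lparr>invol := invol (cut_edges (g\<lparr>invol := I\<rparr>) S)\<rparr>"
      for I S S' by (simp add: cut_edges_def)
    from this[of "invol d"] show ?thesis unfolding e .
  qed
  moreover have "invol (cut_at d h) k = k \<or> invol (cut_at d h) k = invol (cut_at g h) k"
    if "k \<in> halfedges g" for k
    using covD(5)[OF c that] h by auto
  moreover have "invol (cut_at d h) k = invol (cut_at g h) k" if "k \<notin> halfedges g" for k
    using covD(7)[OF c that] h by auto
  ultimately show ?thesis unfolding cov_def by auto
qed

text \<open>Surjectivity of \<open>(g, d) \<mapsto> (d, g/d)\<close>. The graph \<open>g\<close>
  keeps the edges of \<open>d\<close> together with those kept by \<open>w\<close>, and its
  components correspond to those of \<open>w\<close> through \<open>Union\<close>.\<close>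

lemma lift_coproduct_index:
  assumes T: "is_theory T" and spec: "is_spec_graph T (G, i)"
    and dk: "(d, k) \<in> coproduct_index T (G, i)"
    and wl: "(w, l) \<in> coproduct_index T (spec_contract (G, i) (d, k))"
  shows "\<exists>g j. (g, j) \<in> coproduct_index T (G, i) \<and> (d, k) \<in> coproduct_index T (g, j) \<and>
    spec_contract (g, j) (d, k) = (w, l)"
proof -
  have gr: "is_graph G" by (rule is_spec_graphD[OF spec])
  interpret A: contraction G d k using dk gr by (rule contractionI)
  have ws: "is_spec_graph T (w, l)" and wc: "cov w A.Q"
    and wf: "\<And>D. D \<in> pi0 w \<Longrightarrow> is_full w A.Q D \<Longrightarrow>
      l D = restrict (\<lambda>D. i (\<Union>D)) (pi0 A.Q) D"
    using wl unfolding spec_contract_eq coproduct_index_iff[OF A.Q] by auto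
  have ds: "is_spec_graph T (d, k)" using dk coproduct_index_iff[OF gr] by auto
  note S = spec[unfolded is_spec_graph_iff[OF T]] and dS = ds[unfolded is_spec_graph_iff[OF T]]
    and wS = ws[unfolded is_spec_graph_iff[OF T]]
  \<comment> \<open>As a covering subgraph of \<open>G/d\<close>, \<open>w\<close> has the
    involution of \<open>G\<close> off its own half-edges, in particular on the edges kept by
    \<open>d\<close>. So the total function \<open>invol w\<close> is already the involution wanted
    for \<open>g\<close>.\<close>
  define g where "g = G\<lparr>invol := invol w\<rparr>"
  define j where "j = restrict (\<lambda>C. l {c \<in> pi0 d. c \<subseteq> C}) (pi0 g)"
  have g_simps: "verts g = verts G" "halfedges g = halfedges G" "attach g = attach G"
    "etype g = etype G" "rtype g = rtype G" "invol g = invol w"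
    by (simp_all add: g_def)
  have moved: "invol w h = invol G h \<and> invol d h = invol G h" if "h \<in> halfedges G" "invol d h \<noteq> h" for h
    using that covD(7)[OF wc, of h] covD(5)[OF A.d_cov that(1)] by (simp add: A.d_simps)
  have fixed: "(invol w h = h \<or> invol w h = invol G h) \<and> invol w (invol w h) = h"
    if "h \<in> halfedges G" "invol d h = h" for h
    using that covD(5,6)[OF wc, of h] by (simp add: A.d_simps)
  have out: "invol w h = invol G h" if "h \<notin> halfedges G" for h
    using that covD(7)[OF wc, of h] by (simp add: A.d_simps)
  have gc: "cov g G"
    unfolding cov_def
  proof (intro conjI ballI allI impI)
    show "g = G\<lparr>invol := invol g\<rparr>" by (simp add: g_def)
    fix h assume h: "h \<in> halfedges G"
    show "invol g h = h \<or> invol g h = invol G h"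
      using moved[OF h] fixed[OF h] by (auto simp: g_simps)
    show "invol g (invol g h) = h"
    proof (cases "invol d h = h")
      case False
      have hi: "invol G h \<in> halfedges G" "invol G (invol G h) = h" using is_graphD(3,4)[OF gr h] by auto
      then have "invol d (invol G h) \<noteq> invol G h"
        using False cov_fixed_invol[OF A.d_cov gr hi(1)] by auto
      then show ?thesis using moved[OF h False] moved[OF hi(1)] hi(2) by (simp add: g_simps)
    qed (use fixed h in \<open>simp add: g_simps\<close>)
  qed (use out in \<open>simp add: g_simps\<close>)
  have gg: "is_graph g" using gc gr by (rule cov_is_graph)
  have dg: "cov d g"
    unfolding cov_def
  proof (intro conjI ballI allI impI)
    have "d = G\<lparr>invol := invol d\<rparr>" using A.d_cov by (simp add: cov_def)
    then show "d = g\<lparr>invol := invol d\<rparr>" by (simp add: g_def)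
    fix h assume "h \<in> halfedges g"
    then have h: "h \<in> halfedges G" by (simp add: g_simps)
    show "invol d h = h \<or> invol d h = invol g h" using moved[OF h] unfolding g_simps by metis
    show "invol d (invol d h) = h" by (rule covD(6)[OF A.d_cov h])
  qed (use out covD(7)[OF A.d_cov] in \<open>simp add: g_simps\<close>)
  interpret B: contraction g d k using gg dg by unfold_locales
  have Qw: "B.Q = w"
  proof -
    have "w = A.Q\<lparr>invol := invol w\<rparr>" using wc by (simp add: cov_def)
    moreover have "B.Q = A.Q\<lparr>invol := invol w\<rparr>"
      by (intro dec_graph.equality) (simp_all add: g_simps)
    ultimately show ?thesis by simp
  qed
  have w_simps: "halfedges w = {h \<in> halfedges G. invol d h = h}" "attach w = (\<lambda>h. conn d `` {attach G h})"
    "rtype w = (\<lambda>C. (residue_type d C, k C))"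
    by (simp_all flip: Qw add: g_simps A.d_simps)
  have parts: "{c \<in> pi0 d. c \<subseteq> C} \<in> pi0 w" "\<Union>{c \<in> pi0 d. c \<subseteq> C} = C"
    "ext_type w {c \<in> pi0 d. c \<subseteq> C} = ext_type g C"
    "comp_ok T (w, l) {c \<in> pi0 d. c \<subseteq> C}" if "C \<in> pi0 g" for C
    using B.Union_preimage[OF that] B.ext_type_contract[OF B.Union_preimage(1)[OF that]] wS Qw
    by auto
  have own_part: "{c \<in> pi0 d. c \<subseteq> C} = {C}" if C: "C \<in> pi0 d" for C
  proof -
    have "c = C" if c: "c \<in> pi0 d" "c \<subseteq> C" for c
    proof -
      obtain x where "x \<in> c" using pi0_nonempty[OF c(1)] by auto
      then show ?thesis using pi0_disjoint[OF A.d c(1) C] c(2) by auto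
    qed
    then show ?thesis using C by blast
  qed
  \<comment> \<open>Such a \<open>C\<close> becomes a vertex of \<open>w\<close> without internal
    edges, so the single-vertex condition on \<open>(w, l)\<close> forces the value stored in its
    refined type, which is \<open>k C\<close>.\<close>
  have own_spec: "l {C} = k C" if C: "C \<in> pi0 d" "C \<in> pi0 g" and fx: "\<And>h. h \<in> halfedges G \<Longrightarrow>
      attach G h \<in> C \<Longrightarrow> invol d h = h \<Longrightarrow> invol w h = h" for C
  proof -
    have "invol w h = h" if "h \<in> halfedges w" "attach w h = C" for h
    proof -
      have h: "h \<in> halfedges G" "invol d h = h" using that by (auto simp: w_simps)
      have "attach G h \<in> C"
        using that(2) mem_class[of "attach G h" d] is_graphD(5)[OF gr h(1)]
        by (simp add: w_simps A.d_simps)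
      then show ?thesis using fx h by blast
    qed
    then show ?thesis
      using parts(4)[OF C(2)] unfolding own_part[OF C(1)] by (simp add: comp_ok_def w_simps)
  qed
  have "is_spec_graph T (g, j)"
    unfolding is_spec_graph_iff[OF T]
  proof (intro conjI ballI)
    show "is_graph g" by (rule gg)
    show "j \<in> extensional (pi0 g)" by (simp add: j_def)
    show "vert_ok T g v" if "v \<in> verts g" for v
      using S that by (simp add: vert_ok_def g_simps vertex_type_of_def)
    show "edge_ok T g h" if "h \<in> halfedges g" for h
    proof -
      have h: "h \<in> halfedges G" using that by (simp add: g_simps)
      \<comment> \<open>A half-edge fixed by \<open>d\<close> is one of \<open>g/d = w\<close> and
        is no bridge there. Any other belongs to an edge of \<open>d\<close>, which is no bridge in
        \<open>d\<close> and so none in the larger graph \<open>g\<close>.\<close>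
      have "nonbridge g h"
      proof (cases "invol d h = h")
        case True
        then have hw: "h \<in> halfedges B.Q" using h by (simp add: A.d_simps)
        then have "nonbridge B.Q h" using wS Qw by (simp add: edge_ok_def)
        then show ?thesis using B.nonbridge_contract[OF hw] by simp
      next
        case False
        then have e: "invol d h = invol g h" using moved[OF h] by (simp add: g_simps)
        have "nonbridge d h" using dS h by (simp add: edge_ok_def A.d_simps)
        then show ?thesis
          using cov_conn[OF is_graph_cut_at[OF gg that] cov_cut_at_both[OF gg dg that e]] e
          by (simp add: nonbridge_def covD(3)[OF dg])
      qed
      moreover have "etype G (invol w h) = etype G h" "etype G h \<in> edge_types T"
        using S h covD(5)[OF gc h] by (auto simp: edge_ok_def g_simps)
      ultimately show ?thesis by (simp add: edge_ok_def g_simps)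
    qed
    show "comp_ok T (g, j) C" if C: "C \<in> pi0 g" for C
    proof -
      \<comment> \<open>Two single-vertex conditions in a row: the one on \<open>d\<close> evaluates
        \<open>k {v}\<close>, and the one on \<open>w\<close>, through \<open>own_spec\<close>,
        identifies \<open>l {{v}}\<close> with it.\<close>
      have "j C = snd (rtype g v)" if v: "C = {v}" and fx: "\<forall>h \<in> halfedges g. attach g h = v \<longrightarrow> invol g h = h" for v
      proof -
        have "{v} \<in> pi0 d"
        proof -
          obtain c where c: "c \<in> pi0 d" "c \<subseteq> {v}" using parts(1)[OF C] pi0_nonempty v by blast
          then have "c = {v}" using pi0_nonempty[OF c(1)] by blast
          then show ?thesis using c by simp
        qed
        moreover have "invol d h = h" if "h \<in> halfedges d" "attach d h = v" for h
          using that fx cov_fixed[OF dg, of h] by (simp add: covD[OF dg])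
        ultimately have "k {v} = snd (rtype d v)"
          using dS by (simp add: comp_ok_def)
        moreover have "l {{v}} = k {v}"
          using own_spec[OF \<open>{v} \<in> pi0 d\<close>] C v fx by (simp add: g_simps)
        ultimately show ?thesis
          using C own_part[OF \<open>{v} \<in> pi0 d\<close>] cov_rtype[OF dg] v by (simp add: j_def)
      qed
      moreover have "(ext_type g C, j C) \<in> refined_types T"
        using parts(3,4)[OF C] C by (simp add: comp_ok_def j_def)
      ultimately show ?thesis by (simp add: comp_ok_def)
    qed
  qed
  note gs = this
  have "j C = i C" if C: "C \<in> pi0 g" and f: "is_full g G C" for C
  proof -
    let ?D = "{c \<in> pi0 d. c \<subseteq> C}"
    have "is_full w A.Q ?D"
      unfolding is_full_def
    proof (intro ballI impI)
      fix h assume "h \<in> halfedges A.Q" "attach A.Q h \<in> ?D"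
      then have "h \<in> halfedges G" "attach G h \<in> C"
        using mem_class[of "attach G h" d] is_graphD(5)[OF gr, of h] by (auto simp: A.d_simps)
      then show "invol w h = invol A.Q h" using f by (simp add: is_full_def g_simps)
    qed
    then have "l ?D = i (\<Union>?D)"
      using wf[OF parts(1)[OF C]] full_pi0[OF A.Q wc parts(1)[OF C]] by simp
    then show ?thesis using parts(2)[OF C] C by (simp add: j_def)
  qed
  then have 1: "(g, j) \<in> coproduct_index T (G, i)" using gs gc coproduct_index_iff[OF gr] by blast
  have "k C = j C" if C: "C \<in> pi0 d" and f: "is_full d g C" for C
  proof -
    have Cg: "C \<in> pi0 g" by (rule full_pi0[OF gg dg C f])
    have "l {C} = k C" by (rule own_spec[OF C Cg]) (use f in \<open>simp add: is_full_def g_simps\<close>)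
    then show ?thesis using Cg own_part[OF C] by (simp add: j_def)
  qed
  then have 2: "(d, k) \<in> coproduct_index T (g, j)" using ds dg coproduct_index_iff[OF gg] by blast
  have "l D = restrict (\<lambda>D. j (\<Union>D)) (pi0 w) D" if "D \<in> pi0 w" for D
    using that B.parts_Union[of D] B.Union_in_pi0[of D] Qw by (simp add: j_def)
  then have "restrict (\<lambda>D. j (\<Union>D)) (pi0 w) = l"
    using is_spec_graphD(2)[OF ws] by (intro extensionalityI[of _ "pi0 w"]) auto
  then have "spec_contract (g, j) (d, k) = (w, l)"
    unfolding spec_contract_eq Qw by simp
  with 1 2 show ?thesis by blast
qed

text \<open>A contraction stores the whole involution of the graph being contracted, so
  \<open>g\<close> can be read off; \<open>j\<close> is recovered because \<open>Union\<close>
  reaches every component of \<open>g\<close>.\<close>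

lemma spec_contract_inj:
  assumes G: "is_graph G"
    and g: "(g, j) \<in> coproduct_index T (G, i)" "(d, k) \<in> coproduct_index T (g, j)"
    and g': "(g', j') \<in> coproduct_index T (G, i)"
    and eq: "spec_contract (g, j) (d, k) = spec_contract (g', j') (d, k)"
  shows "(g, j) = (g', j')"
proof -
  have s: "is_spec_graph T (g, j)" "is_spec_graph T (g', j')" and c: "cov g G" "cov g' G"
    using g g' coproduct_index_iff[OF G] by auto
  interpret contraction g d k using g(2) is_spec_graphD(1)[OF s(1)] by (rule contractionI)
  have e: "Q = dec_contract g' d k" and r: "restrict (\<lambda>D. j (\<Union>D)) (pi0 Q) =
      restrict (\<lambda>D. j' (\<Union>D)) (pi0 (dec_contract g' d k))"
    using eq unfolding spec_contract_eq prod.inject by blast+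
  have "invol g = invol g'" using arg_cong[OF e, of invol] by simp
  then have gg: "g = g'" by (intro cov_eqI[OF c]) simp
  have "j C = j' C" if "C \<in> pi0 g" for C
    using fun_cong[OF r, of "{c \<in> pi0 d. c \<subseteq> C}"] Union_preimage[OF that] e by simp
  then have "j = j'"
    using is_spec_graphD(2)[OF s(1)] is_spec_graphD(2)[OF s(2)] gg
    by (intro extensionalityI[of j "pi0 g"]) auto
  with gg show ?thesis by simp
qed

text \<open>A vertex of the iterated contraction is a set of components of \<open>d\<close> that
  together make up one component of \<open>g\<close>, namely their union.\<close>

lemma contract_contract:
  assumes T: "is_theory T" and spec: "is_spec_graph T (G, i)"
    and g: "(g, j) \<in> coproduct_index T (G, i)" and dk: "(d, k) \<in> coproduct_index T (g, j)"
  shows "emb Union id (spec_contract (spec_contract (G, i) (d, k)) (spec_contract (g, j) (d, k)))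
      (spec_contract (G, i) (g, j))"
    and "Union ` verts (fst (spec_contract (spec_contract (G, i) (d, k)) (spec_contract (g, j) (d, k)))) =
      verts (fst (spec_contract (G, i) (g, j)))"
proof -
  have gr: "is_graph G" by (rule is_spec_graphD[OF spec])
  have gs: "is_spec_graph T (g, j)" and gc: "cov g G"
    using g coproduct_index_iff[OF gr] by auto
  interpret A: contraction G d k
    using coproduct_index_trans[OF gr g dk] gr by (rule contractionI)
  interpret B: contraction g d k
    using dk is_spec_graphD(1)[OF gs] by (rule contractionI)
  interpret M: contraction G g j using g gr by (rule contractionI)
  let ?iQ = "restrict (\<lambda>D. i (\<Union>D)) (pi0 A.Q)" and ?jQ = "restrict (\<lambda>D. j (\<Union>D)) (pi0 B.Q)"
  interpret N: contraction A.Q B.Q ?jQ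
    using spec_contract_in_coproduct_index[OF T spec g dk] A.Q
    unfolding spec_contract_eq by (rule contractionI)
  \<comment> \<open>A half-edge fixed by \<open>g\<close> is also fixed by \<open>d\<close>, so
    contracting in two stages drops the same half-edges and \<open>id\<close> can serve on
    them.\<close>
  have H: "halfedges N.Q = halfedges M.Q"
    using cov_fixed[OF B.d_cov] by (auto simp: covD[OF B.d_cov])
  have "graph_embedding Union id N.Q M.Q"
  proof
    show "inj_on Union (verts N.Q)"
    proof (rule inj_onI)
      fix D D' assume "D \<in> verts N.Q" "D' \<in> verts N.Q" and U: "\<Union>D = \<Union>D'"
      then have "D \<in> pi0 B.Q" "D' \<in> pi0 B.Q" by simp_all
      from B.parts_Union[OF this(1)] B.parts_Union[OF this(2)] show "D = D'" unfolding U by simp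
    qed
    fix h assume h: "h \<in> halfedges N.Q"
    then have "attach G h \<in> verts g" using is_graphD(5)[OF gr] by (simp add: A.d_simps M.d_simps H)
    then show "attach M.Q (id h) = \<Union>(attach N.Q h)"
      using B.Union_class by simp
  next
    fix v assume "v \<in> verts N.Q"
    then show "\<Union>v \<in> verts M.Q" using B.Union_in_pi0 by simp
  qed (use N.Q M.Q H in auto)
  then interpret E: graph_embedding Union id N.Q M.Q .
  have "rtype M.Q (\<Union>D) = rtype N.Q D" if D: "D \<in> verts N.Q" for D
  proof -
    have D: "D \<in> pi0 B.Q" using D by simp
    then show ?thesis
      using residue_type_eq_ext_type[OF B.Q D] residue_type_eq_ext_type[OF B.G B.Union_in_pi0[OF D]]
        B.ext_type_contract[OF D] by simp
  qed
  moreover have "restrict (\<lambda>D. i (\<Union>D)) (pi0 M.Q) (Union ` D) = restrict (\<lambda>D. ?iQ (\<Union>D)) (pi0 N.Q) D"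
    if D: "D \<in> pi0 N.Q" for D
  proof -
    have "\<Union>(Union ` D) = \<Union>(\<Union>D)" by blast
    then show ?thesis using E.pi0_image[OF D] N.Union_in_pi0[OF D] D by simp
  qed
  ultimately show "emb Union id (spec_contract (spec_contract (G, i) (d, k)) (spec_contract (g, j) (d, k)))
      (spec_contract (G, i) (g, j))"
    using E.graph_embedding_axioms unfolding spec_contract_eq emb_def by simp
  have "Union ` pi0 B.Q = pi0 g"
  proof (intro equalityI subsetI)
    fix C assume "C \<in> pi0 g"
    from B.Union_preimage[OF this] show "C \<in> Union ` pi0 B.Q"
      by (intro image_eqI[where x = "{c \<in> pi0 d. c \<subseteq> C}"]) simp_all
  next
    fix C assume "C \<in> Union ` pi0 B.Q"
    then show "C \<in> pi0 g" using B.Union_in_pi0 by blast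
  qed
  then show "Union ` verts (fst (spec_contract (spec_contract (G, i) (d, k)) (spec_contract (g, j) (d, k)))) =
      verts (fst (spec_contract (G, i) (g, j)))"
    unfolding spec_contract_eq by simp
qed

section \<open>Edgeless subgraphs and disjoint unions\<close>

definition edgeless :: "('v, 'h, 'e, 'z) feyn_graph_scheme \<Rightarrow> bool" where
  "edgeless G \<longleftrightarrow> (\<forall>h \<in> halfedges G. invol G h = h)"

lemma edgeless_pi0:
  assumes G: "is_graph G" and e: "edgeless G"
  shows "pi0 G = (\<lambda>v. {v}) ` verts G"
proof -
  have "y = x" if "(x, y) \<in> conn G" for x y
    using that G by (induction rule: conn_induct) (use e in \<open>auto simp: edgeless_def\<close>)
  then have "conn G `` {x} = {x}" if "x \<in> verts G" for x using conn_refl[OF that] by blast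
  then show ?thesis by (auto simp: pi0_iff image_iff)
qed

lemma self_in_coproduct_index:
  assumes "is_spec_graph T (G, i)"
  shows "(G, i) \<in> coproduct_index T (G, i)"
  using assms is_spec_graphD(1)[OF assms] by (simp add: coproduct_index_iff cov_refl)

text \<open>The half-edges of the contraction are those fixed by \<open>g\<close>; if none of them
  is moved by \<open>G\<close>, then nothing was cut, every component is full and the specifications
  agree. In the right counit law this leaves only the term of the whole graph.\<close>

lemma edgeless_contract_iff:
  assumes spec: "is_spec_graph T (G, i)" and g: "(g, m) \<in> coproduct_index T (G, i)"
  shows "edgeless (fst (spec_contract (G, i) (g, m))) \<longleftrightarrow> (g, m) = (G, i)"
proof
  have G: "is_graph G" by (rule is_spec_graphD[OF spec])
  have s: "is_spec_graph T (g, m)" and c: "cov g G"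
    and f: "\<And>C. C \<in> pi0 g \<Longrightarrow> is_full g G C \<Longrightarrow> m C = i C"
    using g coproduct_index_iff[OF G] by auto
  assume e: "edgeless (fst (spec_contract (G, i) (g, m)))"
  have "invol g h = invol G h" if h: "h \<in> halfedges G" for h
  proof (cases "invol g h = h")
    case True
    then have "invol G h = h" using e h by (simp add: edgeless_def spec_contract_eq covD(2)[OF c])
    with True show ?thesis by simp
  qed (use covD(5)[OF c h] in simp)
  then have gG: "g = G" by (rule cov_eqI[OF c cov_refl[OF G]])
  then have "m = i"
    using f is_spec_graphD(2)[OF s] is_spec_graphD(2)[OF spec]
    by (intro extensionalityI[of m "pi0 G"]) (auto simp: is_full_def)
  with gG show "(g, m) = (G, i)" by simp
qed (auto simp: edgeless_def spec_contract_eq)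

text \<open>With all edges cut, contraction only renames \<open>v\<close> to \<open>{v}\<close>, and
  the stored refined types are the original ones. In the left counit law this leaves exactly one
  term, and it is the graph itself.\<close>

lemma edgeless_subgraph:
  assumes T: "is_theory T" and spec: "is_spec_graph T (G, i)"
  obtains g m where "(g, m) \<in> coproduct_index T (G, i)" "edgeless g"
    "\<And>g' m'. (g', m') \<in> coproduct_index T (G, i) \<Longrightarrow> edgeless g' \<Longrightarrow> (g', m') = (g, m)"
    "emb (\<lambda>v. {v}) id (G, i) (spec_contract (G, i) (g, m))"
    "(\<lambda>v. {v}) ` verts G = verts (fst (spec_contract (G, i) (g, m)))"
proof -
  have G: "is_graph G" by (rule is_spec_graphD[OF spec])
  note S = spec[unfolded is_spec_graph_iff[OF T]]
  define g where "g = G\<lparr>invol := (\<lambda>h. if h \<in> halfedges G then h else invol G h)\<rparr>"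
  \<comment> \<open>The single-vertex condition leaves no other choice. The components of
    \<open>g\<close> are singletons, which \<open>the_elem\<close> unpacks.\<close>
  define m where "m = restrict (\<lambda>C. snd (rtype G (the_elem C))) (pi0 g)"
  have c: "cov g G" by (auto simp: cov_def g_def)
  have gg: "is_graph g" using c G by (rule cov_is_graph)
  have e: "edgeless g" by (simp add: edgeless_def g_def)
  have p: "pi0 g = (\<lambda>v. {v}) ` verts G" using edgeless_pi0[OF gg e] covD(1)[OF c] by simp
  have et: "ext_type g {v} = vertex_type_of G v" for v
    by (auto simp: ext_type_def vertex_type_of_def g_def intro!: arg_cong[of _ _ card])
  have ok: "rtype G v = (ext_type g {v}, m {v})" if v: "v \<in> verts G" for v
    using S v p by (simp add: et m_def vert_ok_def prod_eq_iff)
  have "comp_ok T (g, m) {v}" if v: "v \<in> verts G" for v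
  proof -
    have "(ext_type g {v}, m {v}) \<in> refined_types T"
      using S v unfolding ok[OF v, symmetric] by (simp add: vert_ok_def)
    moreover have "m {v} = snd (rtype G v)" using ok[OF v] by simp
    ultimately show ?thesis using cov_rtype[OF c] by (simp add: comp_ok_def)
  qed
  then have ok': "\<forall>C \<in> pi0 g. comp_ok T (g, m) C" using p by simp
  have "is_spec_graph T (g, m)"
    unfolding is_spec_graph_iff[OF T]
  proof (intro conjI ballI)
    show "vert_ok T g v" if "v \<in> verts g" for v
      using S that by (simp add: vert_ok_def vertex_type_of_def g_def)
    show "edge_ok T g h" if "h \<in> halfedges g" for h
      using S that is_graphD(5)[OF gg that] by (simp add: edge_ok_def g_def nonbridge_def conn_refl)
  qed (use gg ok' m_def in auto)
  \<comment> \<open>A full component of the edgeless \<open>g\<close> is a vertex of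
    \<open>G\<close> without internal edges, so the single-vertex condition on \<open>(G, i)\<close>
    gives \<open>i\<close> the same value.\<close>
  moreover have "m C = i C" if C: "C \<in> pi0 g" and f: "is_full g G C" for C
  proof -
    obtain v where v: "C = {v}" "v \<in> verts G" using C p by auto
    have "invol G h = h" if "h \<in> halfedges G" "attach G h = v" for h
      using f that v by (auto simp: is_full_def g_def)
    moreover have "comp_ok T (G, i) {v}" using full_pi0[OF G c C f] S v by simp
    ultimately show ?thesis using ok[OF v(2)] v(1) by (simp add: comp_ok_def)
  qed
  ultimately have gm: "(g, m) \<in> coproduct_index T (G, i)" using c coproduct_index_iff[OF G] by blast
  have uniq: "(g', m') = (g, m)" if "(g', m') \<in> coproduct_index T (G, i)" and e': "edgeless g'" for g' m'
  proof -
    have s: "is_spec_graph T (g', m')" and c': "cov g' G"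
      using that coproduct_index_iff[OF G] by auto
    have "g' = g" by (rule cov_eqI[OF c' c]) (use e e' in \<open>simp add: edgeless_def covD(2)[OF c] covD(2)[OF c']\<close>)
    moreover have "m' {v} = m {v}" if "v \<in> verts G" for v
    proof -
      have "comp_ok T (g', m') {v}" "comp_ok T (g, m) {v}"
        using s gm p that \<open>g' = g\<close> unfolding coproduct_index_iff[OF G] is_spec_graph_iff[OF T] by auto
      then show ?thesis using e \<open>g' = g\<close> by (auto simp: comp_ok_def edgeless_def)
    qed
    ultimately show ?thesis
      using is_spec_graphD(2)[OF s] p by (auto simp: m_def intro!: extensionalityI[of m' "pi0 g"])
  qed
  interpret contraction G g m using gm G by (rule contractionI)
  have "graph_embedding (\<lambda>v. {v}) id G Q"
  proof
    fix h assume h: "h \<in> halfedges G"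
    then show "id h \<in> halfedges Q" using e by (simp add: edgeless_def d_simps)
    have "conn g `` {attach G h} = {attach G h}"
      using class_in_pi0[of "attach G h" g] mem_class[of "attach G h" g] is_graphD(5)[OF G h] p
      by (auto simp: d_simps)
    then show "attach Q (id h) = {attach G h}" by simp
  qed (use G Q p in \<open>auto simp: d_simps\<close>)
  then interpret E: graph_embedding "\<lambda>v. {v}" id G Q .
  have "rtype Q {v} = rtype G v" if "v \<in> verts G" for v
    using residue_type_eq_ext_type[OF gg, of "{v}"] p that ok[OF that] by simp
  moreover have "restrict (\<lambda>D. i (\<Union>D)) (pi0 Q) ((\<lambda>v. {v}) ` C) = i C" if "C \<in> pi0 G" for C
    using E.pi0_image[OF that] by simp
  ultimately have "emb (\<lambda>v. {v}) id (G, i) (spec_contract (G, i) (g, m))"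
    using E.graph_embedding_axioms unfolding spec_contract_eq emb_def by simp
  from that[OF gm e uniq this] show ?thesis by (simp add: spec_contract_eq p)
qed

section \<open>Disjoint unions\<close>

definition dec_union :: "('v, 'h, 'e) dec_graph \<Rightarrow> ('w, 'k, 'e) dec_graph \<Rightarrow> ('v + 'w, 'h + 'k, 'e) dec_graph" where
  "dec_union G G' = \<lparr>verts = verts G <+> verts G', halfedges = halfedges G <+> halfedges G',
     invol = map_sum (invol G) (invol G'), attach = map_sum (attach G) (attach G'),
     etype = case_sum (etype G) (etype G'), rtype = case_sum (rtype G) (rtype G')\<rparr>"

lemma dec_union_simps [simp]:
  "verts (dec_union G G') = verts G <+> verts G'"
  "halfedges (dec_union G G') = halfedges G <+> halfedges G'"
  "invol (dec_union G G') = map_sum (invol G) (invol G')"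
  "attach (dec_union G G') = map_sum (attach G) (attach G')"
  "etype (dec_union G G') = case_sum (etype G) (etype G')"
  "rtype (dec_union G G') = case_sum (rtype G) (rtype G')"
  by (simp_all add: dec_union_def)

lemma disjoint_union_eq:
  "disjoint_union (G, i) (G', i') = (dec_union G G',
     restrict (\<lambda>C. if C \<subseteq> range Inl then i (Inl -` C) else i' (Inr -` C)) (pi0 (dec_union G G')))"
  by (simp add: disjoint_union_def dec_union_def Let_def)

lemma is_graph_dec_union: "is_graph G \<Longrightarrow> is_graph G' \<Longrightarrow> is_graph (dec_union G G')"
  by (auto simp: is_graph_def)

lemma emb_Inl_Inr:
  fixes G :: "('v, 'h, 'e) dec_graph" and G' :: "('w, 'k, 'e) dec_graph"
  assumes G: "is_graph G" and G': "is_graph G'"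
  shows "emb Inl Inl (G, i) (disjoint_union (G, i) (G', i'))"
    and "emb Inr Inr (G', i') (disjoint_union (G, i) (G', i'))"
proof -
  have "graph_embedding Inl Inl G (dec_union G G')" "graph_embedding Inr Inr G' (dec_union G G')"
    using G G' is_graph_dec_union[OF G G'] by (unfold_locales; auto)+
  then interpret l: graph_embedding Inl Inl G "dec_union G G'" + r: graph_embedding Inr Inr G' "dec_union G G'" .
  have vl: "Inl -` Inl ` C = C" "Inr -` Inr ` D = D" for C :: "'v set" and D :: "'w set" by auto
  \<comment> \<open>The specification of a disjoint union tests whether a component lies in
    \<open>range Inl\<close>. A component from the right fails the test because it is
    nonempty.\<close>
  have "\<not> Inr ` D \<subseteq> range (Inl :: 'v \<Rightarrow> 'v + 'w)" if "D \<in> pi0 G'" for D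
    using pi0_nonempty[OF that] by auto
  then show "emb Inl Inl (G, i) (disjoint_union (G, i) (G', i'))"
    "emb Inr Inr (G', i') (disjoint_union (G, i) (G', i'))"
    using l.graph_embedding_axioms r.graph_embedding_axioms l.pi0_image r.pi0_image
    unfolding disjoint_union_eq emb_def by (auto simp: vl)
qed

lemma is_spec_graph_disjoint_union:
  assumes T: "is_theory T" and A: "is_spec_graph T A" and B: "is_spec_graph T B"
  shows "is_spec_graph T (disjoint_union A B)"
proof -
  obtain G i G' i' where [simp]: "A = (G, i)" "B = (G', i')" by (cases A, cases B)
  have "is_graph G" "is_graph G'" using A B is_spec_graphD(1) by auto
  note emb = emb_Inl_Inr[OF this, where i = i and i' = i', unfolded disjoint_union_eq]
  show ?thesis
    unfolding \<open>A = _\<close> \<open>B = _\<close> disjoint_union_eq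
    by (rule is_spec_graph_cover[OF T emb]) (use A B in auto)
qed

lemma inj_on_case_sum:
  assumes "inj_on f A" "inj_on g B" "f ` A \<inter> g ` B = {}"
  shows "inj_on (case_sum f g) (A <+> B)"
proof (rule inj_onI, elim PlusE)
  fix x y a b assume "case_sum f g x = case_sum f g y" "x = Inl a" "y = Inr b" "a \<in> A" "b \<in> B"
  then show "x = y" using assms(3) by auto
next
  fix x y a b assume "case_sum f g x = case_sum f g y" "x = Inr b" "y = Inl a" "a \<in> A" "b \<in> B"
  then have "g b = f a" "a \<in> A" "b \<in> B" by simp_all
  then have "g b \<in> f ` A \<inter> g ` B" by (metis IntI imageI)
  then show "x = y" using assms(3) by simp
qed (use assms(1,2) in \<open>auto dest: inj_onD\<close>)

lemma image_case_sum: "case_sum f g ` (A <+> B) = f ` A \<union> g ` B"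
  unfolding Plus_def image_Un image_image by simp

text \<open>Two embeddings with disjoint images combine into one. The isomorphisms for functoriality
  and associativity of the union, and for its compatibility with contraction, are assembled in this
  way from those on the summands.\<close>

lemma emb_disjoint_union:
  assumes a: "emb f p (A, i) (W, l)" and b: "emb f' p' (B, j) (W, l)"
    and disj: "f ` verts A \<inter> f' ` verts B = {}"
  shows "emb (case_sum f f') (case_sum p p') (disjoint_union (A, i) (B, j)) (W, l)"
proof -
  interpret a: graph_embedding f p A W by (rule embD[OF a])
  interpret b: graph_embedding f' p' B W by (rule embD[OF b])
  note emb = emb_Inl_Inr[OF a.G b.G, where i = i and i' = j, unfolded disjoint_union_eq]
  let ?U = "dec_union A B"
  \<comment> \<open>Half-edges with a common image would be attached to a common vertex of both
    images.\<close>
  have "p h \<noteq> p' k" if "h \<in> halfedges A" "k \<in> halfedges B" for h k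
    using a.attach_p[OF that(1)] b.attach_p[OF that(2)] is_graphD(5)[OF a.G that(1)]
      is_graphD(5)[OF b.G that(2)] disj by (metis IntI empty_iff imageI)
  then have pdisj: "p ` halfedges A \<inter> p' ` halfedges B = {}" by blast
  have "graph_embedding (case_sum f f') (case_sum p p') ?U W"
  proof
    show "is_graph ?U" by (rule is_graph_dec_union[OF a.G b.G])
    show "inj_on (case_sum f f') (verts ?U)"
      using inj_on_case_sum[OF a.inj_f b.inj_f] disj by auto
    show "inj_on (case_sum p p') (halfedges ?U)"
      using inj_on_case_sum[OF a.inj_p b.inj_p] pdisj by simp
    fix k assume k: "k \<in> halfedges W" "attach W k \<in> case_sum f f' ` verts ?U"
    then have "attach W k \<in> f ` verts A \<or> attach W k \<in> f' ` verts B"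
      by (simp add: image_case_sum)
    then have "k \<in> p ` halfedges A \<or> k \<in> p' ` halfedges B"
      using a.open_image[OF k(1)] b.open_image[OF k(1)] by blast
    then show "k \<in> case_sum p p' ` halfedges ?U" by (simp add: image_case_sum)
  qed (use a.K a.f_verts b.f_verts a.p_halfedges b.p_halfedges a.invol_p b.invol_p a.attach_p
      b.attach_p a.etype_p b.etype_p in auto)
  moreover have "rtype W (case_sum f f' v) = rtype ?U v" if "v \<in> verts ?U" for v
    using that embD(2)[OF a] embD(2)[OF b] by auto
  moreover have "l (case_sum f f' ` C) = snd (disjoint_union (A, i) (B, j)) C" if C: "C \<in> pi0 ?U" for C
  proof -
    have "C \<in> image Inl ` pi0 A \<union> image Inr ` pi0 B" using pi0_cover[OF emb] C by auto
    then consider D where "D \<in> pi0 A" "C = Inl ` D" | D where "D \<in> pi0 B" "C = Inr ` D" by auto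
    then show ?thesis
    proof cases
      case 1
      then show ?thesis using embD(3)[OF a, of D] embD(3)[OF emb(1), of D]
        by (simp add: disjoint_union_eq image_image)
    next
      case 2
      then show ?thesis using embD(3)[OF b, of D] embD(3)[OF emb(2), of D]
        by (simp add: disjoint_union_eq image_image)
    qed
  qed
  ultimately show ?thesis by (simp add: emb_def disjoint_union_eq)
qed

lemma disjoint_union_in_coproduct_index:
  assumes T: "is_theory T" and G: "is_graph G" and G': "is_graph G'"
    and g: "(g, m) \<in> coproduct_index T (G, i)" and g': "(g', m') \<in> coproduct_index T (G', i')"
  shows "disjoint_union (g, m) (g', m') \<in> coproduct_index T (disjoint_union (G, i) (G', i'))"
proof -
  have s: "is_spec_graph T (g, m)" "is_spec_graph T (g', m')" and c: "cov g G" "cov g' G'"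
    and f: "\<And>C. C \<in> pi0 g \<Longrightarrow> is_full g G C \<Longrightarrow> m C = i C"
    and f': "\<And>C. C \<in> pi0 g' \<Longrightarrow> is_full g' G' C \<Longrightarrow> m' C = i' C"
    using g g' coproduct_index_iff[OF G] coproduct_index_iff[OF G'] by auto
  have gr: "is_graph g" "is_graph g'" using s is_spec_graphD(1) by auto
  note e = emb_Inl_Inr[OF gr, where i = m and i' = m', unfolded disjoint_union_eq]
  note E = emb_Inl_Inr[OF G G', where i = i and i' = i', unfolded disjoint_union_eq]
  have cU: "cov (dec_union g g') (dec_union G G')"
    unfolding cov_def
  proof (intro conjI ballI allI impI)
    show "dec_union g g' = (dec_union G G')\<lparr>invol := invol (dec_union g g')\<rparr>"
      by (intro dec_graph.equality) (simp_all add: covD[OF c(1)] covD[OF c(2)] cov_rtype[OF c(1)] cov_rtype[OF c(2)])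
    fix h assume h: "h \<in> halfedges (dec_union G G')"
    have "(invol (dec_union g g') h = h \<or> invol (dec_union g g') h = invol (dec_union G G') h) \<and>
      invol (dec_union g g') (invol (dec_union g g') h) = h"
    proof (cases h)
      case (Inl x)
      then have "x \<in> halfedges G" using h by auto
      from covD(5,6)[OF c(1) this] show ?thesis using Inl by auto
    next
      case (Inr x)
      then have "x \<in> halfedges G'" using h by auto
      from covD(5,6)[OF c(2) this] show ?thesis using Inr by auto
    qed
    then show "invol (dec_union g g') h = h \<or> invol (dec_union g g') h = invol (dec_union G G') h"
      "invol (dec_union g g') (invol (dec_union g g') h) = h" by blast+
  next
    fix h assume h: "h \<notin> halfedges (dec_union G G')"
    show "invol (dec_union g g') h = invol (dec_union G G') h"
    proof (cases h)
      case (Inl x)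
      then have "x \<notin> halfedges G" using h by auto
      then show ?thesis using covD(7)[OF c(1)] Inl by simp
    next
      case (Inr x)
      then have "x \<notin> halfedges G'" using h by auto
      then show ?thesis using covD(7)[OF c(2)] Inr by simp
    qed
  qed
  have "snd (disjoint_union (g, m) (g', m')) C = snd (disjoint_union (G, i) (G', i')) C"
    if C: "C \<in> pi0 (dec_union g g')" and fl: "is_full (dec_union g g') (dec_union G G') C" for C
  proof -
    have "C \<in> image Inl ` pi0 g \<union> image Inr ` pi0 g'" using pi0_cover[OF e] C by auto
    then consider D where "D \<in> pi0 g" "C = Inl ` D" | D where "D \<in> pi0 g'" "C = Inr ` D" by auto
    then show ?thesis
    proof cases
      case 1
      have D: "is_full g G D" using fl 1(2) by (force simp: is_full_def)
      show ?thesis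
        using embD(3)[OF e(1) 1(1)] embD(3)[OF E(1) full_pi0[OF G c(1) 1(1) D]] f[OF 1(1) D] 1(2)
        by (simp add: disjoint_union_eq)
    next
      case 2
      have D: "is_full g' G' D" using fl 2(2) by (force simp: is_full_def)
      show ?thesis
        using embD(3)[OF e(2) 2(1)] embD(3)[OF E(2) full_pi0[OF G' c(2) 2(1) D]] f'[OF 2(1) D] 2(2)
        by (simp add: disjoint_union_eq)
    qed
  qed
  then show ?thesis
    using is_spec_graph_disjoint_union[OF T s] cU
    unfolding disjoint_union_eq coproduct_index_iff[OF is_graph_dec_union[OF G G']] by simp
qed

text \<open>The inverse sends a subgraph of the union to its pullbacks along \<open>Inl\<close> and
  \<open>Inr\<close>. Uniqueness of pullbacks gives injectivity, uniqueness of gluing gives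
  surjectivity.\<close>

lemma bij_betw_disjoint_union:
  assumes T: "is_theory T" and A: "is_spec_graph T A" and B: "is_spec_graph T B"
  shows "bij_betw (\<lambda>(g, g'). disjoint_union g g') (coproduct_index T A \<times> coproduct_index T B)
    (coproduct_index T (disjoint_union A B))"
proof -
  obtain G i G' i' where AB: "A = (G, i)" "B = (G', i')" by (cases A, cases B)
  have gr: "is_graph G" "is_graph G'" using A B AB is_spec_graphD(1) by auto
  note E = emb_Inl_Inr[OF gr, where i = i and i' = i', unfolded disjoint_union_eq]
  have gri: "is_graph g" if "(g, m) \<in> coproduct_index T (H, k)" "is_graph H"
    for g m and H :: "('x, 'y, 'a) dec_graph" and k
    using that coproduct_index_iff[OF that(2)] is_spec_graphD(1) by blast
  show ?thesis
    unfolding bij_betw_def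
  proof (intro conjI equalityI subsetI)
    show "inj_on (\<lambda>(g, g'). disjoint_union g g') (coproduct_index T A \<times> coproduct_index T B)"
    proof (rule inj_onI)
      fix u v
      assume uv: "u \<in> coproduct_index T A \<times> coproduct_index T B"
        "v \<in> coproduct_index T A \<times> coproduct_index T B"
        "(\<lambda>(g, g'). disjoint_union g g') u = (\<lambda>(g, g'). disjoint_union g g') v"
      obtain g m g' m' where u: "u = ((g, m), (g', m'))" by (metis surj_pair)
      obtain h n h' n' where v: "v = ((h, n), (h', n'))" by (metis surj_pair)
      have 1: "(g, m) \<in> coproduct_index T (G, i)" "(g', m') \<in> coproduct_index T (G', i')"
        "(h, n) \<in> coproduct_index T (G, i)" "(h', n') \<in> coproduct_index T (G', i')"
        and eq: "disjoint_union (g, m) (g', m') = disjoint_union (h, n) (h', n')"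
        using uv by (simp_all add: u v AB)
      note e = emb_Inl_Inr[OF gri[OF 1(1) gr(1)] gri[OF 1(2) gr(2)], where i = m and i' = m', unfolded eq, unfolded disjoint_union_eq]
      note e' = emb_Inl_Inr[OF gri[OF 1(3) gr(1)] gri[OF 1(4) gr(2)], where i = n and i' = n', unfolded disjoint_union_eq]
      show "u = v"
        unfolding u v using pullback_unique[OF e(1) e'(1) 1(1,3) gr(1)] pullback_unique[OF e(2) e'(2) 1(2,4) gr(2)]
        by simp
    qed
  next
    fix u assume "u \<in> (\<lambda>(g, g'). disjoint_union g g') ` (coproduct_index T A \<times> coproduct_index T B)"
    then show "u \<in> coproduct_index T (disjoint_union A B)"
      using disjoint_union_in_coproduct_index[OF T gr] unfolding AB by auto
  next
    fix u assume "u \<in> coproduct_index T (disjoint_union A B)"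
    then obtain w n where u: "u = (w, n)"
      "(w, n) \<in> coproduct_index T (disjoint_union (G, i) (G', i'))" by (cases u) (simp add: AB)
    note wn = u(2)[unfolded disjoint_union_eq]
    obtain g m where g: "(g, m) \<in> coproduct_index T (G, i)" "emb Inl Inl (g, m) (w, n)"
      using pullback[OF T E(1) wn] by blast
    obtain g' m' where g': "(g', m') \<in> coproduct_index T (G', i')" "emb Inr Inr (g', m') (w, n)"
      using pullback[OF T E(2) wn] by blast
    have gg: "is_graph g" "is_graph g'" using gri[OF g(1) gr(1)] gri[OF g'(1) gr(2)] .
    note e = emb_Inl_Inr[OF gg, where i = m and i' = m', unfolded disjoint_union_eq]
    have "cov g G" "cov g' G'"
      using g(1) g'(1) coproduct_index_iff[OF gr(1)] coproduct_index_iff[OF gr(2)] by auto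
    then have sur: "verts (dec_union G G') \<subseteq> Inl ` verts g \<union> Inr ` verts g'"
      by (auto simp: covD)
    have "(w, n) = disjoint_union (g, m) (g', m')"
      unfolding disjoint_union_eq
      by (rule glue_unique[OF g(2) e(1) g'(2) e(2) wn
          disjoint_union_in_coproduct_index[OF T gr g(1) g'(1), unfolded disjoint_union_eq]
          is_graph_dec_union[OF gr] sur])
    then show "u \<in> (\<lambda>(g, g'). disjoint_union g g') ` (coproduct_index T A \<times> coproduct_index T B)"
      using g(1) g'(1) u(1) AB by auto
  qed
qed

section \<open>Isomorphism classes\<close>

lemma verts_disjoint_union: "verts (fst (disjoint_union A B)) = verts (fst A) <+> verts (fst B)"
  by (cases A, cases B) (simp add: disjoint_union_eq)

lemma is_graph_fst: "is_spec_graph T A \<Longrightarrow> is_graph (fst A)"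
  using is_spec_graphD(1) by (metis prod.collapse)

lemma is_spec_graph_contract':
  assumes "is_theory T" "is_spec_graph T A" "g \<in> coproduct_index T A"
  shows "is_spec_graph T (spec_contract A g)"
  using assms is_spec_graph_contract by (metis prod.collapse)

lemma coproduct_index_spec: "g \<in> coproduct_index T A \<Longrightarrow> is_spec_graph T g"
  by (simp add: coproduct_index_def)

lemma finite_index: "is_theory T \<Longrightarrow> is_spec_graph T A \<Longrightarrow> finite (coproduct_index T A)"
  using finite_coproduct_index by (metis prod.collapse)

lemma emb_edgeless:
  assumes "emb f p A B" "f ` verts (fst A) = verts (fst B)"
  shows "edgeless (fst A) \<longleftrightarrow> edgeless (fst B)"
proof -
  obtain G i K j where [simp]: "A = (G, i)" "B = (K, j)" by (cases A, cases B)
  have e: "emb f p (G, i) (K, j)" and sur: "f ` verts G = verts K" using assms by auto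
  interpret graph_embedding f p G K by (rule embD[OF e])
  show ?thesis
    using fixed_iff emb_surj_halfedges[OF e sur] by (auto simp: edgeless_def simp flip: emb_surj_halfedges[OF e sur])
qed

lemma emb_cov_surj:
  assumes "(g, m) \<in> coproduct_index T (A, i)" "(w, n) \<in> coproduct_index T (W, l)"
    and "is_graph A" "is_graph W" and "f ` verts A = verts W"
  shows "f ` verts g = verts w"
proof -
  have "cov g A" "cov w W"
    using assms(1,2) unfolding coproduct_index_iff[OF assms(3)] coproduct_index_iff[OF assms(4)] by blast+
  then show ?thesis using assms(5) by (simp add: covD(1))
qed

lemma pullback_injection:
  assumes T: "is_theory T" and A: "is_spec_graph T (A, i)" and W: "is_spec_graph T (W, l)"
    and e: "emb f p (A, i) (W, l)" and sur: "f ` verts A = verts W"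
  shows "\<exists>q. inj_on q (coproduct_index T (W, l)) \<and> q ` coproduct_index T (W, l) \<subseteq> coproduct_index T (A, i) \<and>
    (\<forall>w \<in> coproduct_index T (W, l). emb f p (q w) w)"
proof -
  interpret graph_embedding f p A W by (rule embD[OF e])
  have "\<forall>w \<in> coproduct_index T (W, l). \<exists>g. g \<in> coproduct_index T (A, i) \<and> emb f p g w"
    using pullback[OF T e] by fast
  then obtain q where q: "\<And>w. w \<in> coproduct_index T (W, l) \<Longrightarrow> q w \<in> coproduct_index T (A, i) \<and> emb f p (q w) w"
    by metis
  have "w = w'" if w: "w \<in> coproduct_index T (W, l)" "w' \<in> coproduct_index T (W, l)" and eq: "q w = q w'" for w w'
  proof -
    obtain w1 n w1' n' where ww: "w = (w1, n)" "w' = (w1', n')" by (cases w, cases w')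
    obtain g m where g: "q w = (g, m)" by (cases "q w")
    have gi: "(g, m) \<in> coproduct_index T (A, i)" and e: "emb f p (g, m) (w1, n)" "emb f p (g, m) (w1', n')"
      using q[OF w(1)] q[OF w(2)] unfolding eq[symmetric] g unfolding ww by auto
    have "f ` verts g = verts w1" using emb_cov_surj[OF gi w(1)[unfolded ww] G K sur] .
    moreover have "verts w1 = verts W"
      using w(1) unfolding ww coproduct_index_iff[OF K] by (simp add: covD(1))
    ultimately show ?thesis
      unfolding ww
      by (intro glue_unique[OF e e w(1)[unfolded ww(1)] w(2)[unfolded ww(2)] K]) simp
  qed
  then have "inj_on q (coproduct_index T (W, l))" by (intro inj_onI)
  then show ?thesis using q by blast
qed

text \<open>The sum over subgraphs does not change along an isomorphism. Pullback is injective, and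
  it is available both for the isomorphism and for its inverse; the index sets being finite, it is a
  bijection.\<close>

lemma coproduct_sum_iso:
  fixes F :: "_ \<Rightarrow> 'z::comm_monoid_add"
  assumes T: "is_theory T" and A: "is_spec_graph T A" and W: "is_spec_graph T W"
    and e: "emb f p A W" and sur: "f ` verts (fst A) = verts (fst W)"
    and F: "\<And>g w. g \<in> coproduct_index T A \<Longrightarrow> w \<in> coproduct_index T W \<Longrightarrow> emb f p g w \<Longrightarrow> F g = F' w"
  shows "sum F (coproduct_index T A) = sum F' (coproduct_index T W)"
proof -
  obtain G i K j where AW: "A = (G, i)" "W = (K, j)" by (cases A, cases W)
  note A' = A[unfolded AW] and W' = W[unfolded AW] and e' = e[unfolded AW] and sur' = sur[unfolded AW fst_conv]
  obtain q where q: "inj_on q (coproduct_index T W)" "q ` coproduct_index T W \<subseteq> coproduct_index T A"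
    "\<And>w. w \<in> coproduct_index T W \<Longrightarrow> emb f p (q w) w"
    using pullback_injection[OF T A' W' e' sur'] unfolding AW by blast
  obtain q' where q': "inj_on q' (coproduct_index T A)" "q' ` coproduct_index T A \<subseteq> coproduct_index T W"
    using pullback_injection[OF T W' A' emb_inverse[OF e' sur']] unfolding AW by blast
  \<comment> \<open>Counting replaces a check that the two pullbacks are mutually inverse:
    \<open>q'\<close> bounds the size of the target of \<open>q\<close>.\<close>
  have "card (coproduct_index T A) \<le> card (q ` coproduct_index T W)"
    using card_inj_on_le[OF q' finite_index[OF T W]] by (simp add: card_image q(1))
  then have "q ` coproduct_index T W = coproduct_index T A"
    by (intro card_seteq finite_index[OF T A] q(2))
  then have "sum F (coproduct_index T A) = (\<Sum>w \<in> coproduct_index T W. F (q w))"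
    using sum.reindex[OF q(1), of F] by simp
  also have "\<dots> = sum F' (coproduct_index T W)"
    by (intro sum.cong refl F) (use q(2,3) in blast)+
  finally show ?thesis .
qed

lemma iso_contract:
  assumes T: "is_theory T" and A: "is_spec_graph T A" and W: "is_spec_graph T W"
    and e: "emb f p A W" and sur: "f ` verts (fst A) = verts (fst W)"
    and g: "g \<in> coproduct_index T A" and w: "w \<in> coproduct_index T W" and e': "emb f p g w"
  shows "iso_class T g = iso_class T w"
    and "iso_class T (spec_contract A g) = iso_class T (spec_contract W w)"
proof -
  obtain G i K j where AW: "A = (G, i)" "W = (K, j)" by (cases A, cases W)
  obtain g1 m w1 n where gw: "g = (g1, m)" "w = (w1, n)" by (cases g, cases w)
  have gr: "is_graph G" "is_graph K" using A W is_graph_fst unfolding AW by fastforce+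
  have s: "f ` verts g1 = verts w1"
    using emb_cov_surj[OF g[unfolded AW gw] w[unfolded AW gw] gr] sur by (simp add: AW)
  show "iso_class T g = iso_class T w"
    by (rule emb_iso_class[OF e' _ coproduct_index_spec[OF g] coproduct_index_spec[OF w]]) (simp add: gw s)
  have "pi0 w1 = image f ` pi0 g1"
  proof (rule equalityI)
    show "pi0 w1 \<subseteq> image f ` pi0 g1"
      using pi0_cover[OF e'[unfolded gw] e'[unfolded gw]] s by auto
    interpret graph_embedding f p g1 w1 by (rule embD[OF e'[unfolded gw]])
    show "image f ` pi0 g1 \<subseteq> pi0 w1" using pi0_image by blast
  qed
  then show "iso_class T (spec_contract A g) = iso_class T (spec_contract W w)"
    using emb_iso_class[OF emb_contract[OF e[unfolded AW] e'[unfolded gw] g[unfolded AW gw] w[unfolded AW gw]]]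
      is_spec_graph_contract'[OF T A g] is_spec_graph_contract'[OF T W w]
    by (simp add: AW gw spec_contract_eq)
qed

text \<open>Supplies the isomorphism by which \<open>rep\<close> is eliminated from the structure
  maps.\<close>

lemma rep_iso_class:
  fixes A :: "('v, 'h, 'e) spec_graph"
  assumes T: "is_theory T" and A: "is_spec_graph T A"
  obtains f p where "is_spec_graph T (rep (iso_class T A))" "emb f p A (rep (iso_class T A))"
    "f ` verts (fst A) = verts (fst (rep (iso_class T A)))"
proof -
  obtain G i where G: "A = (G, i)" by (cases A)
  note A' = A[unfolded G]
  obtain K :: "(nat, nat, 'e) dec_graph" and j f p
    where K: "is_spec_graph T (K, j)" "emb f p (G, i) (K, j)" "f ` verts G = verts K"
    using nat_representative[OF T A'] by metis
  then have "(K, j) \<in> iso_class T A"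
    using spec_iso_iff[OF is_spec_graphD(1)[OF A'] is_spec_graphD(1)[OF K(1)]]
    unfolding iso_class_def G by blast
  then have "rep (iso_class T A) \<in> iso_class T A" unfolding rep_def by (rule someI)
  moreover obtain R r where R: "rep (iso_class T A) = (R, r)" by (cases "rep (iso_class T A)")
  ultimately have r: "is_spec_graph T (R, r)" "spec_iso (G, i) (R, r)"
    unfolding iso_class_def G by auto
  then obtain f p where "emb f p (G, i) (R, r)" "f ` verts G = verts R"
    using spec_iso_iff[OF is_spec_graphD(1)[OF A'] is_spec_graphD(1)[OF r(1)]] by blast
  then show ?thesis using that[of f p] r(1) unfolding R by (simp add: G)
qed

lemma iso_class_in_spec_classes:
  fixes A :: "('v, 'h, 'e) spec_graph"
  assumes T: "is_theory T" and A: "is_spec_graph T A"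
  shows "iso_class T A \<in> spec_classes T"
proof -
  obtain f p where "is_spec_graph T (rep (iso_class T A))" "emb f p A (rep (iso_class T A))"
    "f ` verts (fst A) = verts (fst (rep (iso_class T A)))" by (rule rep_iso_class[OF T A])
  then show ?thesis using emb_iso_class[of f p A "rep (iso_class T A)" T] A
    unfolding spec_classes_def by blast
qed

lemma disjoint_union_iso:
  assumes T: "is_theory T" and A: "is_spec_graph T A" and B: "is_spec_graph T B"
    and A': "is_spec_graph T A'" and B': "is_spec_graph T B'"
    and a: "emb f p A A'" "f ` verts (fst A) = verts (fst A')"
    and b: "emb f' p' B B'" "f' ` verts (fst B) = verts (fst B')"
  shows "iso_class T (disjoint_union A B) = iso_class T (disjoint_union A' B')"
proof -
  obtain G i K j where AB: "A = (G, i)" "B = (K, j)" by (cases A, cases B)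
  obtain G' i' K' j' where AB': "A' = (G', i')" "B' = (K', j')" by (cases A', cases B')
  have gr: "is_graph G'" "is_graph K'" using A' B' is_spec_graphD(1) unfolding AB' by blast+
  note e = emb_Inl_Inr[OF gr, where i = i' and i' = j', unfolded disjoint_union_eq]
  have "emb (case_sum (Inl \<circ> f) (Inr \<circ> f')) (case_sum (Inl \<circ> p) (Inr \<circ> p'))
      (disjoint_union A B) (disjoint_union A' B')"
    unfolding AB AB' disjoint_union_eq[of G' i' K' j']
    by (rule emb_disjoint_union[OF emb_compose[OF a(1)[unfolded AB AB'] e(1)] emb_compose[OF b(1)[unfolded AB AB'] e(2)]]) auto
  then show ?thesis
  proof (rule emb_iso_class)
    show "case_sum (Inl \<circ> f) (Inr \<circ> f') ` verts (fst (disjoint_union A B)) =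
        verts (fst (disjoint_union A' B'))"
      unfolding verts_disjoint_union image_case_sum
      unfolding Plus_def image_comp[symmetric] a(2) b(2) by (rule refl)
  qed (intro is_spec_graph_disjoint_union T A B A' B')+
qed

lemma disjoint_union_assoc:
  assumes T: "is_theory T" and A: "is_spec_graph T A" and B: "is_spec_graph T B" and C: "is_spec_graph T C"
  shows "iso_class T (disjoint_union A (disjoint_union B C)) =
    iso_class T (disjoint_union (disjoint_union A B) C)"
proof -
  obtain G i K j L k where ABC: "A = (G, i)" "B = (K, j)" "C = (L, k)" by (cases A, cases B, cases C)
  obtain U u where U: "disjoint_union A B = (U, u)" by (cases "disjoint_union A B")
  obtain W w where W: "disjoint_union (disjoint_union A B) C = (W, w)"
    by (cases "disjoint_union (disjoint_union A B) C")
  obtain V v where V: "disjoint_union B C = (V, v)" by (cases "disjoint_union B C")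
  have gr: "is_graph G" "is_graph K" "is_graph L" using A B C is_spec_graphD(1) unfolding ABC by blast+
  have gU: "is_graph U"
    using is_spec_graph_disjoint_union[OF T A B] is_spec_graphD(1) unfolding U by blast
  note e1 = emb_Inl_Inr[OF gr(1,2), where i = i and i' = j, folded ABC, unfolded U]
  note e2 = emb_Inl_Inr[OF gU gr(3), where i = u and i' = k, folded ABC, folded U, unfolded W]
  note e1 = e1[unfolded ABC] and e2 = e2[unfolded U, unfolded ABC]
  \<comment> \<open>The inclusions of the three summands into \<open>W\<close>. The associativity
    isomorphism is built from them by two uses of \<open>emb_disjoint_union\<close>.\<close>
  note c = emb_compose[OF e1(1) e2(1)] emb_compose[OF e1(2) e2(1)] e2(2)
  have "emb (case_sum (Inl \<circ> Inr) Inr) (case_sum (Inl \<circ> Inr) Inr) (disjoint_union (K, j) (L, k)) (W, w)"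
    by (rule emb_disjoint_union[OF c(2,3)]) auto
  then have d: "emb (case_sum (Inl \<circ> Inr) Inr) (case_sum (Inl \<circ> Inr) Inr) (V, v) (W, w)"
    using V by (simp add: ABC)
  have vV: "verts V = verts K <+> verts L" using verts_disjoint_union[of B C] V by (simp add: ABC)
  have "emb (case_sum (Inl \<circ> Inl) (case_sum (Inl \<circ> Inr) Inr)) (case_sum (Inl \<circ> Inl) (case_sum (Inl \<circ> Inr) Inr))
    (disjoint_union (G, i) (V, v)) (W, w)"
    by (rule emb_disjoint_union[OF c(1) d]) (auto simp: vV)
  then have "emb (case_sum (Inl \<circ> Inl) (case_sum (Inl \<circ> Inr) Inr)) (case_sum (Inl \<circ> Inl) (case_sum (Inl \<circ> Inr) Inr))
    (disjoint_union A (disjoint_union B C)) (disjoint_union (disjoint_union A B) C)"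
    unfolding W V by (simp add: ABC)
  then show ?thesis
    by (rule emb_iso_class)
      (simp_all add: verts_disjoint_union is_spec_graph_disjoint_union T A B C image_case_sum
        Plus_def image_Un image_image Un_assoc)
qed

text \<open>The components of a disjoint union are the images of the components of its two parts, so
  taking images under \<open>Inl\<close> and \<open>Inr\<close> identifies the vertices of the two
  graphs.\<close>

lemma disjoint_union_contract:
  assumes T: "is_theory T" and A: "is_spec_graph T A" and B: "is_spec_graph T B"
    and g: "g \<in> coproduct_index T A" and g': "g' \<in> coproduct_index T B"
  shows "iso_class T (disjoint_union (spec_contract A g) (spec_contract B g')) =
    iso_class T (spec_contract (disjoint_union A B) (disjoint_union g g'))"
proof -
  obtain G i K j where AB: "A = (G, i)" "B = (K, j)" by (cases A, cases B)
  obtain d m d' m' where gg: "g = (d, m)" "g' = (d', m')" by (cases g, cases g')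
  obtain U u where U: "disjoint_union A B = (U, u)" by (cases "disjoint_union A B")
  obtain W w where W: "disjoint_union g g' = (W, w)" by (cases "disjoint_union g g'")
  have gr: "is_graph G" "is_graph K" using A B is_spec_graphD(1) unfolding AB by blast+
  have gd: "is_graph d" "is_graph d'"
    using g g' coproduct_index_spec is_spec_graphD(1) unfolding gg by blast+
  have idx: "disjoint_union g g' \<in> coproduct_index T (disjoint_union A B)"
    using disjoint_union_in_coproduct_index[OF T gr g[unfolded AB gg] g'[unfolded AB gg]]
    by (simp add: AB gg)
  note e = emb_Inl_Inr[OF gr, where i = i and i' = j, folded AB, unfolded U, unfolded AB]
  note e' = emb_Inl_Inr[OF gd, where i = m and i' = m', folded gg, unfolded W, unfolded gg]
  note c = emb_contract[OF e(1) e'(1) g[unfolded AB gg] idx[unfolded U W]]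
    emb_contract[OF e(2) e'(2) g'[unfolded AB gg] idx[unfolded U W]]
  have sur: "pi0 W = image Inl ` pi0 d \<union> image Inr ` pi0 d'"
  proof (rule equalityI)
    have "verts W = verts d <+> verts d'" using verts_disjoint_union[of g g'] unfolding W unfolding gg by simp
    then show "pi0 W \<subseteq> image Inl ` pi0 d \<union> image Inr ` pi0 d'"
      by (intro pi0_cover[OF e']) auto
    interpret l: graph_embedding Inl Inl d W by (rule embD[OF e'(1)])
    interpret r: graph_embedding Inr Inr d' W by (rule embD[OF e'(2)])
    show "image Inl ` pi0 d \<union> image Inr ` pi0 d' \<subseteq> pi0 W" using l.pi0_image r.pi0_image by blast
  qed
  \<comment> \<open>The empty set has the same image under \<open>Inl\<close> and
    \<open>Inr\<close>, so disjointness rests on components being nonempty.\<close>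
  have "image Inl ` pi0 d \<inter> image Inr ` pi0 d' = {}"
    using pi0_nonempty by fastforce
  then have "emb (case_sum (image Inl) (image Inr)) (case_sum Inl Inr)
      (disjoint_union (spec_contract A g) (spec_contract B g'))
      (spec_contract (disjoint_union A B) (disjoint_union g g'))"
    using emb_disjoint_union[OF c[unfolded spec_contract_eq]]
    unfolding U W unfolding AB gg spec_contract_eq by simp
  then show ?thesis
  proof (rule emb_iso_class)
    show "case_sum (image Inl) (image Inr) ` verts (fst (disjoint_union (spec_contract A g) (spec_contract B g'))) =
      verts (fst (spec_contract (disjoint_union A B) (disjoint_union g g')))"
      unfolding verts_disjoint_union image_case_sum U W unfolding AB gg spec_contract_eq using sur by simp
    show "is_spec_graph T (disjoint_union (spec_contract A g) (spec_contract B g'))"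
      by (intro is_spec_graph_disjoint_union T is_spec_graph_contract' A B g g')
    show "is_spec_graph T (spec_contract (disjoint_union A B) (disjoint_union g g'))"
      by (intro is_spec_graph_contract' T is_spec_graph_disjoint_union A B idx)
  qed
qed

section \<open>The structure maps on generators\<close>

abbreviation lin :: "('a cvec \<Rightarrow> 'b cvec) \<Rightarrow> bool" where
  "lin \<equiv> Vector_Spaces.linear smul smul"

lemma linearD:
  assumes "Vector_Spaces.linear smul s f"
  shows "f (x + y) = f x + f y" "f (smul c x) = s c (f x)" "f (\<Sum>a\<in>A. g a) = (\<Sum>a\<in>A. f (g a))"
proof -
  interpret Vector_Spaces.linear smul s f by fact
  show "f (x + y) = f x + f y" "f (smul c x) = s c (f x)" "f (\<Sum>a\<in>A. g a) = (\<Sum>a\<in>A. f (g a))"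
    by (rule add scale sum)+
qed

lemma linear_comp:
  "lin f \<Longrightarrow> Vector_Spaces.linear smul s g \<Longrightarrow> Vector_Spaces.linear smul s (\<lambda>x. g (f x))"
  using Vector_Spaces.linear_compose[of smul smul f s g] by (simp add: o_def)

lemma lin_id: "lin (\<lambda>x. x)"
  by (rule linear_smulI[OF vector_space_smul]) simp_all

text \<open>The bialgebra identities are linear in each argument; this reduces them to basis vectors
  from \<open>B\<close>, hence to statements about single specified graphs.\<close>

lemma linear_eq_on:
  assumes f: "Vector_Spaces.linear smul s f" and g: "Vector_Spaces.linear smul s g"
    and eq: "\<And>b. b \<in> B \<Longrightarrow> f (bas b) = g (bas b)" and x: "x \<in> free_space B"
  shows "f x = g x"
proof -
  have "f (\<Sum>b \<in> Poly_Mapping.keys x. smul (Poly_Mapping.lookup x b) (bas b)) =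
    g (\<Sum>b \<in> Poly_Mapping.keys x. smul (Poly_Mapping.lookup x b) (bas b))"
    unfolding linearD[OF f] linearD[OF g]
    using x eq by (intro sum.cong) (auto simp: free_space_def)
  then show ?thesis by (simp flip: expand_bas)
qed

text \<open>For bilinear maps written as nested linear extensions, \<open>linear_lin_ext\<close>
  gives linearity in the outer argument; this gives it in the inner one.\<close>

lemma lin_lin_ext_arg:
  assumes "\<And>a. lin (\<phi> a)"
  shows "lin (\<lambda>y. lin_ext (\<lambda>a. \<phi> a y) x)"
proof (rule linear_smulI[OF vector_space_smul])
  interpret V: vector_space "smul :: complex \<Rightarrow> 'c cvec \<Rightarrow> 'c cvec" by (rule vector_space_smul)
  show "lin_ext (\<lambda>a. \<phi> a (y + z)) x = lin_ext (\<lambda>a. \<phi> a y) x + lin_ext (\<lambda>a. \<phi> a z) x" for y z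
    by (simp add: lin_ext_def linearD[OF assms] V.scale_right_distrib sum.distrib)
  show "lin_ext (\<lambda>a. \<phi> a (smul c y)) x = smul c (lin_ext (\<lambda>a. \<phi> a y) x)" for c y
    by (simp add: lin_ext_def linearD[OF assms] V.scale_sum_right mult.commute)
qed

lemma free_space_add: "x \<in> free_space B \<Longrightarrow> y \<in> free_space B \<Longrightarrow> x + y \<in> free_space B"
  unfolding free_space_def using keys_add[of x y] by blast

lemma free_space_zero: "0 \<in> free_space B"
  by (simp add: free_space_def)

lemma free_space_smul: "x \<in> free_space B \<Longrightarrow> smul c x \<in> free_space B"
  unfolding free_space_def by (auto simp: in_keys_iff lookup_smul)

lemma free_space_sum: "(\<And>a. a \<in> A \<Longrightarrow> f a \<in> free_space B) \<Longrightarrow> (\<Sum>a\<in>A. f a) \<in> free_space B"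
  by (induction A rule: infinite_finite_induct) (auto intro: free_space_add free_space_zero)

lemma free_space_bas: "b \<in> B \<Longrightarrow> bas b \<in> free_space B"
  by (simp add: free_space_def)

lemma lin_free_space:
  assumes f: "lin f" and b: "\<And>b. b \<in> B \<Longrightarrow> f (bas b) \<in> free_space C" and x: "x \<in> free_space B"
  shows "f x \<in> free_space C"
proof -
  have "f (\<Sum>b \<in> Poly_Mapping.keys x. smul (Poly_Mapping.lookup x b) (bas b)) \<in> free_space C"
    unfolding linearD[OF f]
    using x b by (intro free_space_sum free_space_smul) (auto simp: free_space_def)
  then show ?thesis by (simp flip: expand_bas)
qed

lemma linear_betweenI:
  assumes "lin f" "\<And>b. b \<in> B \<Longrightarrow> f (bas b) \<in> free_space C"
  shows "linear_between B C f"
  unfolding linear_between_def using linearD[OF assms(1)] lin_free_space[OF assms] by blast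

lemma lin_tensor_mult1: "lin (\<lambda>z. tensor_mult m z w)"
  unfolding tensor_mult_def by (rule linear_lin_ext)

lemma lin_tensor_mult2: "lin (tensor_mult m z)"
  unfolding tensor_mult_def case_prod_unfold by (intro lin_lin_ext_arg linear_lin_ext)

lemma lin_graph_mult1: "lin (\<lambda>x. graph_mult T x y)"
  unfolding graph_mult_def by (rule linear_lin_ext)

lemma lin_graph_mult2: "lin (graph_mult T x)"
  unfolding graph_mult_def by (intro lin_lin_ext_arg linear_lin_ext)

lemma lin_coproduct: "lin (graph_coproduct T)"
  unfolding graph_coproduct_def by (rule linear_lin_ext)

lemma tensor_gen: "tensor (gen T g) (gen T h) = bas (iso_class T g, iso_class T h)"
  by (simp add: gen_def tensor_bas)

lemma graph_mult_gen:
  assumes T: "is_theory T" and A: "is_spec_graph T A" and B: "is_spec_graph T B"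
  shows "graph_mult T (gen T A) (gen T B) = gen T (disjoint_union A B)"
proof -
  obtain f p where a: "is_spec_graph T (rep (iso_class T A))" "emb f p A (rep (iso_class T A))"
    "f ` verts (fst A) = verts (fst (rep (iso_class T A)))" by (rule rep_iso_class[OF T A])
  obtain f' p' where b: "is_spec_graph T (rep (iso_class T B))" "emb f' p' B (rep (iso_class T B))"
    "f' ` verts (fst B) = verts (fst (rep (iso_class T B)))" by (rule rep_iso_class[OF T B])
  show ?thesis
    unfolding graph_mult_def gen_def lin_ext_bas
    by (simp add: disjoint_union_iso[OF T A B a(1) b(1) a(2,3) b(2,3)])
qed

text \<open>Independence of the representative: \<open>coproduct_sum_iso\<close> carries the sum
  along the isomorphism from \<open>A\<close> to \<open>rep\<close>, and \<open>iso_contract\<close>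
  matches the terms.\<close>

lemma graph_coproduct_gen:
  assumes T: "is_theory T" and A: "is_spec_graph T A"
  shows "graph_coproduct T (gen T A) =
    (\<Sum>g \<in> coproduct_index T A. tensor (gen T g) (gen T (spec_contract A g)))"
proof -
  obtain f p where a: "is_spec_graph T (rep (iso_class T A))" "emb f p A (rep (iso_class T A))"
    "f ` verts (fst A) = verts (fst (rep (iso_class T A)))" by (rule rep_iso_class[OF T A])
  show ?thesis
    unfolding graph_coproduct_def lin_ext_bas gen_def
    by (rule sym, rule coproduct_sum_iso[OF T A a])
      (simp add: iso_contract[OF T A a])
qed

lemma gen_in_free_space:
  "is_theory T \<Longrightarrow> is_spec_graph T A \<Longrightarrow> gen T A \<in> free_space (spec_classes T)"
  unfolding gen_def by (intro free_space_bas iso_class_in_spec_classes)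

lemma spec_classesE:
  assumes "b \<in> spec_classes T"
  obtains A :: "(nat, nat, 'e) spec_graph" where "is_spec_graph T A" "bas b = gen T A"
  using assms unfolding spec_classes_def gen_def by blast

lemma coassociative:
  assumes T: "is_theory T" and A: "is_spec_graph T A"
  shows "tensor_assoc (tensor_map (graph_coproduct T) id (graph_coproduct T (gen T A))) =
    tensor_map id (graph_coproduct T) (graph_coproduct T (gen T A))"
proof -
  let ?I = "coproduct_index T"
  let ?F = "\<lambda>(d, w). bas (iso_class T d, iso_class T w,
    iso_class T (spec_contract (spec_contract A d) w)) :: ('a spec_class \<times> 'a spec_class \<times> 'a spec_class) cvec"
  have fin: "finite (?I A)" by (rule finite_index[OF T A])
  note Q = is_spec_graph_contract'[OF T A]
  have lmap: "lin (tensor_map f g)" for f :: "'x cvec \<Rightarrow> 'y cvec" and g :: "'z cvec \<Rightarrow> 'w cvec"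
    unfolding tensor_map_def by (rule linear_lin_ext)
  have lass: "lin tensor_assoc" unfolding tensor_assoc_def by (rule linear_lin_ext)
  note lt1 = linearD(3)[OF tensor_bilinear(2)] and lt2 = linearD(3)[OF tensor_bilinear(1)]
  have "tensor_assoc (tensor_map (graph_coproduct T) id (graph_coproduct T (gen T A))) =
    (\<Sum>g \<in> ?I A. tensor_assoc (tensor (graph_coproduct T (gen T g)) (gen T (spec_contract A g))))"
    unfolding graph_coproduct_gen[OF T A] tensor_gen linearD(3)[OF lmap] linearD(3)[OF lass]
    by (simp add: tensor_map_def lin_ext_bas gen_def)
  also have "\<dots> = (\<Sum>g \<in> ?I A. \<Sum>d \<in> ?I g.
      bas (iso_class T d, iso_class T (spec_contract g d), iso_class T (spec_contract A g)))"
    by (intro sum.cong refl)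
      (simp add: graph_coproduct_gen[OF T coproduct_index_spec] lt1 linearD(3)[OF lass] tensor_gen,
        simp add: gen_def tensor_bas tensor_assoc_def lin_ext_bas)
  also have "\<dots> = (\<Sum>(g, d) \<in> Sigma (?I A) ?I.
      bas (iso_class T d, iso_class T (spec_contract g d), iso_class T (spec_contract A g)))"
    by (intro sum.Sigma fin ballI) (rule finite_index[OF T coproduct_index_spec])
  \<comment> \<open>Only the third factor changes, from \<open>A/g\<close> to the isomorphic
    \<open>(A/d)/(g/d)\<close>; the first two factors are literally the same.\<close>
  also have "\<dots> = (\<Sum>(g, d) \<in> Sigma (?I A) ?I. ?F (d, spec_contract g d))"
  proof (rule sum.cong[OF refl])
    fix x assume "x \<in> Sigma (?I A) ?I"
    moreover obtain g j d k where x: "x = ((g, j), (d, k))" by (metis surj_pair)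
    ultimately have gd: "(g, j) \<in> ?I A" "(d, k) \<in> ?I (g, j)" by simp_all
    obtain G i where G: "A = (G, i)" by (cases A)
    have dA: "(d, k) \<in> ?I A"
      using coproduct_index_trans[OF is_spec_graphD(1)[OF A[unfolded G]]] gd unfolding G by blast
    have "iso_class T (spec_contract (spec_contract A (d, k)) (spec_contract (g, j) (d, k))) =
      iso_class T (spec_contract A (g, j))"
      using emb_iso_class[OF contract_contract[OF T A[unfolded G] gd(1)[unfolded G] gd(2)]]
        is_spec_graph_contract'[OF T Q[OF dA], of "spec_contract (g, j) (d, k)"]
        spec_contract_in_coproduct_index[OF T A[unfolded G] gd(1)[unfolded G] gd(2)] Q[OF gd(1)]
      unfolding G by blast
    then show "(case x of (g, d) \<Rightarrow>
        bas (iso_class T d, iso_class T (spec_contract g d), iso_class T (spec_contract A g))) =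
      (case x of (g, d) \<Rightarrow> ?F (d, spec_contract g d))" by (simp add: x)
  qed
  \<comment> \<open>The reindexing takes place on actual graphs, not on classes, so every chain is
    counted exactly once. For a fixed \<open>d\<close>, the graph \<open>g\<close> is determined by
    \<open>g/d\<close>.\<close>
  also have "\<dots> = (\<Sum>q \<in> Sigma (?I A) (\<lambda>d. ?I (spec_contract A d)). ?F q)"
  proof -
    obtain G i where G: "A = (G, i)" by (cases A)
    note gr = is_spec_graphD(1)[OF A[unfolded G]]
    have inj: "inj_on (\<lambda>(g, d). (d, spec_contract g d)) (Sigma (?I A) ?I)"
      using spec_contract_inj[OF gr] unfolding G by (fastforce intro!: inj_onI)
    have "(\<lambda>(g, d). (d, spec_contract g d)) ` Sigma (?I A) ?I = Sigma (?I A) (\<lambda>d. ?I (spec_contract A d))"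
    proof (intro equalityI subsetI)
      fix x assume "x \<in> (\<lambda>(g, d). (d, spec_contract g d)) ` Sigma (?I A) ?I"
      then obtain g d where x: "x = (d, spec_contract g d)" "g \<in> ?I A" "d \<in> ?I g" by auto
      obtain g1 j d1 k where gd: "g = (g1, j)" "d = (d1, k)" by (cases g, cases d)
      show "x \<in> Sigma (?I A) (\<lambda>d. ?I (spec_contract A d))"
        using x coproduct_index_trans[OF gr] spec_contract_in_coproduct_index[OF T A[unfolded G]]
        unfolding gd G by blast
    next
      fix x assume "x \<in> Sigma (?I A) (\<lambda>d. ?I (spec_contract A d))"
      then obtain d w where x: "x = (d, w)" "d \<in> ?I A" "w \<in> ?I (spec_contract A d)" by auto
      obtain d1 k w1 l where dw: "d = (d1, k)" "w = (w1, l)" by (cases d, cases w)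
      obtain g j where "(g, j) \<in> ?I A" "d \<in> ?I (g, j)" "spec_contract (g, j) d = w"
        using lift_coproduct_index[OF T A[unfolded G]] x(2,3) unfolding dw G by blast
      then show "x \<in> (\<lambda>(g, d). (d, spec_contract g d)) ` Sigma (?I A) ?I"
        unfolding x(1) by (intro image_eqI[of _ _ "((g, j), d)"]) auto
    qed
    then have "bij_betw (\<lambda>(g, d). (d, spec_contract g d)) (Sigma (?I A) ?I)
        (Sigma (?I A) (\<lambda>d. ?I (spec_contract A d)))" using inj by (simp add: bij_betw_def)
    from sum.reindex_bij_betw[OF this, of ?F] show ?thesis by (simp add: case_prod_unfold)
  qed
  also have "\<dots> = (\<Sum>d \<in> ?I A. \<Sum>w \<in> ?I (spec_contract A d). ?F (d, w))"
  proof -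
    have "\<forall>d \<in> ?I A. finite (?I (spec_contract A d))" using finite_index[OF T Q] by blast
    from sum.Sigma[OF fin this, of "\<lambda>d w. ?F (d, w)"] show ?thesis by simp
  qed
  also have "\<dots> = (\<Sum>d \<in> ?I A. tensor (gen T d) (graph_coproduct T (gen T (spec_contract A d))))"
    by (intro sum.cong refl) (simp add: graph_coproduct_gen[OF T Q] lt2 tensor_gen, simp add: gen_def tensor_bas)
  also have "\<dots> = tensor_map id (graph_coproduct T) (graph_coproduct T (gen T A))"
    unfolding graph_coproduct_gen[OF T A] tensor_gen linearD(3)[OF lmap]
    by (simp add: tensor_map_def lin_ext_bas gen_def)
  finally show ?thesis .
qed

lemma coproduct_mult:
  assumes T: "is_theory T" and A: "is_spec_graph T A" and B: "is_spec_graph T B"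
  shows "graph_coproduct T (gen T (disjoint_union A B)) =
    tensor_mult (graph_mult T) (graph_coproduct T (gen T A)) (graph_coproduct T (gen T B))"
proof -
  let ?I = "coproduct_index T"
  have *: "tensor_mult (graph_mult T) (bas (iso_class T g, iso_class T (spec_contract A g)))
      (bas (iso_class T h, iso_class T (spec_contract B h))) =
      tensor (gen T (disjoint_union g h)) (gen T (spec_contract (disjoint_union A B) (disjoint_union g h)))"
    if g: "g \<in> ?I A" and h: "h \<in> ?I B" for g h
    using graph_mult_gen[OF T coproduct_index_spec[OF g] coproduct_index_spec[OF h]]
      graph_mult_gen[OF T is_spec_graph_contract'[OF T A g] is_spec_graph_contract'[OF T B h]]
      disjoint_union_contract[OF T A B g h]
    by (simp add: tensor_mult_def lin_ext_bas gen_def)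
  have "tensor_mult (graph_mult T) (graph_coproduct T (gen T A)) (graph_coproduct T (gen T B)) =
    (\<Sum>g \<in> ?I A. \<Sum>h \<in> ?I B.
      tensor (gen T (disjoint_union g h)) (gen T (spec_contract (disjoint_union A B) (disjoint_union g h))))"
    unfolding graph_coproduct_gen[OF T A] graph_coproduct_gen[OF T B] tensor_gen
      linearD(3)[OF lin_tensor_mult1] linearD(3)[OF lin_tensor_mult2]
    by (subst sum.swap) (simp add: * tensor_gen cong: sum.cong)
  also have "\<dots> = (\<Sum>x \<in> ?I A \<times> ?I B. (\<lambda>u. tensor (gen T u) (gen T (spec_contract (disjoint_union A B) u)))
      ((\<lambda>(g, h). disjoint_union g h) x))"
    by (simp add: sum.cartesian_product case_prod_unfold)
  also have "\<dots> = graph_coproduct T (gen T (disjoint_union A B))"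
    unfolding graph_coproduct_gen[OF T is_spec_graph_disjoint_union[OF T A B]]
    by (rule sum.reindex_bij_betw[OF bij_betw_disjoint_union[OF T A B]])
  finally show ?thesis by simp
qed

section \<open>The bialgebra\<close>

text \<open>Support on the empty graph alone would not do: an edgeless graph is its own only
  specified covering subgraph and is isomorphic to its contraction by itself. It is therefore
  group-like, and the counit has to be 1 on it.\<close>

definition counit :: "'e spec_class cvec \<Rightarrow> complex" where
  "counit x = (\<Sum>X \<in> Poly_Mapping.keys x.
     Poly_Mapping.lookup x X * (if edgeless (fst (rep X)) then 1 else 0))"

lemma vector_space_complex: "vector_space ((*) :: complex \<Rightarrow> complex \<Rightarrow> complex)"
  by unfold_locales (simp_all add: algebra_simps)

lemma linear_counit: "Vector_Spaces.linear smul (*) counit"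
  using linear_extension(1)[OF vector_space_complex, of "\<lambda>X. if edgeless (fst (rep X)) then 1 else 0"]
  unfolding counit_def .

lemma counit_gen:
  assumes T: "is_theory T" and A: "is_spec_graph T A"
  shows "counit (gen T A) = (if edgeless (fst A) then 1 else 0)"
proof -
  obtain f p where a: "is_spec_graph T (rep (iso_class T A))" "emb f p A (rep (iso_class T A))"
    "f ` verts (fst A) = verts (fst (rep (iso_class T A)))" by (rule rep_iso_class[OF T A])
  show ?thesis
    using linear_extension(2)[OF vector_space_complex, where b = "iso_class T A" and
        \<phi> = "\<lambda>X. if edgeless (fst (rep X)) then 1 else 0"]
      emb_edgeless[OF a(2,3)]
    unfolding counit_def gen_def by simp
qed

lemma empty_spec_graph:
  fixes E :: "(nat, nat, 'e) spec_graph"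
  assumes T: "is_theory T" and E: "E = empty_spec_graph"
  shows "is_spec_graph T E" "edgeless (fst E)" "verts (fst E) = {}"
proof -
  obtain G i where G: "E = (G, i)" by (cases E)
  have s: "verts G = {}" "halfedges G = {}" "i = (\<lambda>_. undefined)"
    using E unfolding G empty_spec_graph_def by auto
  show "edgeless (fst E)" "verts (fst E) = {}" by (simp_all add: G s edgeless_def)
  have "pi0 G = {}" by (simp add: pi0_def quotient_def s)
  then show "is_spec_graph T E" unfolding G is_spec_graph_iff[OF T] by (simp add: is_graph_def s)
qed

lemma
  assumes T: "is_theory T" and A: "is_spec_graph T A" and E: "is_spec_graph T E"
    and e: "verts (fst E) = {}"
  shows disjoint_union_empty_left: "iso_class T (disjoint_union E A) = iso_class T A"
    and disjoint_union_empty_right: "iso_class T (disjoint_union A E) = iso_class T A"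
proof -
  obtain G i where G: "A = (G, i)" by (cases A)
  obtain N n where N: "E = (N, n)" by (cases E)
  have gr: "is_graph G" "is_graph N" using A E is_spec_graphD(1) unfolding G N by blast+
  have l: "emb Inr Inr A (disjoint_union E A)" and r: "emb Inl Inl A (disjoint_union A E)"
    unfolding G N using emb_Inl_Inr(2)[OF gr(2,1)] emb_Inl_Inr(1)[OF gr] by blast+
  show "iso_class T (disjoint_union E A) = iso_class T A"
    by (rule emb_iso_class[OF l _ A is_spec_graph_disjoint_union[OF T E A], symmetric])
      (simp add: verts_disjoint_union e Plus_def)
  show "iso_class T (disjoint_union A E) = iso_class T A"
    by (rule emb_iso_class[OF r _ A is_spec_graph_disjoint_union[OF T A E], symmetric])
      (simp add: verts_disjoint_union e Plus_def)
qed

lemma contract_edgeless_gen: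
  assumes T: "is_theory T" and A: "is_spec_graph T A"
  obtains g where "g \<in> coproduct_index T A" "gen T (spec_contract A g) = gen T A"
    "\<And>h. h \<in> coproduct_index T A \<Longrightarrow> edgeless (fst h) \<longleftrightarrow> h = g"
proof -
  obtain G i where G: "A = (G, i)" by (cases A)
  obtain g m where g: "(g, m) \<in> coproduct_index T (G, i)" "edgeless g"
    "\<And>g' m'. (g', m') \<in> coproduct_index T (G, i) \<Longrightarrow> edgeless g' \<Longrightarrow> (g', m') = (g, m)"
    "emb (\<lambda>v. {v}) id (G, i) (spec_contract (G, i) (g, m))"
    "(\<lambda>v. {v}) ` verts G = verts (fst (spec_contract (G, i) (g, m)))"
    using edgeless_subgraph[OF T A[unfolded G]] by metis
  have "iso_class T (G, i) = iso_class T (spec_contract (G, i) (g, m))"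
    using emb_iso_class[OF g(4) _ A[unfolded G] is_spec_graph_contract[OF T A[unfolded G] g(1)]] g(5)
    by simp
  moreover have "edgeless (fst h) \<longleftrightarrow> h = (g, m)" if "h \<in> coproduct_index T A" for h
    using that g(2) g(3)[of "fst h" "snd h"] unfolding G by auto
  ultimately show ?thesis using that[of "(g, m)"] g(1) unfolding G gen_def by simp
qed

lemma counit_left:
  assumes T: "is_theory T" and A: "is_spec_graph T A"
  shows "lin_ext (\<lambda>(a, b). smul (counit (bas a)) (bas b)) (graph_coproduct T (gen T A)) = gen T A"
proof -
  let ?I = "coproduct_index T A"
  interpret V: vector_space "smul :: complex \<Rightarrow> 'a spec_class cvec \<Rightarrow> 'a spec_class cvec"
    by (rule vector_space_smul)
  obtain g where g: "g \<in> ?I" "gen T (spec_contract A g) = gen T A"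
    "\<And>h. h \<in> ?I \<Longrightarrow> edgeless (fst h) \<longleftrightarrow> h = g"
    using contract_edgeless_gen[OF T A] by metis
  have "lin_ext (\<lambda>(a, b). smul (counit (bas a)) (bas b)) (graph_coproduct T (gen T A)) =
    (\<Sum>h \<in> ?I. smul (counit (gen T h)) (gen T (spec_contract A h)))"
    unfolding graph_coproduct_gen[OF T A] linearD(3)[OF linear_lin_ext] tensor_gen
    by (simp add: lin_ext_bas gen_def)
  also have "\<dots> = (\<Sum>h \<in> ?I. if h = g then gen T A else 0)"
    by (rule sum.cong[OF refl]) (simp add: counit_gen[OF T coproduct_index_spec] g)
  finally show ?thesis using finite_index[OF T A] g(1) by simp
qed

lemma counit_right:
  assumes T: "is_theory T" and A: "is_spec_graph T A"
  shows "lin_ext (\<lambda>(a, b). smul (counit (bas b)) (bas a)) (graph_coproduct T (gen T A)) = gen T A"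
proof -
  let ?I = "coproduct_index T A"
  interpret V: vector_space "smul :: complex \<Rightarrow> 'a spec_class cvec \<Rightarrow> 'a spec_class cvec"
    by (rule vector_space_smul)
  obtain G i where G: "A = (G, i)" by (cases A)
  have e: "edgeless (fst (spec_contract A h)) \<longleftrightarrow> h = A" if "h \<in> ?I" for h
    using edgeless_contract_iff[OF A[unfolded G], of "fst h" "snd h"] that unfolding G by simp
  have "lin_ext (\<lambda>(a, b). smul (counit (bas b)) (bas a)) (graph_coproduct T (gen T A)) =
    (\<Sum>h \<in> ?I. smul (counit (gen T (spec_contract A h))) (gen T h))"
    unfolding graph_coproduct_gen[OF T A] linearD(3)[OF linear_lin_ext] tensor_gen
    by (simp add: lin_ext_bas gen_def)
  also have "\<dots> = (\<Sum>h \<in> ?I. if h = A then gen T A else 0)"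
    by (rule sum.cong[OF refl]) (simp add: counit_gen[OF T is_spec_graph_contract'[OF T A]] e)
  finally show ?thesis
    using finite_index[OF T A] self_in_coproduct_index[OF A[unfolded G]] G by simp
qed

lemma coproduct_unit:
  assumes T: "is_theory T"
  shows "graph_coproduct T (graph_unit T) = tensor (graph_unit T) (graph_unit T)"
proof -
  let ?E = "empty_spec_graph :: (nat, nat, 'a) spec_graph"
  note E = empty_spec_graph[OF T refl]
  have self: "?E \<in> coproduct_index T ?E"
    using self_in_coproduct_index[of T "fst ?E" "snd ?E"] E(1) by simp
  obtain g where g: "gen T (spec_contract ?E g) = gen T ?E"
    "\<And>h. h \<in> coproduct_index T ?E \<Longrightarrow> edgeless (fst h) \<longleftrightarrow> h = g"
    using contract_edgeless_gen[OF T E(1)] by metis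
  have gE: "g = ?E" using g(2)[OF self] E(2) by simp
  \<comment> \<open>Every subgraph of the empty graph is edgeless, and the edgeless subgraph is
    unique.\<close>
  have "h = ?E" if "h \<in> coproduct_index T ?E" for h
  proof -
    have "halfedges (fst h) = {}"
      using that by (auto simp: coproduct_index_def spec_covering_subgraph_def covering_subgraph_def
          empty_spec_graph_def)
    then show ?thesis using g(2)[OF that] gE by (simp add: edgeless_def)
  qed
  then have "coproduct_index T ?E = {?E}" using self by blast
  then show ?thesis
    using g(1) gE by (simp add: graph_unit_def graph_coproduct_gen[OF T E(1)])
qed

lemma unital_algebra_graphs:
  fixes T :: "'e field_theory"
  assumes T: "is_theory T"
  shows "unital_algebra (spec_classes T) (graph_mult T) (graph_unit T)"
proof -
  let ?B = "spec_classes T" and ?F = "free_space (spec_classes T)" and ?m = "graph_mult T"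
  let ?E = "empty_spec_graph :: (nat, nat, 'e) spec_graph"
  note E = empty_spec_graph[OF T refl]
  have bb: "?m (bas a) (bas b) \<in> ?F" if a: "a \<in> ?B" and b: "b \<in> ?B" for a b
  proof -
    obtain A B :: "(nat, nat, 'e) spec_graph"
      where *: "is_spec_graph T A" "bas a = gen T A" "is_spec_graph T B" "bas b = gen T B"
      using spec_classesE[OF a] spec_classesE[OF b] by metis
    show ?thesis
      unfolding *(2,4) graph_mult_gen[OF T *(1,3)]
      by (rule gen_in_free_space[OF T is_spec_graph_disjoint_union[OF T *(1,3)]])
  qed
  have xb: "?m x (bas b) \<in> ?F" if "x \<in> ?F" "b \<in> ?B" for x b
    by (rule lin_free_space[OF lin_graph_mult1 bb that(1)]) (use that in auto)
  have bx: "?m (bas b) x \<in> ?F" if "x \<in> ?F" "b \<in> ?B" for x b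
    by (rule lin_free_space[OF lin_graph_mult2 bb that(1)]) (use that in auto)
  have bbb: "?m (?m (bas a) (bas b)) (bas c) = ?m (bas a) (?m (bas b) (bas c))"
    if a: "a \<in> ?B" and b: "b \<in> ?B" and c: "c \<in> ?B" for a b c
  proof -
    obtain A B C :: "(nat, nat, 'e) spec_graph"
      where *: "is_spec_graph T A" "bas a = gen T A" "is_spec_graph T B" "bas b = gen T B"
        "is_spec_graph T C" "bas c = gen T C"
      using spec_classesE[OF a] spec_classesE[OF b] spec_classesE[OF c] by metis
    then show ?thesis
      using disjoint_union_assoc[OF T *(1,3,5)]
      by (simp add: graph_mult_gen T is_spec_graph_disjoint_union) (simp add: gen_def)
  qed
  \<comment> \<open>One argument at a time is reduced to basis vectors, with the others held
    fixed.\<close>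
  have "?m (?m x y) z = ?m x (?m y z)" if x: "x \<in> ?F" and y: "y \<in> ?F" and z: "z \<in> ?F" for x y z
  proof (rule linear_eq_on[OF linear_comp[OF lin_graph_mult1 lin_graph_mult1] lin_graph_mult1 _ x])
    fix a assume a: "a \<in> ?B"
    show "?m (?m (bas a) y) z = ?m (bas a) (?m y z)"
    proof (rule linear_eq_on[OF linear_comp[OF lin_graph_mult2 lin_graph_mult1]
          linear_comp[OF lin_graph_mult1 lin_graph_mult2] _ y])
      fix b assume b: "b \<in> ?B"
      show "?m (?m (bas a) (bas b)) z = ?m (bas a) (?m (bas b) z)"
        by (rule linear_eq_on[OF lin_graph_mult2 linear_comp[OF lin_graph_mult2 lin_graph_mult2] _ z])
          (rule bbb[OF a b])
    qed
  qed
  moreover have "?m (graph_unit T) x = x \<and> ?m x (graph_unit T) = x" if x: "x \<in> ?F" for x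
  proof
    have "?m (graph_unit T) (bas a) = bas a \<and> ?m (bas a) (graph_unit T) = bas a" if a: "a \<in> ?B" for a
    proof -
      obtain A :: "(nat, nat, 'e) spec_graph" where A: "is_spec_graph T A" "bas a = gen T A"
        using spec_classesE[OF a] .
      then show ?thesis
        using disjoint_union_empty_left[OF T A(1) E(1,3)] disjoint_union_empty_right[OF T A(1) E(1,3)]
        by (simp add: graph_unit_def graph_mult_gen T E(1)) (simp add: gen_def)
    qed
    then show "?m (graph_unit T) x = x" "?m x (graph_unit T) = x"
      using linear_eq_on[OF lin_graph_mult2 lin_id _ x, of T "graph_unit T"]
        linear_eq_on[OF lin_graph_mult1 lin_id _ x, of T "graph_unit T"] by blast+
  qed
  moreover have "graph_unit T \<in> ?F"
    unfolding graph_unit_def by (rule gen_in_free_space[OF T E(1)])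
  ultimately show ?thesis
    unfolding unital_algebra_def
    using linear_betweenI[OF lin_graph_mult1 bx] linear_betweenI[OF lin_graph_mult2 xb] by blast
qed

lemma counital_coalgebra_graphs:
  fixes T :: "'e field_theory"
  assumes T: "is_theory T"
  shows "counital_coalgebra (spec_classes T) (graph_coproduct T) counit"
proof -
  let ?B = "spec_classes T" and ?F = "free_space (spec_classes T)" and ?D = "graph_coproduct T"
  have lmap: "lin (tensor_map f g)" for f :: "'x cvec \<Rightarrow> 'y cvec" and g :: "'z cvec \<Rightarrow> 'w cvec"
    unfolding tensor_map_def by (rule linear_lin_ext)
  have lass: "lin tensor_assoc" unfolding tensor_assoc_def by (rule linear_lin_ext)
  have "?D (bas a) \<in> free_space (?B \<times> ?B)" if a: "a \<in> ?B" for a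
  proof -
    obtain A :: "(nat, nat, 'e) spec_graph" where A: "is_spec_graph T A" "bas a = gen T A"
      using spec_classesE[OF a] .
    show ?thesis
      unfolding A(2) graph_coproduct_gen[OF T A(1)] tensor_gen
      by (intro free_space_sum free_space_bas SigmaI iso_class_in_spec_classes T
          is_spec_graph_contract'[OF T A(1)]) (auto dest: coproduct_index_spec)
  qed
  then have "linear_between ?B (?B \<times> ?B) ?D" by (rule linear_betweenI[OF lin_coproduct])
  moreover have "linear_form ?B counit"
    unfolding linear_form_def using linearD(1,2)[OF linear_counit] by blast
  moreover have "tensor_assoc (tensor_map ?D id (?D x)) = tensor_map id ?D (?D x)" if x: "x \<in> ?F" for x
  proof (rule linear_eq_on[OF linear_comp[OF linear_comp[OF lin_coproduct lmap] lass]
        linear_comp[OF lin_coproduct lmap] _ x])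
    fix a assume a: "a \<in> ?B"
    obtain A :: "(nat, nat, 'e) spec_graph" where A: "is_spec_graph T A" "bas a = gen T A"
      using spec_classesE[OF a] .
    show "tensor_assoc (tensor_map ?D id (?D (bas a))) = tensor_map id ?D (?D (bas a))"
      unfolding A(2) by (rule coassociative[OF T A(1)])
  qed
  moreover have "lin_ext (\<lambda>(a, b). smul (counit (bas a)) (bas b)) (?D x) = x" if x: "x \<in> ?F" for x
  proof (rule linear_eq_on[OF linear_comp[OF lin_coproduct linear_lin_ext] lin_id _ x])
    fix a assume a: "a \<in> ?B"
    obtain A :: "(nat, nat, 'e) spec_graph" where A: "is_spec_graph T A" "bas a = gen T A"
      using spec_classesE[OF a] .
    show "lin_ext (\<lambda>(a, b). smul (counit (bas a)) (bas b)) (?D (bas a)) = bas a"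
      unfolding A(2) by (rule counit_left[OF T A(1)])
  qed
  moreover have "lin_ext (\<lambda>(a, b). smul (counit (bas b)) (bas a)) (?D x) = x" if x: "x \<in> ?F" for x
  proof (rule linear_eq_on[OF linear_comp[OF lin_coproduct linear_lin_ext] lin_id _ x])
    fix a assume a: "a \<in> ?B"
    obtain A :: "(nat, nat, 'e) spec_graph" where A: "is_spec_graph T A" "bas a = gen T A"
      using spec_classesE[OF a] .
    show "lin_ext (\<lambda>(a, b). smul (counit (bas b)) (bas a)) (?D (bas a)) = bas a"
      unfolding A(2) by (rule counit_right[OF T A(1)])
  qed
  ultimately show ?thesis unfolding counital_coalgebra_def by blast
qed

lemma bialgebra_graphs:
  fixes T :: "'e field_theory"
  assumes T: "is_theory T"
  shows "bialgebra (spec_classes T) (graph_mult T) (graph_unit T) (graph_coproduct T) counit"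
proof -
  let ?B = "spec_classes T" and ?F = "free_space (spec_classes T)" and ?m = "graph_mult T"
    and ?D = "graph_coproduct T"
  have "?D (?m (bas a) (bas b)) = tensor_mult ?m (?D (bas a)) (?D (bas b)) \<and>
    counit (?m (bas a) (bas b)) = counit (bas a) * counit (bas b)"
    if a: "a \<in> ?B" and b: "b \<in> ?B" for a b
  proof -
    obtain A B :: "(nat, nat, 'e) spec_graph"
      where *: "is_spec_graph T A" "bas a = gen T A" "is_spec_graph T B" "bas b = gen T B"
      using spec_classesE[OF a] spec_classesE[OF b] by metis
    obtain G i K j where AB: "A = (G, i)" "B = (K, j)" by (cases A, cases B)
    have "edgeless (fst (disjoint_union A B)) \<longleftrightarrow> edgeless (fst A) \<and> edgeless (fst B)"
      unfolding AB disjoint_union_eq by (simp add: edgeless_def Plus_def ball_Un)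
    then show ?thesis
      using *(1,3)
      by (simp add: * graph_mult_gen[OF T *(1,3)] coproduct_mult[OF T *(1,3)] counit_gen T
          is_spec_graph_disjoint_union)
  qed
  note gens = this
  have cm: "Vector_Spaces.linear smul (*) (\<lambda>x. counit x * c)"
    "Vector_Spaces.linear smul (*) (\<lambda>x. c * counit x)" for c
    by (rule linear_smulI[OF vector_space_complex];
        simp add: linearD(1,2)[OF linear_counit] distrib_left distrib_right)+
  have "?D (?m x y) = tensor_mult ?m (?D x) (?D y)" if x: "x \<in> ?F" and y: "y \<in> ?F" for x y
  proof (rule linear_eq_on[OF linear_comp[OF lin_graph_mult1 lin_coproduct]
        linear_comp[OF lin_coproduct lin_tensor_mult1] _ x])
    fix a assume a: "a \<in> ?B"
    show "?D (?m (bas a) y) = tensor_mult ?m (?D (bas a)) (?D y)"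
      by (rule linear_eq_on[OF linear_comp[OF lin_graph_mult2 lin_coproduct]
            linear_comp[OF lin_coproduct lin_tensor_mult2] _ y]) (use gens[OF a] in blast)
  qed
  moreover have "counit (?m x y) = counit x * counit y" if x: "x \<in> ?F" and y: "y \<in> ?F" for x y
  proof (rule linear_eq_on[OF linear_comp[OF lin_graph_mult1 linear_counit] cm(1) _ x])
    fix a assume a: "a \<in> ?B"
    show "counit (?m (bas a) y) = counit (bas a) * counit y"
      by (rule linear_eq_on[OF linear_comp[OF lin_graph_mult2 linear_counit] cm(2) _ y])
        (use gens[OF a] in blast)
  qed
  moreover have "counit (graph_unit T) = 1"
    unfolding graph_unit_def using counit_gen[OF T] empty_spec_graph(1,2)[OF T refl] by metis
  ultimately show ?thesis
    unfolding bialgebra_def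
    using unital_algebra_graphs[OF T] counital_coalgebra_graphs[OF T] coproduct_unit[OF T] by blast
qed

text \<open>The structure maps are defined through \<open>rep\<close>. The first two conjuncts tie
  them to concatenation and to the sum over subgraphs for graphs over arbitrary vertex and half-edge
  types, so that the third concerns the intended structure.\<close>

theorem theorem2:
  fixes T :: "'e field_theory"
  assumes "is_theory T"
  shows "(\<forall>(G :: ('v, 'h, 'e) spec_graph) (G' :: ('w, 'k, 'e) spec_graph).
            is_spec_graph T G \<longrightarrow> is_spec_graph T G' \<longrightarrow>
            graph_mult T (gen T G) (gen T G') = gen T (disjoint_union G G')) \<and>
         (\<forall>G :: ('v, 'h, 'e) spec_graph. is_spec_graph T G \<longrightarrow>
            graph_coproduct T (gen T G) =
              (\<Sum>g \<in> coproduct_index T G. tensor (gen T g) (gen T (spec_contract G g)))) \<and>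
         (\<exists>\<epsilon>. bialgebra (spec_classes T) (graph_mult T) (graph_unit T) (graph_coproduct T) \<epsilon>)"
  using graph_mult_gen[OF assms] graph_coproduct_gen[OF assms] bialgebra_graphs[OF assms] by blast

end
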